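(* Consider the setting of the context: a polygonal domain $\Omega\subset\mathbb R^2$, meshes satisfying (G1) and (G2), diffusion coefficient and data satisfying (K) and (D), and uniform degree $p\in\mathbb N$, $p\ge1$. Let $\widetilde u$ and $(\boldsymbol\sigma,u)$ be the solutions of the continuous primal and mixed problems, and let $\widetilde u_n$ and $(\boldsymbol\sigma_n,u_n)$ be the solutions of the primal and mixed virtual element methods. For $K\in\mathcal T_n$ let $$\eta_{K}^2:=\|\kappa^{1/2}\nabla\widetilde\Pi^\nabla_p\widetilde u_n+\kappa^{-1/2}\boldsymbol\Pi^0_p\boldsymbol\sigma_n\|_{0,K}^2+\widetilde S^K((I-\widetilde\Pi^\nabla_p)\widetilde u_n,(I-\widetilde\Pi^\nabla_p)\widetilde u_n)+S^K((\mathbf I-\boldsymbol\Pi^0_p)\boldsymbol\sigma_n,(\mathbf I-\boldsymbol\Pi^0_p)\boldsymbol\sigma_n).$$ Then, for every $K\in\mathcal T_n$, $$\begin{aligned}\eta_{K}^2\le{}&4(1+\widetilde\alpha^* )\|\kappa^{1/2}\nabla(\widetilde u-\widetilde u_n)\|_{0,K}^2+2(2+\widetilde\alpha^* )\|\kappa^{1/2}\nabla(\widetilde u-\widetilde\Pi^\nabla_p\widetilde u)\|_{0,K}^2\\&+4(1+\alpha^* )\|\kappa^{-1/2}(\boldsymbol\sigma-\boldsymbol\sigma_n)\|_{0,K}^2+2(2+\alpha^* )\|\kappa^{-1/2}(\boldsymbol\sigma-\boldsymbol\Pi^0_p\boldsymbol\sigma)\|_{0,K}^2.\end{aligned}$$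
   Context: Notation: $\|\cdot\|_{0,D}$, $(\cdot,\cdot)_{0,D}$ are the $L^2(D)$ norm and inner product; $\mathbb P_\ell$ denotes polynomials of total degree at most $\ell$ ($\mathbb P_{-1}=\{0\}$); $\operatorname{div}\boldsymbol\tau=\partial_x\tau_1+\partial_y\tau_2$, $\operatorname{rot}\boldsymbol\tau=\partial_y\tau_1-\partial_x\tau_2$. Continuous problem: $\partial\Omega=\Gamma_D\cup\Gamma_N$, $\Gamma_D\ne\emptyset$, $\Gamma_D\cap\Gamma_N=\emptyset$; $0<k_*\le\kappa\le k^*<\infty$ a.e. in $\Omega$; $f\in L^2(\Omega)$, $g_D\in H^{1/2}(\Gamma_D)$, $g_N\in H^{-1/2}(\Gamma_N)$. Primal: $\widetilde u\in H^1(\Omega)$ with $\widetilde u=g_D$ on $\Gamma_D$ and $(\kappa\nabla\widetilde u,\nabla\widetilde v)_{0,\Omega}=(f,\widetilde v)_{0,\Omega}+(g_N,\widetilde v)_{0,\Gamma_N}$ for all $\widetilde v\in H^1(\Omega)$ vanishing on $\Gamma_D$. Mixed: with $a(\boldsymbol\sigma,\boldsymbol\tau)=\int_\Omega\kappa^{-1}\boldsymbol\sigma\cdot\boldsymbol\tau$ and $b(\boldsymbol\tau,v)=-\int_\Omega\operatorname{div}(\boldsymbol\tau)v$, find $\boldsymbol\sigma\in H(\operatorname{div},\Omega)$ with $\mathbf n\cdot\boldsymbol\sigma=-g_N$ on $\Gamma_N$ and $u\in L^2(\Omega)$ such that $a(\boldsymbol\sigma,\boldsymbol\tau)+b(\boldsymbol\tau,u)=-(g_D,\mathbf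 n\cdot\boldsymbol\tau)_{0,\Gamma_D}$ for all $\boldsymbol\tau\in H(\operatorname{div},\Omega)$ with $\mathbf n\cdot\boldsymbol\tau=0$ on $\Gamma_N$, and $b(\boldsymbol\sigma,v)=-(f,v)_{0,\Omega}$ for all $v\in L^2(\Omega)$. (One has $\boldsymbol\sigma=-\kappa\nabla\widetilde u$.) Meshes: $\mathcal T_n$ is a conforming decomposition of $\Omega$ into polygons $K$ with straight edges (hanging nodes are vertices; each boundary edge lies in $\Gamma_D$ or in $\Gamma_N$); $h_K$ diameter, $h_e$ edge length, $\mathcal E^K$ edges of $K$. (G1): each $K$ is star-shaped with respect to a ball of radius $\ge\gamma h_K$. (G2): $h_K\le\widetilde\gamma h_e$ for all $e\in\mathcal E^K$. (K): $\kappa$ is constant on each $K$. (D): $g_D$, $g_N$ are piecewise polynomials of degree $p$ on the edges of $\Gamma_D$, $\Gamma_N$. Primal VEM: $\widetilde V_n(K)=\{v\in C^0(\overline K): v|_e\in\mathbb P_p(e)\ \forall e\in\mathcal E^K,\ \Delta v\in\mathbb P_{p-2}(K)\}$; $\widetilde V_n=\{v\in C^0(\overline\Omega):v|_K\in\widetilde V_n(K)\ \forall K\}$; $\widetilde V_{n,g_D}$, $\widetilde V_{n,0}$ are the subsets of $\widetilde V_n$ of functions equal to $g_D$, resp. $0$, on $\Gamma_D$. For $v\in H^1(K)$, $\widetilde\Pi^\nabla_p v\in\mathbb P_p(K)$ is defined by $(\kappa\nabla(v-\widetilde\Pi^\nabla_pv),\nabla q)_{0,K}=0$ for all $q\in\mathbb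 P_p(K)$ and $\int_{\partial K}(v-\widetilde\Pi^\nabla_pv)=0$. $\widetilde S^K$ is any bilinear form on $\ker\widetilde\Pi^\nabla_p\cap\widetilde V_n(K)$ with $\widetilde\alpha_*\|\kappa^{1/2}\nabla v\|_{0,K}^2\le\widetilde S^K(v,v)\le\widetilde\alpha^*\|\kappa^{1/2}\nabla v\|_{0,K}^2$ there, where $0<\widetilde\alpha_*\le\widetilde\alpha^*<\infty$ (possibly depending on $K$, $p$, $\kappa$, $\gamma,\widetilde\gamma$, not on $h_K$). $\widetilde a_n(v,w)=\sum_K[(\kappa\nabla\widetilde\Pi^\nabla_pv,\nabla\widetilde\Pi^\nabla_pw)_{0,K}+\widetilde S^K((I-\widetilde\Pi^\nabla_p)v,(I-\widetilde\Pi^\nabla_p)w)]$. $\widetilde u_n\in\widetilde V_{n,g_D}$ solves $\widetilde a_n(\widetilde u_n,v)=\langle f,v\rangle_n+(g_N,v)_{0,\Gamma_N}$ for all $v\in\widetilde V_{n,0}$, where $\langle f,v\rangle_n=\sum_K(f,\widetilde\Pi^0_{p-2}v)_{0,K}$ with $\widetilde\Pi^0_{p-2}$ the $L^2(K)$ projection onto $\mathbb P_{p-2}(K)$ if $p\ge2$, and for $p=1$ $\widetilde\Pi^0_{p-2}v$ is replaced on $K$ by the average of the values of $v$ at the vertices of $K$. Mixed VEM: $\boldsymbol\Sigma_n(K)=\{\boldsymbol\tau\in H(\operatorname{div},K)\cap H(\operatorname{rot},K):\mathbf n\cdot\boldsymbol\tau|_e\in\mathbb P_p(e)\ \forall e\in\mathcal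 E^K,\ \operatorname{div}\boldsymbol\tau\in\mathbb P_{p-1}(K),\ \operatorname{rot}\boldsymbol\tau\in\mathbb P_{p-1}(K)\}$; $\boldsymbol\Sigma_n=\{\boldsymbol\tau\in H(\operatorname{div},\Omega):\boldsymbol\tau|_K\in\boldsymbol\Sigma_n(K)\ \forall K\}$; $V_n$ is the space of piecewise (discontinuous) polynomials of degree $p-1$ on $\mathcal T_n$. With $a^K(\boldsymbol\sigma,\boldsymbol\tau)=\int_K\kappa^{-1}\boldsymbol\sigma\cdot\boldsymbol\tau$, $\boldsymbol\Pi^0_p:[L^2(K)]^2\to\nabla\mathbb P_{p+1}(K)$ is the $a^K$-orthogonal projection. $S^K$ is any bilinear form on $\ker\boldsymbol\Pi^0_p\cap\boldsymbol\Sigma_n(K)$ with $\alpha_*a^K(\boldsymbol\tau,\boldsymbol\tau)\le S^K(\boldsymbol\tau,\boldsymbol\tau)\le\alpha^*a^K(\boldsymbol\tau,\boldsymbol\tau)$ there, $0<\alpha_*\le\alpha^*<\infty$ (possibly depending on $K$, $p$, $\kappa$, $\gamma,\widetilde\gamma$, not on $h_K$). $a_n(\boldsymbol\sigma,\boldsymbol\tau)=\sum_K[a^K(\boldsymbol\Pi^0_p\boldsymbol\sigma,\boldsymbol\Pi^0_p\boldsymbol\tau)+S^K((\mathbf I-\boldsymbol\Pi^0_p)\boldsymbol\sigma,(\mathbf I-\boldsymbol\Pi^0_p)\boldsymbol\tau)]$. $(\boldsymbol\sigma_n,u_n)\in\boldsymbol\Sigma_n\times V_n$ with $\mathbf n\cdot\boldsymbol\sigma_n=-g_N$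 on $\Gamma_N$ solves $a_n(\boldsymbol\sigma_n,\boldsymbol\tau_n)+b(\boldsymbol\tau_n,u_n)=-(g_D,\mathbf n\cdot\boldsymbol\tau_n)_{0,\Gamma_D}$ for all $\boldsymbol\tau_n\in\boldsymbol\Sigma_n$ with $\mathbf n\cdot\boldsymbol\tau_n=0$ on $\Gamma_N$, and $b(\boldsymbol\sigma_n,v_n)=-(f,v_n)_{0,\Omega}$ for all $v_n\in V_n$. *)

theory Defs
  imports "HOL-Analysis.Analysis"
begin

type_synonym point = "real \<times> real"
type_synonym edge = "point \<times> point"

section \<open>Polygons, polygonal domains and meshes\<close>

text \<open>A polygon is given by the cyclic list of its vertices; vertices with a flat angle
  (hanging nodes) are allowed.\<close>

type_synonym polygon = "point list"

fun polygonal_path :: "point list \<Rightarrow> real \<Rightarrow> point" where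
  "polygonal_path [] = linepath 0 0"
| "polygonal_path [a] = linepath a a"
| "polygonal_path [a, b] = linepath a b"
| "polygonal_path (a # b # c # xs) = linepath a b +++ polygonal_path (b # c # xs)"

definition boundary_path :: "polygon \<Rightarrow> real \<Rightarrow> point" where
  "boundary_path P = polygonal_path (P @ [hd P])"

definition simple_polygon :: "polygon \<Rightarrow> bool" where
  "simple_polygon P \<longleftrightarrow> 3 \<le> length P \<and> simple_path (boundary_path P)"

definition region :: "polygon \<Rightarrow> point set" where
  "region P = inside (path_image (boundary_path P))"

definition edges :: "polygon \<Rightarrow> edge set" where
  "edges P = {(P ! i, P ! (Suc i mod length P)) | i. i < length P}"

definition seg :: "edge \<Rightarrow> point set" where
  "seg e = closed_segment (fst e) (snd e)"

definition open_seg :: "edge \<Rightarrow> point set" where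
  "open_seg e = open_segment (fst e) (snd e)"

text \<open>A Lipschitz polygonal domain \<open>\<Omega>\<close>, possibly multiply connected: a simple polygon minus
  finitely many pairwise disjoint closed polygonal holes. \<open>E\<close> collects the sides
  of the outer polygon and of the holes, so that the boundary of \<open>\<Omega>\<close> is the union of \<open>E\<close>.\<close>

definition polygonal_domain :: "point set \<Rightarrow> edge set \<Rightarrow> bool" where
  "polygonal_domain \<Omega> E \<longleftrightarrow> (\<exists>P H. simple_polygon P \<and> finite H \<and>
      (\<forall>Q\<in>H. simple_polygon Q \<and> closure (region Q) \<subseteq> region P) \<and>
      (\<forall>Q\<in>H. \<forall>R\<in>H. Q \<noteq> R \<longrightarrow> closure (region Q) \<inter> closure (region R) = {}) \<and>
      \<Omega> = region P - (\<Union>Q\<in>H. closure (region Q)) \<and>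
      E = edges P \<union> (\<Union>Q\<in>H. edges Q))"

text \<open>In the last clause, two edges of the mesh coincide as segments or meet at most in a
  common endpoint.\<close>

definition conforming_mesh :: "point set \<Rightarrow> polygon set \<Rightarrow> bool" where
  "conforming_mesh \<Omega> T \<longleftrightarrow> finite T \<and>
      (\<forall>K\<in>T. simple_polygon K \<and> region K \<subseteq> \<Omega>) \<and>
      closure \<Omega> = (\<Union>K\<in>T. closure (region K)) \<and>
      (\<forall>K\<in>T. \<forall>L\<in>T. K \<noteq> L \<longrightarrow> region K \<inter> region L = {}) \<and>
      (\<forall>K\<in>T. \<forall>L\<in>T. \<forall>d\<in>edges K. \<forall>e\<in>edges L.
         seg d = seg e \<or> seg d \<inter> seg e \<subseteq> {fst d, snd d} \<inter> {fst e, snd e})"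

definition boundary_edges :: "point set \<Rightarrow> polygon set \<Rightarrow> edge set" where
  "boundary_edges \<Omega> T = {e \<in> (\<Union>K\<in>T. edges K). seg e \<subseteq> frontier \<Omega>}"

text \<open>As \<open>\<Gamma>\<^sub>D\<close> and \<open>\<Gamma>\<^sub>N\<close> are disjoint sets of points, a boundary edge lies in one of them only
  up to its endpoints. The last clause excludes isolated vertices from \<open>\<Gamma>\<^sub>D\<close>; with
  \<open>\<Gamma>\<^sub>D \<noteq> {}\<close> it yields a Dirichlet part of positive length.\<close>

definition boundary_partition ::
    "point set \<Rightarrow> polygon set \<Rightarrow> point set \<Rightarrow> point set \<Rightarrow> bool" where
  "boundary_partition \<Omega> T \<Gamma>D \<Gamma>N \<longleftrightarrow>
      frontier \<Omega> = \<Gamma>D \<union> \<Gamma>N \<and> \<Gamma>D \<noteq> {} \<and> \<Gamma>D \<inter> \<Gamma>N = {} \<and>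
      (\<forall>e\<in>boundary_edges \<Omega> T. open_seg e \<subseteq> \<Gamma>D \<or> open_seg e \<subseteq> \<Gamma>N) \<and>
      \<Gamma>D \<subseteq> (\<Union>e\<in>{e \<in> boundary_edges \<Omega> T. open_seg e \<subseteq> \<Gamma>D}. seg e)"

definition mesh_G1 :: "real \<Rightarrow> polygon set \<Rightarrow> bool" where
  "mesh_G1 \<gamma> T \<longleftrightarrow> (\<forall>K\<in>T. \<exists>c r. r \<ge> \<gamma> * diameter (region K) \<and> ball c r \<subseteq> region K \<and>
      (\<forall>x\<in>region K. convex hull (insert x (ball c r)) \<subseteq> region K))"

definition mesh_G2 :: "real \<Rightarrow> polygon set \<Rightarrow> bool" where
  "mesh_G2 \<gamma>' T \<longleftrightarrow>
      (\<forall>K\<in>T. \<forall>e\<in>edges K. diameter (region K) \<le> \<gamma>' * dist (fst e) (snd e))"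

section \<open>Function spaces\<close>

definition L2 :: "point set \<Rightarrow> (point \<Rightarrow> 'a::euclidean_space) set" where
  "L2 D = {v. v \<in> borel_measurable (lebesgue_on D) \<and>
              integrable (lebesgue_on D) (\<lambda>x. (norm (v x))\<^sup>2)}"

definition ip :: "point set \<Rightarrow> (point \<Rightarrow> 'a::euclidean_space) \<Rightarrow> (point \<Rightarrow> 'a) \<Rightarrow> real" where
  "ip D v w = (LINT x|lebesgue_on D. v x \<bullet> w x)"

definition L2norm :: "point set \<Rightarrow> (point \<Rightarrow> 'a::euclidean_space) \<Rightarrow> real" where
  "L2norm D v = sqrt (LINT x|lebesgue_on D. (norm (v x))\<^sup>2)"

definition C1 :: "(point \<Rightarrow> real) \<Rightarrow> (point \<Rightarrow> point) \<Rightarrow> bool" where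
  "C1 \<phi> G \<longleftrightarrow> (\<forall>x. GDERIV \<phi> x :> G x) \<and> continuous_on UNIV G"

text \<open>Weak derivatives are tested with continuously differentiable functions of compact support
  (equivalently, with smooth ones).\<close>

definition C1c :: "point set \<Rightarrow> (point \<Rightarrow> real) \<Rightarrow> (point \<Rightarrow> point) \<Rightarrow> bool" where
  "C1c D \<phi> G \<longleftrightarrow> C1 \<phi> G \<and> compact (closure {x. \<phi> x \<noteq> 0}) \<and> closure {x. \<phi> x \<noteq> 0} \<subseteq> D"

definition has_weak_grad ::
    "point set \<Rightarrow> (point \<Rightarrow> real) \<Rightarrow> (point \<Rightarrow> point) \<Rightarrow> bool" where
  "has_weak_grad D v g \<longleftrightarrow> (\<forall>\<phi> G. C1c D \<phi> G \<longrightarrow>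
      (LINT x|lebesgue_on D. v x *\<^sub>R G x) = - (LINT x|lebesgue_on D. \<phi> x *\<^sub>R g x))"

definition has_weak_div ::
    "point set \<Rightarrow> (point \<Rightarrow> point) \<Rightarrow> (point \<Rightarrow> real) \<Rightarrow> bool" where
  "has_weak_div D \<tau> d \<longleftrightarrow> (\<forall>\<phi> G. C1c D \<phi> G \<longrightarrow> ip D \<tau> G = - ip D d \<phi>)"

text \<open>The sign convention is \<open>rot \<tau> = \<partial>\<^sub>y \<tau>\<^sub>1 - \<partial>\<^sub>x \<tau>\<^sub>2\<close>, that is, the divergence of
  \<open>(- \<tau>\<^sub>2, \<tau>\<^sub>1)\<close>.\<close>

definition has_weak_rot ::
    "point set \<Rightarrow> (point \<Rightarrow> point) \<Rightarrow> (point \<Rightarrow> real) \<Rightarrow> bool" where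
  "has_weak_rot D \<tau> r \<longleftrightarrow> has_weak_div D (\<lambda>x. (- snd (\<tau> x), fst (\<tau> x))) r"

definition H1 :: "point set \<Rightarrow> (point \<Rightarrow> real) set" where
  "H1 D = {v \<in> L2 D. \<exists>g\<in>L2 D. has_weak_grad D v g}"

definition Hdiv :: "point set \<Rightarrow> (point \<Rightarrow> point) set" where
  "Hdiv D = {\<tau> \<in> L2 D. \<exists>d\<in>L2 D. has_weak_div D \<tau> d}"

definition Hrot :: "point set \<Rightarrow> (point \<Rightarrow> point) set" where
  "Hrot D = {\<tau> \<in> L2 D. \<exists>r\<in>L2 D. has_weak_rot D \<tau> r}"

text \<open>The weak gradient and the weak divergence are unique up to null sets; the operators below
  pick a representative.\<close>

definition wgrad :: "point set \<Rightarrow> (point \<Rightarrow> real) \<Rightarrow> point \<Rightarrow> point" where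
  "wgrad D v = (SOME g. g \<in> L2 D \<and> has_weak_grad D v g)"

definition wdiv :: "point set \<Rightarrow> (point \<Rightarrow> point) \<Rightarrow> point \<Rightarrow> real" where
  "wdiv D \<tau> = (SOME d. d \<in> L2 D \<and> has_weak_div D \<tau> d)"

text \<open>Boundary values. On a bounded Lipschitz domain the trace of a function in \<open>H1 D\<close> is,
  almost everywhere on the boundary, the limit of its mean values over
  \<open>D \<inter> ball x r\<close> as \<open>r\<close> tends to \<open>0\<close>; if the function is continuous up to the boundary,
  the limit is its boundary value.\<close>

definition has_trace :: "point set \<Rightarrow> (point \<Rightarrow> real) \<Rightarrow> point \<Rightarrow> real \<Rightarrow> bool" where
  "has_trace D v x l \<longleftrightarrow>
      ((\<lambda>r. (LINT y|lebesgue_on (D \<inter> ball x r). v y) / measure lebesgue (D \<inter> ball x r))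
        \<longlongrightarrow> l) (at_right 0)"

definition trace :: "point set \<Rightarrow> (point \<Rightarrow> real) \<Rightarrow> point \<Rightarrow> real" where
  "trace D v x = (THE l. has_trace D v x l)"

definition edge_int :: "edge \<Rightarrow> (point \<Rightarrow> real) \<Rightarrow> real" where
  "edge_int e g =
     dist (fst e) (snd e) * (LINT t|lebesgue_on {0..1}. g (linepath (fst e) (snd e) t))"

text \<open>The arc length integral of \<open>g\<close> over \<open>\<Gamma>\<close>, a part of the union of the edges in \<open>E\<close>.\<close>

definition bdry_int :: "edge set \<Rightarrow> point set \<Rightarrow> (point \<Rightarrow> real) \<Rightarrow> real" where
  "bdry_int E \<Gamma> g = (\<Sum>e\<in>E. edge_int e (\<lambda>x. indicator \<Gamma> x * g x))"

text \<open>\<open>v = g\<close> on \<open>\<Gamma>\<close> in the sense of traces, almost everywhere with respect to arc length.\<close>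

definition trace_eq ::
    "point set \<Rightarrow> edge set \<Rightarrow> point set \<Rightarrow> (point \<Rightarrow> real) \<Rightarrow> (point \<Rightarrow> real) \<Rightarrow> bool" where
  "trace_eq D E \<Gamma> v g \<longleftrightarrow> (\<forall>e\<in>E. AE t in lebesgue_on {0..1}.
      linepath (fst e) (snd e) t \<in> \<Gamma> \<longrightarrow>
      has_trace D v (linepath (fst e) (snd e) t) (g (linepath (fst e) (snd e) t)))"

definition H12 :: "point set \<Rightarrow> edge set \<Rightarrow> point set \<Rightarrow> (point \<Rightarrow> real) set" where
  "H12 D E \<Gamma> = {g. \<exists>w\<in>H1 D. trace_eq D E \<Gamma> w g}"

text \<open>The duality pairing of the normal trace of \<open>\<tau>\<close> (outward normal) with the trace of \<open>v\<close> on
  the whole boundary of \<open>D\<close>, defined by Green's formula.\<close>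

definition normal_pairing ::
    "point set \<Rightarrow> (point \<Rightarrow> point) \<Rightarrow> (point \<Rightarrow> real) \<Rightarrow> real" where
  "normal_pairing D \<tau> v = ip D \<tau> (wgrad D v) + ip D (wdiv D \<tau>) v"

text \<open>The normal component of \<open>\<tau>\<close> equals \<open>m\<close> on \<open>\<Gamma>\<close>: both act in the same way on the
  functions of \<open>H1 D\<close> that vanish on the rest of the boundary.\<close>

definition normal_eq ::
    "point set \<Rightarrow> edge set \<Rightarrow> point set \<Rightarrow> (point \<Rightarrow> point) \<Rightarrow> (point \<Rightarrow> real) \<Rightarrow> bool" where
  "normal_eq D E \<Gamma> \<tau> m \<longleftrightarrow>
      (\<forall>v\<in>H1 D. trace_eq D E (frontier D - \<Gamma>) v (\<lambda>_. 0) \<longrightarrow>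
         normal_pairing D \<tau> v = bdry_int E \<Gamma> (\<lambda>x. m x * trace D v x))"

text \<open>The pairing of \<open>g\<close> on \<open>\<Gamma>\<^sub>D\<close> with the normal component of a field \<open>\<tau>\<close> whose normal
  component vanishes on the rest of the boundary; for such \<open>\<tau>\<close> it does not depend on the
  lifting \<open>w\<close> of \<open>g\<close>.\<close>

definition dirichlet_pairing ::
    "point set \<Rightarrow> edge set \<Rightarrow> point set \<Rightarrow> (point \<Rightarrow> real) \<Rightarrow> (point \<Rightarrow> point) \<Rightarrow> real" where
  "dirichlet_pairing D E \<Gamma>D g \<tau> =
     normal_pairing D \<tau> (SOME w. w \<in> H1 D \<and> trace_eq D E \<Gamma>D w g)"

section \<open>The continuous problems\<close>

definition primal_solution ::
    "point set \<Rightarrow> edge set \<Rightarrow> point set \<Rightarrow> point set \<Rightarrow> (point \<Rightarrow> real) \<Rightarrow> (point \<Rightarrow> real) \<Rightarrow>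
     (point \<Rightarrow> real) \<Rightarrow> (point \<Rightarrow> real) \<Rightarrow> (point \<Rightarrow> real) \<Rightarrow> bool" where
  "primal_solution \<Omega> E \<Gamma>D \<Gamma>N \<kappa> f gD gN ut \<longleftrightarrow>
      ut \<in> H1 \<Omega> \<and> trace_eq \<Omega> E \<Gamma>D ut gD \<and>
      (\<forall>v\<in>H1 \<Omega>. trace_eq \<Omega> E \<Gamma>D v (\<lambda>_. 0) \<longrightarrow>
         ip \<Omega> (\<lambda>x. \<kappa> x *\<^sub>R wgrad \<Omega> ut x) (wgrad \<Omega> v) =
         ip \<Omega> f v + bdry_int E \<Gamma>N (\<lambda>x. gN x * trace \<Omega> v x))"

definition form_a ::
    "point set \<Rightarrow> (point \<Rightarrow> real) \<Rightarrow> (point \<Rightarrow> point) \<Rightarrow> (point \<Rightarrow> point) \<Rightarrow> real" where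
  "form_a D \<kappa> \<sigma> \<tau> = ip D (\<lambda>x. inverse (\<kappa> x) *\<^sub>R \<sigma> x) \<tau>"

definition form_b :: "point set \<Rightarrow> (point \<Rightarrow> point) \<Rightarrow> (point \<Rightarrow> real) \<Rightarrow> real" where
  "form_b D \<tau> v = - ip D (wdiv D \<tau>) v"

definition mixed_solution ::
    "point set \<Rightarrow> edge set \<Rightarrow> point set \<Rightarrow> point set \<Rightarrow> (point \<Rightarrow> real) \<Rightarrow> (point \<Rightarrow> real) \<Rightarrow>
     (point \<Rightarrow> real) \<Rightarrow> (point \<Rightarrow> real) \<Rightarrow> (point \<Rightarrow> point) \<Rightarrow> (point \<Rightarrow> real) \<Rightarrow> bool" where
  "mixed_solution \<Omega> E \<Gamma>D \<Gamma>N \<kappa> f gD gN \<sigma> u \<longleftrightarrow>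
      \<sigma> \<in> Hdiv \<Omega> \<and> normal_eq \<Omega> E \<Gamma>N \<sigma> (\<lambda>x. - gN x) \<and> u \<in> L2 \<Omega> \<and>
      (\<forall>\<tau>\<in>Hdiv \<Omega>. normal_eq \<Omega> E \<Gamma>N \<tau> (\<lambda>_. 0) \<longrightarrow>
         form_a \<Omega> \<kappa> \<sigma> \<tau> + form_b \<Omega> \<tau> u = - dirichlet_pairing \<Omega> E \<Gamma>D gD \<tau>) \<and>
      (\<forall>v\<in>L2 \<Omega>. form_b \<Omega> \<sigma> v = - ip \<Omega> f v)"

section \<open>Polynomials, and forms on function spaces\<close>

text \<open>Polynomials in two variables of total degree at most \<open>l\<close>; \<open>Pol l = {0}\<close> for \<open>l < 0\<close>.
  Their restrictions to a segment are the polynomials of degree at most \<open>l\<close> in arc length.\<close>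

definition Pol :: "int \<Rightarrow> (point \<Rightarrow> real) set" where
  "Pol l = {q. \<exists>c :: nat \<Rightarrow> nat \<Rightarrow> real.
      q = (\<lambda>x. \<Sum>(i, j)\<in>{(i, j). int (i + j) \<le> l}. c i j * fst x ^ i * snd x ^ j)}"

definition gradPol :: "int \<Rightarrow> (point \<Rightarrow> point) set" where
  "gradPol l = {G. \<exists>q\<in>Pol l. \<forall>x. GDERIV q x :> G x}"

definition poly_on :: "int \<Rightarrow> point set \<Rightarrow> (point \<Rightarrow> real) \<Rightarrow> bool" where
  "poly_on l A v \<longleftrightarrow> (\<exists>q\<in>Pol l. \<forall>x\<in>A. v x = q x)"

text \<open>\<open>S\<close> is a bilinear form on the space \<open>W\<close>, whose elements are identified by \<open>R\<close>: total
  functions represent functions on an element or classes modulo null sets.\<close>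

definition bilinear_form_on ::
    "(point \<Rightarrow> 'a::real_vector) set \<Rightarrow> ((point \<Rightarrow> 'a) \<Rightarrow> (point \<Rightarrow> 'a) \<Rightarrow> bool) \<Rightarrow>
     ((point \<Rightarrow> 'a) \<Rightarrow> (point \<Rightarrow> 'a) \<Rightarrow> real) \<Rightarrow> bool" where
  "bilinear_form_on W R S \<longleftrightarrow>
      (\<forall>u\<in>W. \<forall>v\<in>W. \<forall>w\<in>W.
         S (\<lambda>x. u x + v x) w = S u w + S v w \<and> S w (\<lambda>x. u x + v x) = S w u + S w v) \<and>
      (\<forall>u\<in>W. \<forall>w\<in>W. \<forall>c.
         S (\<lambda>x. c *\<^sub>R u x) w = c * S u w \<and> S w (\<lambda>x. c *\<^sub>R u x) = c * S w u) \<and>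
      (\<forall>u\<in>W. \<forall>v\<in>W. \<forall>w\<in>W. R u v \<longrightarrow> S u w = S v w \<and> S w u = S w v)"

section \<open>The primal virtual element method\<close>

text \<open>The Laplacian is the weak divergence of the weak gradient. A continuous function on the
  closed element with piecewise polynomial boundary values and polynomial distributional
  Laplacian automatically belongs to \<open>H1\<close>.\<close>

definition Vt_loc :: "nat \<Rightarrow> polygon \<Rightarrow> (point \<Rightarrow> real) set" where
  "Vt_loc p K = {v. continuous_on (closure (region K)) v \<and>
      (\<forall>e\<in>edges K. poly_on (int p) (seg e) v) \<and>
      v \<in> H1 (region K) \<and>
      (\<exists>q\<in>Pol (int p - 2). has_weak_div (region K) (wgrad (region K) v) q)}"

definition Vt :: "point set \<Rightarrow> polygon set \<Rightarrow> nat \<Rightarrow> (point \<Rightarrow> real) set" where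
  "Vt \<Omega> T p = {v. continuous_on (closure \<Omega>) v \<and> (\<forall>K\<in>T. v \<in> Vt_loc p K)}"

definition Vt_bc ::
    "point set \<Rightarrow> polygon set \<Rightarrow> nat \<Rightarrow> point set \<Rightarrow> (point \<Rightarrow> real) \<Rightarrow> (point \<Rightarrow> real) set" where
  "Vt_bc \<Omega> T p \<Gamma>D g = {v \<in> Vt \<Omega> T p. \<forall>x\<in>\<Gamma>D. v x = g x}"

definition is_Pi_nabla ::
    "(point \<Rightarrow> real) \<Rightarrow> nat \<Rightarrow> polygon \<Rightarrow> (point \<Rightarrow> real) \<Rightarrow> (point \<Rightarrow> real) \<Rightarrow> bool" where
  "is_Pi_nabla \<kappa> p K v q \<longleftrightarrow> q \<in> Pol (int p) \<and>
      (\<forall>r\<in>Pol (int p).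
         ip (region K) (\<lambda>x. \<kappa> x *\<^sub>R wgrad (region K) (\<lambda>y. v y - q y) x) (wgrad (region K) r) = 0) \<and>
      (\<Sum>e\<in>edges K. edge_int e (\<lambda>x. trace (region K) v x - q x)) = 0"

definition Pi_nabla ::
    "(point \<Rightarrow> real) \<Rightarrow> nat \<Rightarrow> polygon \<Rightarrow> (point \<Rightarrow> real) \<Rightarrow> point \<Rightarrow> real" where
  "Pi_nabla \<kappa> p K v = (SOME q. is_Pi_nabla \<kappa> p K v q)"

definition res_nabla ::
    "(point \<Rightarrow> real) \<Rightarrow> nat \<Rightarrow> polygon \<Rightarrow> (point \<Rightarrow> real) \<Rightarrow> point \<Rightarrow> real" where
  "res_nabla \<kappa> p K v = (\<lambda>x. v x - Pi_nabla \<kappa> p K v x)"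

definition energy_norm :: "(point \<Rightarrow> real) \<Rightarrow> polygon \<Rightarrow> (point \<Rightarrow> real) \<Rightarrow> real" where
  "energy_norm \<kappa> K v = L2norm (region K) (\<lambda>x. sqrt (\<kappa> x) *\<^sub>R wgrad (region K) v x)"

definition primal_stab ::
    "(point \<Rightarrow> real) \<Rightarrow> nat \<Rightarrow> polygon \<Rightarrow> real \<Rightarrow> real \<Rightarrow>
     ((point \<Rightarrow> real) \<Rightarrow> (point \<Rightarrow> real) \<Rightarrow> real) \<Rightarrow> bool" where
  "primal_stab \<kappa> p K al au S \<longleftrightarrow>
     (let W = {v \<in> Vt_loc p K. Pi_nabla \<kappa> p K v = (\<lambda>_. 0)} in
      bilinear_form_on W (\<lambda>v w. \<forall>x\<in>closure (region K). v x = w x) S \<and>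
      (\<forall>v\<in>W. al * (energy_norm \<kappa> K v)\<^sup>2 \<le> S v v \<and> S v v \<le> au * (energy_norm \<kappa> K v)\<^sup>2))"

definition primal_form ::
    "(point \<Rightarrow> real) \<Rightarrow> nat \<Rightarrow> polygon set \<Rightarrow>
     (polygon \<Rightarrow> (point \<Rightarrow> real) \<Rightarrow> (point \<Rightarrow> real) \<Rightarrow> real) \<Rightarrow>
     (point \<Rightarrow> real) \<Rightarrow> (point \<Rightarrow> real) \<Rightarrow> real" where
  "primal_form \<kappa> p T St v w = (\<Sum>K\<in>T.
      ip (region K) (\<lambda>x. \<kappa> x *\<^sub>R wgrad (region K) (Pi_nabla \<kappa> p K v) x)
                    (wgrad (region K) (Pi_nabla \<kappa> p K w)) +
      St K (res_nabla \<kappa> p K v) (res_nabla \<kappa> p K w))"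

definition Pi_L2 :: "int \<Rightarrow> polygon \<Rightarrow> (point \<Rightarrow> real) \<Rightarrow> point \<Rightarrow> real" where
  "Pi_L2 l K v = (SOME q. q \<in> Pol l \<and> (\<forall>r\<in>Pol l. ip (region K) (\<lambda>x. v x - q x) r = 0))"

definition load_proj :: "nat \<Rightarrow> polygon \<Rightarrow> (point \<Rightarrow> real) \<Rightarrow> point \<Rightarrow> real" where
  "load_proj p K v = (if p = 1 then (\<lambda>_. (\<Sum>x\<in>set K. v x) / real (card (set K)))
                      else Pi_L2 (int p - 2) K v)"

definition primal_vem_solution ::
    "point set \<Rightarrow> edge set \<Rightarrow> polygon set \<Rightarrow> nat \<Rightarrow> point set \<Rightarrow> point set \<Rightarrow> (point \<Rightarrow> real) \<Rightarrow>
     (point \<Rightarrow> real) \<Rightarrow> (point \<Rightarrow> real) \<Rightarrow> (point \<Rightarrow> real) \<Rightarrow>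
     (polygon \<Rightarrow> (point \<Rightarrow> real) \<Rightarrow> (point \<Rightarrow> real) \<Rightarrow> real) \<Rightarrow> (point \<Rightarrow> real) \<Rightarrow> bool" where
  "primal_vem_solution \<Omega> E T p \<Gamma>D \<Gamma>N \<kappa> f gD gN St utn \<longleftrightarrow>
      utn \<in> Vt_bc \<Omega> T p \<Gamma>D gD \<and>
      (\<forall>v\<in>Vt_bc \<Omega> T p \<Gamma>D (\<lambda>_. 0).
         primal_form \<kappa> p T St utn v =
         (\<Sum>K\<in>T. ip (region K) f (load_proj p K v)) + bdry_int E \<Gamma>N (\<lambda>x. gN x * v x))"

section \<open>The mixed virtual element method\<close>

text \<open>The (outward) normal component of \<open>\<tau>\<close> on the edge \<open>e\<close> of \<open>K\<close> equals \<open>m\<close>, as a functional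
  on the boundary values that vanish on the other edges. By density it suffices to test with
  continuously differentiable functions.\<close>

definition edge_normal_eq ::
    "polygon \<Rightarrow> edge \<Rightarrow> (point \<Rightarrow> point) \<Rightarrow> (point \<Rightarrow> real) \<Rightarrow> bool" where
  "edge_normal_eq K e \<tau> m \<longleftrightarrow>
      (\<forall>\<phi> G. C1 \<phi> G \<and> (\<forall>d\<in>edges K. d \<noteq> e \<longrightarrow> (\<forall>x\<in>seg d. \<phi> x = 0)) \<longrightarrow>
         ip (region K) \<tau> G + ip (region K) (wdiv (region K) \<tau>) \<phi> = edge_int e (\<lambda>x. m x * \<phi> x))"

definition Sigma_loc :: "nat \<Rightarrow> polygon \<Rightarrow> (point \<Rightarrow> point) set" where
  "Sigma_loc p K = {\<tau>. \<tau> \<in> Hdiv (region K) \<and> \<tau> \<in> Hrot (region K) \<and>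
      (\<forall>e\<in>edges K. \<exists>m\<in>Pol (int p). edge_normal_eq K e \<tau> m) \<and>
      (\<exists>q\<in>Pol (int p - 1). has_weak_div (region K) \<tau> q) \<and>
      (\<exists>q\<in>Pol (int p - 1). has_weak_rot (region K) \<tau> q)}"

definition Sigma_n :: "point set \<Rightarrow> polygon set \<Rightarrow> nat \<Rightarrow> (point \<Rightarrow> point) set" where
  "Sigma_n \<Omega> T p = {\<tau> \<in> Hdiv \<Omega>. \<forall>K\<in>T. \<tau> \<in> Sigma_loc p K}"

definition V_n :: "polygon set \<Rightarrow> nat \<Rightarrow> (point \<Rightarrow> real) set" where
  "V_n T p = {v. \<forall>K\<in>T. poly_on (int p - 1) (region K) v}"

definition Pi_mixed ::
    "(point \<Rightarrow> real) \<Rightarrow> nat \<Rightarrow> polygon \<Rightarrow> (point \<Rightarrow> point) \<Rightarrow> point \<Rightarrow> point" where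
  "Pi_mixed \<kappa> p K \<tau> = (SOME r. r \<in> gradPol (int p + 1) \<and>
      (\<forall>s\<in>gradPol (int p + 1). form_a (region K) \<kappa> (\<lambda>x. \<tau> x - r x) s = 0))"

definition res_mixed ::
    "(point \<Rightarrow> real) \<Rightarrow> nat \<Rightarrow> polygon \<Rightarrow> (point \<Rightarrow> point) \<Rightarrow> point \<Rightarrow> point" where
  "res_mixed \<kappa> p K \<tau> = (\<lambda>x. \<tau> x - Pi_mixed \<kappa> p K \<tau> x)"

definition flux_norm :: "(point \<Rightarrow> real) \<Rightarrow> polygon \<Rightarrow> (point \<Rightarrow> point) \<Rightarrow> real" where
  "flux_norm \<kappa> K \<tau> = L2norm (region K) (\<lambda>x. inverse (sqrt (\<kappa> x)) *\<^sub>R \<tau> x)"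

definition mixed_stab ::
    "(point \<Rightarrow> real) \<Rightarrow> nat \<Rightarrow> polygon \<Rightarrow> real \<Rightarrow> real \<Rightarrow>
     ((point \<Rightarrow> point) \<Rightarrow> (point \<Rightarrow> point) \<Rightarrow> real) \<Rightarrow> bool" where
  "mixed_stab \<kappa> p K al au S \<longleftrightarrow>
     (let W = {\<tau> \<in> Sigma_loc p K. Pi_mixed \<kappa> p K \<tau> = (\<lambda>_. 0)} in
      bilinear_form_on W (\<lambda>\<sigma> \<tau>. AE x in lebesgue_on (region K). \<sigma> x = \<tau> x) S \<and>
      (\<forall>\<tau>\<in>W. al * form_a (region K) \<kappa> \<tau> \<tau> \<le> S \<tau> \<tau> \<and>
              S \<tau> \<tau> \<le> au * form_a (region K) \<kappa> \<tau> \<tau>))"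

definition mixed_form ::
    "(point \<Rightarrow> real) \<Rightarrow> nat \<Rightarrow> polygon set \<Rightarrow>
     (polygon \<Rightarrow> (point \<Rightarrow> point) \<Rightarrow> (point \<Rightarrow> point) \<Rightarrow> real) \<Rightarrow>
     (point \<Rightarrow> point) \<Rightarrow> (point \<Rightarrow> point) \<Rightarrow> real" where
  "mixed_form \<kappa> p T S \<sigma> \<tau> = (\<Sum>K\<in>T.
      form_a (region K) \<kappa> (Pi_mixed \<kappa> p K \<sigma>) (Pi_mixed \<kappa> p K \<tau>) +
      S K (res_mixed \<kappa> p K \<sigma>) (res_mixed \<kappa> p K \<tau>))"

definition mixed_vem_solution ::
    "point set \<Rightarrow> edge set \<Rightarrow> polygon set \<Rightarrow> nat \<Rightarrow> point set \<Rightarrow> point set \<Rightarrow> (point \<Rightarrow> real) \<Rightarrow>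
     (point \<Rightarrow> real) \<Rightarrow> (point \<Rightarrow> real) \<Rightarrow> (point \<Rightarrow> real) \<Rightarrow>
     (polygon \<Rightarrow> (point \<Rightarrow> point) \<Rightarrow> (point \<Rightarrow> point) \<Rightarrow> real) \<Rightarrow>
     (point \<Rightarrow> point) \<Rightarrow> (point \<Rightarrow> real) \<Rightarrow> bool" where
  "mixed_vem_solution \<Omega> E T p \<Gamma>D \<Gamma>N \<kappa> f gD gN S \<sigma>n un \<longleftrightarrow>
      \<sigma>n \<in> Sigma_n \<Omega> T p \<and> normal_eq \<Omega> E \<Gamma>N \<sigma>n (\<lambda>x. - gN x) \<and> un \<in> V_n T p \<and>
      (\<forall>\<tau>\<in>Sigma_n \<Omega> T p. normal_eq \<Omega> E \<Gamma>N \<tau> (\<lambda>_. 0) \<longrightarrow>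
         mixed_form \<kappa> p T S \<sigma>n \<tau> + form_b \<Omega> \<tau> un = - dirichlet_pairing \<Omega> E \<Gamma>D gD \<tau>) \<and>
      (\<forall>v\<in>V_n T p. form_b \<Omega> \<sigma>n v = - ip \<Omega> f v)"

section \<open>Data and error estimator\<close>

definition coefficient :: "point set \<Rightarrow> (point \<Rightarrow> real) \<Rightarrow> bool" where
  "coefficient \<Omega> \<kappa> \<longleftrightarrow> \<kappa> \<in> borel_measurable (lebesgue_on \<Omega>) \<and>
      (\<exists>kmin kmax. 0 < kmin \<and> (AE x in lebesgue_on \<Omega>. kmin \<le> \<kappa> x \<and> \<kappa> x \<le> kmax))"

text \<open>The Dirichlet datum, a piecewise polynomial in \<open>H12\<close>, is represented by its continuous
  representative; the Neumann datum may jump at vertices.\<close>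

definition data_D ::
    "point set \<Rightarrow> polygon set \<Rightarrow> nat \<Rightarrow> point set \<Rightarrow> point set \<Rightarrow>
     (point \<Rightarrow> real) \<Rightarrow> (point \<Rightarrow> real) \<Rightarrow> bool" where
  "data_D \<Omega> T p \<Gamma>D \<Gamma>N gD gN \<longleftrightarrow>
      (\<forall>e\<in>boundary_edges \<Omega> T.
         (open_seg e \<subseteq> \<Gamma>D \<longrightarrow> poly_on (int p) (seg e \<inter> \<Gamma>D) gD) \<and>
         (open_seg e \<subseteq> \<Gamma>N \<longrightarrow> poly_on (int p) (open_seg e) gN))"

definition eta_sq ::
    "(point \<Rightarrow> real) \<Rightarrow> nat \<Rightarrow>
     (polygon \<Rightarrow> (point \<Rightarrow> real) \<Rightarrow> (point \<Rightarrow> real) \<Rightarrow> real) \<Rightarrow>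
     (polygon \<Rightarrow> (point \<Rightarrow> point) \<Rightarrow> (point \<Rightarrow> point) \<Rightarrow> real) \<Rightarrow>
     (point \<Rightarrow> real) \<Rightarrow> (point \<Rightarrow> point) \<Rightarrow> polygon \<Rightarrow> real" where
  "eta_sq \<kappa> p St S utn \<sigma>n K =
      (L2norm (region K) (\<lambda>x. sqrt (\<kappa> x) *\<^sub>R wgrad (region K) (Pi_nabla \<kappa> p K utn) x
                            + inverse (sqrt (\<kappa> x)) *\<^sub>R Pi_mixed \<kappa> p K \<sigma>n x))\<^sup>2
      + St K (res_nabla \<kappa> p K utn) (res_nabla \<kappa> p K utn)
      + S K (res_mixed \<kappa> p K \<sigma>n) (res_mixed \<kappa> p K \<sigma>n)"

end

theory Submission
  imports Defs
begin

text \<open>On the continuous level \<open>\<sigma> = - \<kappa> \<nabla>ut\<close>, as testing the mixed problem with \<open>\<sigma> + \<kappa> \<nabla>ut\<close>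
  shows, so both parts of the consistency term of the estimator can be compared with the exact
  flux. The two projections are energy orthogonal and the stabilizations are bounded by the
  energies of the residuals, hence every term of the estimator is bounded by discretization and
  projection errors.

  The bounds for the stabilizations apply only if the residuals belong to the virtual element
  spaces. For the mixed space this needs Green's formula on a simple polygon, which is obtained
  from the Jordan curve theorem by integrating along horizontal and vertical lines.\<close>

section \<open>The space of square integrable functions\<close>

text \<open>Three obstacles shape the proof. The projections are chosen total functions, and the
  kernels on which the stabilizations live are defined by equality of total functions; uniqueness on
  an element must therefore be carried to the whole plane, which the identity theorem for
  polynomials does. A polygon is only a simple closed path of unknown orientation, so Green's
  formula is proved for one edge at a time, with test functions that vanish on the other edges and
  hence at all corners, and the side of the edge on which the region lies is found topologically.
  The operators \<open>wgrad\<close> and \<open>wdiv\<close> are choices too, so that every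
  comparison with them holds up to null sets.

  The constants arise as follows. For either field let A be the squared discretization error and B
  the squared projection error. The residual energy and the squared distance from the projected
  discrete field to the exact field are each at most \<open>2 * A + 2 * B\<close>. The consistency
  term takes the second bound twice, the stabilization takes the first one times its upper constant
  \<alpha>; this gives the factor \<open>4 + 2 * \<alpha>\<close> before both A and B.\<close>

lemma L2_iff:
  "v \<in> L2 D \<longleftrightarrow> v \<in> borel_measurable (lebesgue_on D) \<and>
      integrable (lebesgue_on D) (\<lambda>x. (norm (v x))\<^sup>2)"
  by (simp add: L2_def)

lemma L2_measurable: "v \<in> L2 D \<Longrightarrow> v \<in> borel_measurable (lebesgue_on D)"
  by (simp add: L2_iff)

text \<open>The majorant comes from 2 |v| |w| \<le> |v|^2 + |w|^2. The norm bound on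
  \<open>h\<close> covers inner products and products with scalars at once.\<close>

lemma L2_integrable_product:
  fixes v :: "point \<Rightarrow> 'a::euclidean_space" and w :: "point \<Rightarrow> 'b::euclidean_space"
    and h :: "point \<Rightarrow> 'c::euclidean_space"
  assumes v: "v \<in> L2 D" and w: "w \<in> L2 D"
    and h: "h \<in> borel_measurable (lebesgue_on D)"
    and bound: "\<And>x. norm (h x) \<le> norm (v x) * norm (w x)"
  shows "integrable (lebesgue_on D) h"
proof (rule Bochner_Integration.integrable_bound)
  show "integrable (lebesgue_on D) (\<lambda>x. (norm (v x))\<^sup>2 + (norm (w x))\<^sup>2)"
    using v w by (intro Bochner_Integration.integrable_add) (auto simp: L2_iff)
  show "h \<in> borel_measurable (lebesgue_on D)" by (rule h)
  show "AE x in lebesgue_on D. norm (h x) \<le> norm ((norm (v x))\<^sup>2 + (norm (w x))\<^sup>2)"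
  proof (rule AE_I2)
    fix x
    have "2 * (norm (v x) * norm (w x)) \<le> (norm (v x))\<^sup>2 + (norm (w x))\<^sup>2"
      using sum_squares_bound[of "norm (v x)" "norm (w x)"] by (simp add: mult.assoc)
    moreover have "0 \<le> norm (v x) * norm (w x)" by simp
    ultimately show "norm (h x) \<le> norm ((norm (v x))\<^sup>2 + (norm (w x))\<^sup>2)"
      using bound[of x] by (smt (verit) real_norm_def)
  qed
qed

lemma L2_integrable_inner:
  "\<lbrakk>v \<in> L2 D; w \<in> L2 D\<rbrakk> \<Longrightarrow> integrable (lebesgue_on D) (\<lambda>x. v x \<bullet> w x)"
  by (rule L2_integrable_product[of v _ w])
    (auto intro: borel_measurable_inner L2_measurable Cauchy_Schwarz_ineq2)

lemma L2_integrable_scaleR: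
  fixes v :: "point \<Rightarrow> real"
  shows "\<lbrakk>v \<in> L2 D; w \<in> L2 D\<rbrakk> \<Longrightarrow> integrable (lebesgue_on D) (\<lambda>x. v x *\<^sub>R w x)"
  by (rule L2_integrable_product[of v _ w])
    (auto intro: borel_measurable_scaleR L2_measurable)

text \<open>The bound is an a.e. statement because the bounds on \<open>\<kappa>\<close> are given
  in this form.\<close>

lemma L2_mult_bounded:
  fixes k :: "point \<Rightarrow> real"
  assumes v: "v \<in> L2 D" and k: "k \<in> borel_measurable (lebesgue_on D)"
    and bound: "AE x in lebesgue_on D. \<bar>k x\<bar> \<le> C"
  shows "(\<lambda>x. k x *\<^sub>R v x) \<in> L2 D"
  unfolding L2_iff
proof
  show m: "(\<lambda>x. k x *\<^sub>R v x) \<in> borel_measurable (lebesgue_on D)"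
    using k L2_measurable[OF v] by (rule borel_measurable_scaleR)
  show "integrable (lebesgue_on D) (\<lambda>x. (norm (k x *\<^sub>R v x))\<^sup>2)"
  proof (rule Bochner_Integration.integrable_bound)
    show "integrable (lebesgue_on D) (\<lambda>x. C\<^sup>2 * (norm (v x))\<^sup>2)"
      using v by (auto simp: L2_iff)
    show "(\<lambda>x. (norm (k x *\<^sub>R v x))\<^sup>2) \<in> borel_measurable (lebesgue_on D)"
      using m by measurable
    show "AE x in lebesgue_on D. norm ((norm (k x *\<^sub>R v x))\<^sup>2) \<le> norm (C\<^sup>2 * (norm (v x))\<^sup>2)"
      using bound
    proof eventually_elim
      case (elim x)
      then have "\<bar>k x\<bar>\<^sup>2 \<le> C\<^sup>2" by (intro power_mono) auto
      then show ?case
        by (simp add: power_mult_distrib mult_right_mono)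
    qed
  qed
qed

lemma L2_scaleR: "v \<in> L2 D \<Longrightarrow> (\<lambda>x. c *\<^sub>R v x) \<in> L2 D"
  by (rule L2_mult_bounded[where C = "\<bar>c\<bar>"]) auto

lemma L2_minus: "v \<in> L2 D \<Longrightarrow> (\<lambda>x. - v x) \<in> L2 D"
  using L2_scaleR[of v D "-1"] by simp

lemma L2_add:
  assumes v: "v \<in> L2 D" and w: "w \<in> L2 D"
  shows "(\<lambda>x. v x + w x) \<in> L2 D"
proof -
  have eq: "(norm (v x + w x))\<^sup>2 = (norm (v x))\<^sup>2 + 2 * (v x \<bullet> w x) + (norm (w x))\<^sup>2" for x
    by (simp add: power2_norm_eq_inner inner_add_left inner_add_right inner_commute)
  have "integrable (lebesgue_on D)
      (\<lambda>x. (norm (v x))\<^sup>2 + 2 * (v x \<bullet> w x) + (norm (w x))\<^sup>2)"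
    using v w L2_integrable_inner[OF v w]
    by (intro Bochner_Integration.integrable_add integrable_mult_right) (auto simp: L2_iff)
  then show ?thesis
    using v w by (auto simp: L2_iff eq)
qed

lemma L2_diff: "\<lbrakk>v \<in> L2 D; w \<in> L2 D\<rbrakk> \<Longrightarrow> (\<lambda>x. v x - w x) \<in> L2 D"
  using L2_add[of v D "\<lambda>x. - w x"] L2_minus[of w D] by simp

lemma L2_0: "(\<lambda>_. 0) \<in> L2 D"
  by (simp add: L2_iff)

lemma L2_sum:
  "(\<And>i. i \<in> I \<Longrightarrow> v i \<in> L2 D) \<Longrightarrow> (\<lambda>x. \<Sum>i\<in>I. v i x) \<in> L2 D"
  by (induction I rule: infinite_finite_induct) (auto intro: L2_0 L2_add)

text \<open>Applied to the coordinate projections and to the quarter turn that rewrites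
  \<open>rot\<close> as a divergence.\<close>

lemma L2_linear_comp:
  fixes f :: "'a::euclidean_space \<Rightarrow> 'b::euclidean_space"
  assumes v: "v \<in> L2 D" and f: "\<And>x. norm (f x) \<le> norm x" "continuous_on UNIV f"
  shows "(\<lambda>x. f (v x)) \<in> L2 D"
  unfolding L2_iff
proof
  show m: "(\<lambda>x. f (v x)) \<in> borel_measurable (lebesgue_on D)"
    by (rule measurable_compose[OF L2_measurable[OF v]])
      (use f(2) in \<open>simp add: borel_measurable_continuous_onI\<close>)
  show "integrable (lebesgue_on D) (\<lambda>x. (norm (f (v x)))\<^sup>2)"
  proof (rule Bochner_Integration.integrable_bound)
    show "integrable (lebesgue_on D) (\<lambda>x. (norm (v x))\<^sup>2)" using v by (simp add: L2_iff)
    show "AE x in lebesgue_on D. norm ((norm (f (v x)))\<^sup>2) \<le> norm ((norm (v x))\<^sup>2)"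
      using f(1) by (auto intro!: AE_I2 power_mono)
  qed (use m in measurable)
qed

lemma L2_fst: "v \<in> L2 D \<Longrightarrow> (\<lambda>x. fst (v x)) \<in> L2 D"
  by (rule L2_linear_comp) (auto simp: norm_fst_le[of "fst x" "snd x" for x, simplified] intro: continuous_intros)

lemma L2_snd: "v \<in> L2 D \<Longrightarrow> (\<lambda>x. snd (v x)) \<in> L2 D"
  by (rule L2_linear_comp) (auto simp: norm_snd_le[of "snd x" "fst x" for x, simplified] intro: continuous_intros)

lemma L2_restrict:
  assumes v: "v \<in> L2 \<Omega>" and D: "D \<subseteq> \<Omega>" "D \<in> sets lebesgue" "\<Omega> \<in> sets lebesgue"
  shows "v \<in> L2 D"
proof -
  have "integrable (lebesgue_on \<Omega>) (\<lambda>x. (norm (v x))\<^sup>2)" using v by (simp add: L2_iff)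
  then have "integrable lebesgue (\<lambda>x. if x \<in> \<Omega> then (norm (v x))\<^sup>2 else 0)"
    using D by (simp add: Lebesgue_Measure.integrable_restrict_UNIV)
  then have "integrable lebesgue (\<lambda>x. indicator D x *\<^sub>R (if x \<in> \<Omega> then (norm (v x))\<^sup>2 else 0))"
    using D(2) by (rule integrable_mult_indicator[rotated])
  also have "(\<lambda>x. indicator D x *\<^sub>R (if x \<in> \<Omega> then (norm (v x))\<^sup>2 else 0)) =
      (\<lambda>x. if x \<in> D then (norm (v x))\<^sup>2 else 0)"
    using D(1) by (auto simp: fun_eq_iff indicator_def)
  finally have "integrable (lebesgue_on D) (\<lambda>x. (norm (v x))\<^sup>2)"
    using D by (simp add: Lebesgue_Measure.integrable_restrict_UNIV)
  moreover have "v \<in> borel_measurable (lebesgue_on D)"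
    using L2_measurable[OF v] D(1) by (rule measurable_restrict_mono)
  ultimately show ?thesis by (simp add: L2_iff)
qed

lemma L2_continuous:
  fixes v :: "point \<Rightarrow> 'a::euclidean_space"
  assumes "continuous_on UNIV v" and D: "bounded D" "D \<in> sets lebesgue"
  shows "v \<in> L2 D"
proof -
  have c: "compact (closure D)" using D by (simp add: compact_eq_bounded_closed bounded_closure)
  have v: "continuous_on A v" for A using assms(1) continuous_on_subset by blast
  have "compact (v ` closure D)" using c v by (rule compact_continuous_image[rotated])
  then obtain C where C: "\<And>x. x \<in> closure D \<Longrightarrow> norm (v x) \<le> C"
    using compact_imp_bounded[of "v ` closure D"] by (auto simp: bounded_iff)
  have "finite_measure (lebesgue_on D)"
    using D by (intro finite_measure_lebesgue_on) (simp add: bounded_set_imp_lmeasurable)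
  then interpret finite_measure "lebesgue_on D" .
  have m: "v \<in> borel_measurable (lebesgue_on D)"
    using v[of D] D(2) by (rule continuous_imp_measurable_on_sets_lebesgue)
  have "integrable (lebesgue_on D) (\<lambda>x. (norm (v x))\<^sup>2)"
  proof (rule integrable_const_bound[where B = "C\<^sup>2"])
    show "AE x in lebesgue_on D. norm ((norm (v x))\<^sup>2) \<le> C\<^sup>2"
    proof (rule AE_I2)
      fix x assume "x \<in> space (lebesgue_on D)"
      then have "x \<in> closure D" using closure_subset by auto
      then show "norm ((norm (v x))\<^sup>2) \<le> C\<^sup>2" using C[of x] by (simp add: power_mono)
    qed
  qed (use m in measurable)
  with m show ?thesis by (simp add: L2_iff)
qed

section \<open>The inner product\<close>

lemma ip_commute: "ip D v w = ip D w v"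
  by (simp add: ip_def inner_commute)

lemma ip_add_left:
  "\<lbrakk>u \<in> L2 D; v \<in> L2 D; w \<in> L2 D\<rbrakk> \<Longrightarrow> ip D (\<lambda>x. u x + v x) w = ip D u w + ip D v w"
  by (simp add: ip_def inner_add_left L2_integrable_inner)

lemma ip_diff_left:
  "\<lbrakk>u \<in> L2 D; v \<in> L2 D; w \<in> L2 D\<rbrakk> \<Longrightarrow> ip D (\<lambda>x. u x - v x) w = ip D u w - ip D v w"
  by (simp add: ip_def inner_diff_left L2_integrable_inner)

lemma ip_add_right:
  "\<lbrakk>u \<in> L2 D; v \<in> L2 D; w \<in> L2 D\<rbrakk> \<Longrightarrow> ip D w (\<lambda>x. u x + v x) = ip D w u + ip D w v"
  by (simp add: ip_def inner_add_right L2_integrable_inner)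

lemma ip_diff_right:
  "\<lbrakk>u \<in> L2 D; v \<in> L2 D; w \<in> L2 D\<rbrakk> \<Longrightarrow> ip D w (\<lambda>x. u x - v x) = ip D w u - ip D w v"
  by (simp add: ip_def inner_diff_right L2_integrable_inner)

lemma ip_scaleR_left: "ip D (\<lambda>x. c *\<^sub>R v x) w = c * ip D v w"
  by (simp add: ip_def)

lemma ip_scaleR_right: "ip D v (\<lambda>x. c *\<^sub>R w x) = c * ip D v w"
  by (simp add: ip_def)

lemma ip_minus_left: "ip D (\<lambda>x. - v x) w = - ip D v w"
  by (simp add: ip_def)

lemma ip_0_left: "ip D (\<lambda>_. 0) w = 0"
  by (simp add: ip_def)

lemma ip_0_right: "ip D w (\<lambda>_. 0) = 0"
  by (simp add: ip_def)

lemma ip_sum_right: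
  "\<lbrakk>w \<in> L2 D; \<And>i. i \<in> I \<Longrightarrow> v i \<in> L2 D\<rbrakk> \<Longrightarrow>
    ip D w (\<lambda>x. \<Sum>i\<in>I. v i x) = (\<Sum>i\<in>I. ip D w (v i))"
  by (induction I rule: infinite_finite_induct) (auto simp: ip_0_right ip_add_right L2_sum)

lemma ip_cong_AE:
  assumes "u \<in> L2 D" "u' \<in> L2 D" "v \<in> L2 D" "v' \<in> L2 D"
    and "AE x in lebesgue_on D. u x = u' x" "AE x in lebesgue_on D. v x = v' x"
  shows "ip D u v = ip D u' v'"
  unfolding ip_def
proof (rule integral_cong_AE)
  show "AE x in lebesgue_on D. u x \<bullet> v x = u' x \<bullet> v' x"
    using assms(5,6) by eventually_elim simp
qed (use assms(1-4) in \<open>auto intro: borel_measurable_inner L2_measurable\<close>)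

lemma L2norm_sq: "(L2norm D v)\<^sup>2 = ip D v v"
  by (simp add: L2norm_def ip_def power2_norm_eq_inner)

lemma ip_self_nonneg: "0 \<le> ip D v v"
  by (simp add: ip_def)

lemma ip_self_eq_0:
  assumes "v \<in> L2 D" "ip D v v = 0"
  shows "AE x in lebesgue_on D. v x = 0"
proof -
  have "AE x in lebesgue_on D. v x \<bullet> v x = 0"
    using assms L2_integrable_inner[OF assms(1) assms(1)]
    by (simp add: ip_def integral_nonneg_eq_0_iff_AE)
  then show ?thesis by simp
qed

lemma AE_lebesgue_on_subset:
  assumes "AE x in lebesgue_on \<Omega>. P x" "D \<subseteq> \<Omega>" "D \<in> sets lebesgue" "\<Omega> \<in> sets lebesgue"
  shows "AE x in lebesgue_on D. P x"
  using assms by (auto simp: AE_restrict_space_iff elim!: eventually_mono)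

text \<open>Gram--Schmidt: the projection onto the span of the \<open>g i\<close> exists even when they are
  linearly dependent modulo null sets.\<close>

lemma orthogonal_projection_exists:
  fixes g :: "'i \<Rightarrow> point \<Rightarrow> 'a::euclidean_space"
  assumes "finite I" and "\<And>i. i \<in> I \<Longrightarrow> g i \<in> L2 D" and "v \<in> L2 D"
  shows "\<exists>c. \<forall>j\<in>I. ip D (\<lambda>x. v x - (\<Sum>i\<in>I. c i *\<^sub>R g i x)) (g j) = 0"
  using assms
proof (induction I arbitrary: v rule: finite_induct)
  case empty
  then show ?case by simp
next
  case (insert k I)
  have gI: "g i \<in> L2 D" if "i \<in> I" for i using insert.prems(1) that by simp
  have gk: "g k \<in> L2 D" using insert.prems(1) by simp
  obtain c where c: "\<forall>j\<in>I. ip D (\<lambda>x. v x - (\<Sum>i\<in>I. c i *\<^sub>R g i x)) (g j) = 0"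
    using insert.IH[OF gI insert.prems(2)] by auto
  obtain d where d: "\<forall>j\<in>I. ip D (\<lambda>x. g k x - (\<Sum>i\<in>I. d i *\<^sub>R g i x)) (g j) = 0"
    using insert.IH[OF gI gk] by auto
  define r where "r = (\<lambda>x. v x - (\<Sum>i\<in>I. c i *\<^sub>R g i x))"
  define s where "s = (\<lambda>x. g k x - (\<Sum>i\<in>I. d i *\<^sub>R g i x))"
  have sum_L2: "(\<lambda>x. \<Sum>i\<in>I. b i *\<^sub>R g i x) \<in> L2 D" for b
    using gI by (intro L2_sum L2_scaleR)
  have r_L2: "r \<in> L2 D" and s_L2: "s \<in> L2 D"
    unfolding r_def s_def using insert.prems(2) gk sum_L2 by (auto intro: L2_diff)
  have r_orth: "ip D r (g j) = 0" and s_orth: "ip D s (g j) = 0" if "j \<in> I" for j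
    using c d that by (auto simp: r_def s_def)
  have orth_sum: "ip D u (\<lambda>x. \<Sum>i\<in>I. b i *\<^sub>R g i x) = 0"
    if "u \<in> L2 D" "\<And>j. j \<in> I \<Longrightarrow> ip D u (g j) = 0" for u b
    using that gI by (subst ip_sum_right) (auto simp: ip_scaleR_right intro: L2_scaleR)
  have gk_eq: "g k = (\<lambda>x. s x + (\<Sum>i\<in>I. d i *\<^sub>R g i x))" by (simp add: s_def)
  have ip_gk: "ip D u (g k) = ip D u s"
    if "u \<in> L2 D" "\<And>j. j \<in> I \<Longrightarrow> ip D u (g j) = 0" for u
    using that orth_sum[OF that] by (subst gk_eq) (simp add: ip_add_right s_L2 sum_L2)
  \<comment> \<open>If \<open>g k\<close> lies a.e. in the span of the other functions, then
    \<open>ip D s s = 0\<close> and the division yields \<open>t = 0\<close>; any value would serve,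
    as \<open>s\<close> vanishes a.e.\<close>
  define t where "t = ip D r s / ip D s s"
  define e where "e = (\<lambda>i. if i = k then t else c i - t * d i)"
  have res: "(\<lambda>x. v x - (\<Sum>i\<in>insert k I. e i *\<^sub>R g i x)) = (\<lambda>x. r x - t *\<^sub>R s x)"
  proof
    fix x
    have "(\<Sum>i\<in>I. e i *\<^sub>R g i x) = (\<Sum>i\<in>I. c i *\<^sub>R g i x - t *\<^sub>R (d i *\<^sub>R g i x))"
      using insert.hyps by (intro sum.cong) (auto simp: e_def scaleR_diff_left)
    moreover have "e k = t" by (simp add: e_def)
    ultimately show "v x - (\<Sum>i\<in>insert k I. e i *\<^sub>R g i x) = r x - t *\<^sub>R s x"
      using insert.hyps
      by (simp add: r_def s_def sum_subtractf scaleR_sum_right[symmetric]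
          algebra_simps del: scaleR_scaleR)
  qed
  have ts: "(\<lambda>x. t *\<^sub>R s x) \<in> L2 D" using s_L2 by (rule L2_scaleR)
  have orth: "ip D (\<lambda>x. r x - t *\<^sub>R s x) (g j) = 0" if "j \<in> I" for j
    using that by (simp add: ip_diff_left r_L2 ts gI ip_scaleR_left r_orth s_orth)
  have "ip D (\<lambda>x. r x - t *\<^sub>R s x) (g k) = ip D (\<lambda>x. r x - t *\<^sub>R s x) s"
    using orth by (intro ip_gk L2_diff r_L2 ts)
  also have "\<dots> = ip D r s - t * ip D s s"
    by (simp add: ip_diff_left r_L2 ts s_L2 ip_scaleR_left)
  also have "\<dots> = 0"
  proof (cases "ip D s s = 0")
    case True
    have "AE x in lebesgue_on D. s x = 0" using ip_self_eq_0[OF s_L2 True] .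
    then have "ip D r s = ip D r (\<lambda>_. 0)"
      by (intro ip_cong_AE) (auto simp: r_L2 s_L2 L2_0)
    then show ?thesis using True by (simp add: ip_0_right)
  qed (simp add: t_def)
  finally show ?case using orth by (intro exI[of _ e]) (auto simp: res)
qed

section \<open>Continuously differentiable functions\<close>

lemma C1_GDERIV: "C1 \<phi> G \<Longrightarrow> GDERIV \<phi> x :> G x"
  unfolding C1_def by blast

lemma C1_has_derivative: "C1 \<phi> G \<Longrightarrow> (\<phi> has_derivative (\<lambda>h. h \<bullet> G x)) (at x)"
  using C1_GDERIV by (simp only: gderiv_def)

lemma C1_add: "\<lbrakk>C1 \<phi> G; C1 \<psi> H\<rbrakk> \<Longrightarrow> C1 (\<lambda>x. \<phi> x + \<psi> x) (\<lambda>x. G x + H x)"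
  by (auto simp: C1_def intro: GDERIV_add continuous_intros)

lemma C1_diff: "\<lbrakk>C1 \<phi> G; C1 \<psi> H\<rbrakk> \<Longrightarrow> C1 (\<lambda>x. \<phi> x - \<psi> x) (\<lambda>x. G x - H x)"
  by (auto simp: C1_def intro: GDERIV_diff continuous_intros)

lemma C1_const: "C1 (\<lambda>_. c) (\<lambda>_. 0)"
  by (auto simp: C1_def intro: GDERIV_const)

lemma C1_continuous:
  assumes "C1 \<phi> G"
  shows "continuous_on A \<phi>"
proof -
  have "isCont \<phi> x" for x
    using C1_has_derivative[OF assms] by (rule has_derivative_continuous)
  then show ?thesis by (simp add: continuous_at_imp_continuous_on)
qed

lemma C1_continuous_grad: "C1 \<phi> G \<Longrightarrow> continuous_on A G"
  using continuous_on_subset by (auto simp: C1_def)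

lemma C1_mult:
  "\<lbrakk>C1 \<phi> G; C1 \<psi> H\<rbrakk> \<Longrightarrow> C1 (\<lambda>x. \<phi> x * \<psi> x) (\<lambda>x. \<phi> x *\<^sub>R H x + \<psi> x *\<^sub>R G x)"
  using C1_continuous[of \<phi> G UNIV] C1_continuous[of \<psi> H UNIV]
  by (auto simp: C1_def intro!: GDERIV_mult continuous_intros)

lemma C1_scale: "C1 \<phi> G \<Longrightarrow> C1 (\<lambda>x. c * \<phi> x) (\<lambda>x. c *\<^sub>R G x)"
  using C1_mult[OF C1_const[of c], of \<phi> G] by simp

lemma C1_fst: "C1 fst (\<lambda>_. (1, 0))"
  by (auto simp: C1_def gderiv_def intro!: derivative_eq_intros)

lemma C1_snd: "C1 snd (\<lambda>_. (0, 1))"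
  by (auto simp: C1_def gderiv_def intro!: derivative_eq_intros)

lemma GDERIV_unique: 
  assumes "GDERIV f x :> G" "GDERIV f x :> H" shows "G = H"
proof -
  have "(\<lambda>h. h \<bullet> G) = (\<lambda>h. h \<bullet> H)"
    using assms unfolding gderiv_def by (rule has_derivative_unique)
  then show ?thesis by (metis inner_commute vector_eq_rdot)
qed

lemma C1_unique: "\<lbrakk>C1 \<phi> G; C1 \<phi> H\<rbrakk> \<Longrightarrow> G = H"
  using C1_GDERIV GDERIV_unique by (intro ext) blast

lemma C1_grad_eq_0:
  assumes "C1 \<phi> G" "open A" "x \<in> A" "\<And>y. y \<in> A \<Longrightarrow> \<phi> y = c"
  shows "G x = 0"
proof (rule GDERIV_unique)
  show "GDERIV \<phi> x :> G x" using assms(1) by (rule C1_GDERIV)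
  have "((\<lambda>_. c) has_derivative (\<lambda>h. h \<bullet> 0)) (at x)" by simp
  then have "(\<phi> has_derivative (\<lambda>h. h \<bullet> 0)) (at x)"
    by (rule has_derivative_transform_within_open[where s = A]) (use assms in auto)
  then show "GDERIV \<phi> x :> 0" by (simp add: gderiv_def)
qed

text \<open>The complement of the support is open, so the gradient vanishes there along with the
  function. Integrals over \<open>D\<close> can thus be extended to larger sets.\<close>

lemma C1c_outside:
  assumes "C1c D \<phi> G" "x \<notin> D"
  shows "\<phi> x = 0" "G x = 0"
proof -
  have x: "x \<in> - closure {x. \<phi> x \<noteq> 0}" using assms by (auto simp: C1c_def)
  have zero: "\<phi> y = 0" if "y \<in> - closure {x. \<phi> x \<noteq> 0}" for y
    using that closure_subset[of "{x. \<phi> x \<noteq> 0}"] by auto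
  show "\<phi> x = 0" using zero[OF x] .
  show "G x = 0"
    by (rule C1_grad_eq_0[OF _ _ x zero]) (use assms(1) in \<open>simp_all add: C1c_def open_Compl\<close>)
qed

lemma C1c_mono: "\<lbrakk>C1c D \<phi> G; D \<subseteq> \<Omega>\<rbrakk> \<Longrightarrow> C1c \<Omega> \<phi> G"
  unfolding C1c_def by blast

lemma C1c_mult:
  assumes "C1c D \<phi> G" "C1 \<psi> H"
  shows "C1c D (\<lambda>x. \<phi> x * \<psi> x) (\<lambda>x. \<phi> x *\<^sub>R H x + \<psi> x *\<^sub>R G x)"
proof -
  have sub: "closure {x. \<phi> x * \<psi> x \<noteq> 0} \<subseteq> closure {x. \<phi> x \<noteq> 0}"
    by (rule closure_mono) auto
  have "compact (closure {x. \<phi> x * \<psi> x \<noteq> 0})"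
    using compact_Int_closed[of "closure {x. \<phi> x \<noteq> 0}" "closure {x. \<phi> x * \<psi> x \<noteq> 0}"] assms(1) sub
    by (simp add: C1c_def Int_absorb1)
  then show ?thesis using assms sub by (auto simp: C1c_def intro: C1_mult)
qed

lemma C1_slice:
  assumes "C1 \<psi> H"
  shows "((\<lambda>x. \<psi> (x, y)) has_real_derivative fst (H (x, y))) (at x)"
proof -
  have p: "((\<lambda>x. (x, y)) has_derivative (\<lambda>h. (h, 0))) (at x)"
    by (auto intro!: derivative_eq_intros)
  have "((\<lambda>x. \<psi> (x, y)) has_derivative (\<lambda>h. (h, 0) \<bullet> H (x, y))) (at x)"
    by (rule has_derivative_compose[OF p C1_has_derivative[OF assms]])
  moreover have "(\<lambda>h. (h, 0) \<bullet> H (x, y)) = (*) (fst (H (x, y)))"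
    by (cases "H (x, y)") (auto simp: fun_eq_iff)
  ultimately show ?thesis by (simp add: has_field_derivative_def)
qed

section \<open>Exchange of the two coordinates\<close>

lemma continuous_on_swap: "continuous_on A (prod.swap :: point \<Rightarrow> point)"
  unfolding prod.swap_def by (intro continuous_intros)

lemma swap_image_eq_vimage: "prod.swap ` A = prod.swap -` A" for A :: "point set"
  by (auto simp: image_iff) (metis swap_simp)

lemma open_bounded_swap:
  fixes U :: "point set"
  assumes "open U" "bounded U"
  shows "open (prod.swap ` U)" "bounded (prod.swap ` U)"
proof -
  show "open (prod.swap ` U)"
    unfolding swap_image_eq_vimage using assms(1) continuous_on_swap by (rule open_vimage)
  have "bounded_linear (prod.swap :: point \<Rightarrow> point)"
    by (simp add: linear_conv_bounded_linear[symmetric] linear_iff)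
  then show "bounded (prod.swap ` U)" using assms(2) by (rule bounded_linear_image[rotated])
qed

lemma C1_swap:
  assumes "C1 \<psi> H"
  shows "C1 (\<lambda>p. \<psi> (prod.swap p)) (\<lambda>p. prod.swap (H (prod.swap p)))"
proof -
  have sw: "((prod.swap :: point \<Rightarrow> point) has_derivative prod.swap) (at x)" for x
    unfolding prod.swap_def by (auto intro!: derivative_eq_intros)
  have "((\<lambda>p. \<psi> (prod.swap p)) has_derivative (\<lambda>h. prod.swap h \<bullet> H (prod.swap x))) (at x)" for x
    by (rule has_derivative_compose[OF sw C1_has_derivative[OF assms]])
  moreover have "prod.swap h \<bullet> H (prod.swap x) = h \<bullet> prod.swap (H (prod.swap x))" for h x
    by (cases h; cases "H (prod.swap x)") simp
  moreover have "continuous_on UNIV (\<lambda>p. prod.swap (H (prod.swap p)))"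
    using C1_continuous_grad[OF assms] continuous_on_swap
    by (intro continuous_on_compose2[OF continuous_on_swap]
        continuous_on_compose2[OF _ continuous_on_swap]) auto
  ultimately show ?thesis by (simp add: C1_def gderiv_def)
qed

section \<open>Integration over slices\<close>

text \<open>Inner products are taken with Lebesgue measure, whereas Fubini's theorem is applied to
  the Borel product measure; for continuous integrands the two integrals agree.\<close>

lemma integral_lebesgue_on_lborel:
  fixes f :: "point \<Rightarrow> real"
  assumes "open U" "continuous_on UNIV f"
  shows "(LINT p|lebesgue_on U. f p) = (LINT p|lborel. indicator U p * f p)"
proof -
  have "(LINT p|lebesgue_on U. f p) = (LINT p|lebesgue. indicator U p * f p)"
    using assms(1) by (subst Bochner_Integration.integral_restrict_space) auto
  also have "\<dots> = (LINT p|lborel. indicator U p * f p)"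
    using assms(1) borel_measurable_continuous_onI[OF assms(2)]
    by (intro integral_completion) auto
  finally show ?thesis .
qed

lemma integrable_indicator_continuous:
  fixes f :: "'a::euclidean_space \<Rightarrow> real"
  assumes "open U" "bounded U" "continuous_on UNIV f"
  shows "integrable lborel (\<lambda>p. indicator U p * f p)"
proof -
  have f: "continuous_on A f" for A using assms(3) continuous_on_subset by blast
  have "compact (closure U)" using assms(2) by simp
  then have "integrable lborel (\<lambda>p. indicator (closure U) p *\<^sub>R f p)"
    using f by (rule borel_integrable_compact)
  then have "integrable lborel (\<lambda>p. indicator U p *\<^sub>R (indicator (closure U) p *\<^sub>R f p))"
    by (rule integrable_mult_indicator[rotated]) (use assms in auto)
  also have "(\<lambda>p. indicator U p *\<^sub>R (indicator (closure U) p *\<^sub>R f p)) = (\<lambda>p. indicator U p * f p)"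
    using closure_subset[of U] by (auto simp: fun_eq_iff indicator_def)
  finally show ?thesis .
qed

lemma integral_slices:
  fixes f :: "point \<Rightarrow> real"
  assumes "open U" "bounded U" "continuous_on UNIV f"
  shows "(LINT p|lebesgue_on U. f p) =
    (LINT y|lborel. LINT x|lborel. indicator U (x, y) * f (x, y))"
proof -
  have "integrable (lborel \<Otimes>\<^sub>M lborel) (\<lambda>p. indicator U p * f p)"
    using integrable_indicator_continuous[OF assms] by (simp add: lborel_prod)
  then show ?thesis
    using integral_lebesgue_on_lborel[OF assms(1,3)]
      lborel_pair.integral_snd[of "\<lambda>x y. indicator U (x, y) * f (x, y)"]
    by (simp add: lborel_prod case_prod_unfold)
qed

lemma integral_swap:
  fixes f :: "point \<Rightarrow> real"
  assumes "open U" "continuous_on UNIV f"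
  shows "(LINT p|lebesgue_on U. f p) = (LINT p|lebesgue_on (prod.swap ` U). f (prod.swap p))"
proof -
  have "open (prod.swap -` U)" using assms(1) continuous_on_swap by (rule open_vimage)
  moreover have "continuous_on UNIV (\<lambda>p. f (prod.swap p))"
    using assms(2) continuous_on_swap by (rule continuous_on_compose2) auto
  ultimately have "(LINT p|lebesgue_on (prod.swap ` U). f (prod.swap p)) =
      (LINT p|lborel. indicator (prod.swap -` U) p * f (prod.swap p))"
    by (simp add: swap_image_eq_vimage integral_lebesgue_on_lborel)
  also have "\<dots> = integral\<^sup>L (lborel \<Otimes>\<^sub>M lborel) (\<lambda>(x, y). indicator U (y, x) * f (y, x))"
    by (simp add: lborel_prod case_prod_unfold indicator_vimage prod.swap_def)
  also have "\<dots> = integral\<^sup>L (lborel \<Otimes>\<^sub>M lborel) (\<lambda>p. indicator U p * f p)"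
    using assms(1) borel_measurable_continuous_onI[OF assms(2)]
    by (intro lborel_pair.integral_product_swap) (auto simp: lborel_prod)
  also have "\<dots> = (LINT p|lebesgue_on U. f p)"
    using assms by (simp add: integral_lebesgue_on_lborel lborel_prod)
  finally show ?thesis by simp
qed

text \<open>The fundamental theorem of calculus with a finite exceptional set: the integrand may
  jump there, as a derivative cut off outside an open set does, provided that the primitive
  \<open>W\<close> stays continuous.\<close>

lemma integral_eq_boundary_values:
  fixes W g :: "real \<Rightarrow> real"
  assumes g: "integrable lborel g" "\<And>x. x \<notin> {-R..R} \<Longrightarrow> g x = 0"
    and W: "finite B" "0 \<le> R" "\<And>x. x \<in> {-R<..<R} - B \<Longrightarrow> (W has_real_derivative g x) (at x)"
      "continuous_on {-R..R} W"
  shows "(LINT x|lborel. g x) = W R - W (-R)"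
proof -
  have "(g has_integral (W R - W (-R))) {-R..R}"
    using W by (intro fundamental_theorem_of_calculus_interior_strong[where S = B])
      (auto simp: has_real_derivative_iff_has_vector_derivative)
  then have "(g has_integral (W R - W (-R))) UNIV"
    by (rule has_integral_on_superset) (use g(2) in auto)
  moreover have "(g has_integral (LINT x|lborel. g x)) UNIV"
    using g(1) by (rule has_integral_integral_lborel)
  ultimately show ?thesis by (rule has_integral_unique[symmetric])
qed

lemma integral_C1_fst:
  assumes \<psi>: "C1 \<psi> H" and D: "open D" "bounded D"
    and out: "\<And>x. x \<notin> D \<Longrightarrow> \<psi> x = 0" "\<And>x. x \<notin> D \<Longrightarrow> H x = 0"
  shows "(LINT p|lebesgue_on D. fst (H p)) = 0"
proof -
  have H: "continuous_on UNIV (\<lambda>p. fst (H p))"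
    using C1_continuous_grad[OF \<psi>] by (intro continuous_intros)
  obtain R where R: "0 < R" "\<And>p. p \<in> D \<Longrightarrow> norm p < R"
    using D(2) by (meson bounded_pos_less)
  have zero: "\<psi> (x, y) = 0 \<and> H (x, y) = 0" if "R \<le> \<bar>x\<bar>" for x y
  proof -
    have "\<bar>x\<bar> \<le> norm (x, y)" by (metis norm_fst_le real_norm_def)
    then have "(x, y) \<notin> D" using R(2) that by fastforce
    then show ?thesis using out by simp
  qed
  have "(LINT x|lborel. indicator D (x, y) * fst (H (x, y))) = 0" for y
  proof -
    \<comment> \<open>A horizontal line may meet \<open>D\<close> in infinitely many intervals. As
      \<open>H\<close> vanishes off \<open>D\<close>, the indicator of \<open>D\<close> may be
      traded for that of one interval.\<close>
    have ind: "indicator D (x, y) * fst (H (x, y)) = indicator {-R<..<R} x * fst (H (x, y))" for x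
      using out(2)[of "(x, y)"] zero[of x y] by (auto simp: indicator_def)
    have "continuous_on UNIV (\<lambda>x. fst (H (x, y)))"
      by (rule continuous_on_compose2[OF H]) (auto intro!: continuous_intros)
    then have "integrable lborel (\<lambda>x. indicator {-R<..<R} x * fst (H (x, y)))"
      by (intro integrable_indicator_continuous) auto
    then have "(LINT x|lborel. indicator D (x, y) * fst (H (x, y))) = \<psi> (R, y) - \<psi> (-R, y)"
      unfolding ind
    proof (rule integral_eq_boundary_values[where B = "{}"])
      show "((\<lambda>x. \<psi> (x, y)) has_real_derivative indicator {-R<..<R} x * fst (H (x, y))) (at x)"
        if "x \<in> {-R<..<R} - {}" for x
        using C1_slice[OF \<psi>] that by simp
      show "continuous_on {-R..R} (\<lambda>x. \<psi> (x, y))"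
        by (rule continuous_on_compose2[OF C1_continuous[OF \<psi>]]) (auto intro: continuous_intros)
    qed (use R in \<open>auto simp: indicator_def\<close>)
    also have "\<dots> = 0" using zero[of R y] zero[of "-R" y] by simp
    finally show ?thesis .
  qed
  then show ?thesis using integral_slices[OF D H] by simp
qed

lemma integral_C1_snd:
  assumes \<psi>: "C1 \<psi> H" and D: "open D" "bounded D"
    and out: "\<And>x. x \<notin> D \<Longrightarrow> \<psi> x = 0" "\<And>x. x \<notin> D \<Longrightarrow> H x = 0"
  shows "(LINT p|lebesgue_on D. snd (H p)) = 0"
proof -
  have H: "continuous_on UNIV (\<lambda>p. snd (H p))"
    using C1_continuous_grad[OF \<psi>] by (intro continuous_intros)
  have "(LINT p|lebesgue_on (prod.swap ` D). fst (prod.swap (H (prod.swap p)))) = 0"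
    by (rule integral_C1_fst[OF C1_swap[OF \<psi>] open_bounded_swap[OF D]])
      (auto simp: swap_image_eq_vimage out zero_prod_def)
  then show ?thesis using integral_swap[OF D(1) H] by simp
qed

section \<open>Weak derivatives\<close>

lemma C1c_L2:
  assumes "C1c D \<phi> G" "open U" "bounded U"
  shows "\<phi> \<in> L2 U" "G \<in> L2 U"
  using assms C1_continuous C1_continuous_grad by (auto simp: C1c_def intro!: L2_continuous)

lemma C1_L2:
  assumes "C1 \<phi> G" "open U" "bounded U"
  shows "\<phi> \<in> L2 U" "G \<in> L2 U"
  using assms C1_continuous C1_continuous_grad by (auto intro!: L2_continuous)

section \<open>The fundamental lemma of the calculus of variations\<close>

lemma C1_real_polynomial_function:
  fixes q :: "point \<Rightarrow> real"
  shows "real_polynomial_function q \<Longrightarrow> \<exists>H. C1 q H"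
proof (induction q rule: real_polynomial_function.induct)
  case (linear f)
  then interpret bounded_linear f .
  have "f x = f (1, 0) * fst x + f (0, 1) * snd x" for x
    using add[of "fst x *\<^sub>R (1, 0)" "snd x *\<^sub>R (0, 1)"]
      scaleR[of "fst x" "(1, 0)"] scaleR[of "snd x" "(0, 1)"]
    by (simp add: mult.commute)
  then have "f = (\<lambda>x. f (1, 0) * fst x + f (0, 1) * snd x)" by (rule ext)
  then show ?case by (metis C1_add C1_scale C1_fst C1_snd)
next
  case (const c)
  then show ?case using C1_const by blast
next
  case (add f g)
  then show ?case using C1_add by blast
next
  case (mult f g)
  then show ?case using C1_mult by blast
qed

lemma C1c_bump:
  fixes z :: point
  assumes "0 < r" "cball z r \<subseteq> D"
  obtains \<phi> G where "C1c D \<phi> G" "\<And>x. 0 < \<phi> x \<longleftrightarrow> x \<in> ball z r" "\<And>x. 0 \<le> \<phi> x"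
proof
  \<comment> \<open>Squaring the positive part makes it continuously differentiable across the
    sphere, which is the regularity that \<open>C1c\<close> asks for.\<close>
  define \<phi> where "\<phi> = (\<lambda>x. (max 0 (r\<^sup>2 - (x - z) \<bullet> (x - z)))\<^sup>2)"
  define G where "G = (\<lambda>x. (2 * max 0 (r\<^sup>2 - (x - z) \<bullet> (x - z))) *\<^sub>R (- 2 *\<^sub>R (x - z)))"
  have sq: "((\<lambda>t::real. (max 0 t)\<^sup>2) has_real_derivative 2 * max 0 t) (at t)" for t
  proof -
    consider "t < 0" | "t = 0" | "0 < t" by linarith
    then show ?thesis
    proof cases
      case 1
      have "((\<lambda>_::real. 0::real) has_real_derivative 0) (at t)" by simp
      then have "((\<lambda>t::real. (max 0 t)\<^sup>2) has_real_derivative 0) (at t)"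
        by (rule has_field_derivative_transform_within_open[where S = "{..<0}"]) (use 1 in auto)
      then show ?thesis using 1 by simp
    next
      case 2
      have "((\<lambda>h::real. (max 0 h)\<^sup>2 / h) \<longlongrightarrow> 0) (at 0)"
      proof (rule Lim_null_comparison)
        show "\<forall>\<^sub>F h::real in at 0. norm ((max 0 h)\<^sup>2 / h) \<le> \<bar>h\<bar>"
          by (rule always_eventually) (auto simp: power2_eq_square max_def)
        show "((\<lambda>h::real. \<bar>h\<bar>) \<longlongrightarrow> 0) (at 0)" by (auto intro!: tendsto_eq_intros)
      qed
      then show ?thesis using 2 by (simp add: DERIV_def)
    next
      case 3
      have "((\<lambda>t::real. t\<^sup>2) has_real_derivative 2 * t) (at t)"
        by (auto intro!: derivative_eq_intros)
      then have "((\<lambda>t::real. (max 0 t)\<^sup>2) has_real_derivative 2 * t) (at t)"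
        by (rule has_field_derivative_transform_within_open[where S = "{0<..}"]) (use 3 in auto)
      then show ?thesis using 3 by simp
    qed
  qed
  have "GDERIV (\<lambda>x. r\<^sup>2 - (x - z) \<bullet> (x - z)) x :> (- 2 *\<^sub>R (x - z))" for x
    unfolding gderiv_def
    by (auto intro!: derivative_eq_intros simp: fun_eq_iff inner_commute)
  then have "GDERIV \<phi> x :> G x" for x
    unfolding \<phi>_def G_def by (rule GDERIV_DERIV_compose[OF _ sq])
  moreover have "continuous_on UNIV G"
    unfolding G_def by (intro continuous_intros)
  ultimately have C1: "C1 \<phi> G" unfolding C1_def by blast
  have eq: "(x - z) \<bullet> (x - z) = (dist z x)\<^sup>2" for x
    by (simp add: dist_norm power2_norm_eq_inner norm_minus_commute)
  have lt: "(dist z x)\<^sup>2 < r\<^sup>2 \<longleftrightarrow> dist z x < r" for x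
    using assms(1) by (metis less_eq_real_def power2_less_imp_less power_strict_mono zero_le_dist zero_less_numeral)
  show pos: "0 < \<phi> x \<longleftrightarrow> x \<in> ball z r" for x
    using lt[of x] by (auto simp: \<phi>_def eq max_def)
  show nonneg: "0 \<le> \<phi> x" for x by (simp add: \<phi>_def)
  have "{x. \<phi> x \<noteq> 0} = ball z r" using pos nonneg by (auto simp: less_le)
  then show "C1c D \<phi> G" using assms C1 by (simp add: C1c_def closure_ball compact_cball)
qed

text \<open>By Stone-Weierstrass on \<open>C\<close>, orthogonality extends from polynomials to
  continuous functions. Approximating \<open>sgn (w x)\<close> pointwise a.e. by continuous
  functions then gives zero for the integral of |w|.\<close>

lemma integrable_eq_0_if_orthogonal_to_polynomials:
  fixes w :: "point \<Rightarrow> real"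
  assumes w: "integrable lebesgue w" and C: "compact C" "\<And>x. x \<notin> C \<Longrightarrow> w x = 0"
    and orth: "\<And>P. real_polynomial_function P \<Longrightarrow> (LINT x|lebesgue. P x * w x) = 0"
  shows "AE x in lebesgue. w x = 0"
proof -
  have w_meas: "w \<in> borel_measurable lebesgue" using w by simp
  have int: "integrable lebesgue (\<lambda>x. h x * w x)" if "continuous_on UNIV h" for h
  proof -
    have "compact (h ` C)" using C(1) that continuous_on_subset by (blast intro: compact_continuous_image)
    then obtain M where M: "\<And>x. x \<in> C \<Longrightarrow> norm (h x) \<le> M"
      using compact_imp_bounded[of "h ` C"] by (auto simp: bounded_iff)
    have hm: "h \<in> borel_measurable lebesgue"
      using borel_measurable_continuous_onI[OF that] by (simp add: measurable_completion)
    show ?thesis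
    proof (rule Bochner_Integration.integrable_bound)
      show "integrable lebesgue (\<lambda>x. M * w x)" using w by simp
      show "(\<lambda>x. h x * w x) \<in> borel_measurable lebesgue" using hm w_meas by measurable
      show "AE x in lebesgue. norm (h x * w x) \<le> norm (M * w x)"
      proof (rule AE_I2)
        fix x show "norm (h x * w x) \<le> norm (M * w x)"
        proof (cases "x \<in> C")
          case True
          then have "\<bar>h x\<bar> \<le> \<bar>M\<bar>" using M[of x] by simp
          then show ?thesis by (simp add: abs_mult mult_right_mono)
        qed (simp add: C(2))
      qed
    qed
  qed
  have cont: "(LINT x|lebesgue. h x * w x) = 0" if h: "continuous_on UNIV h" for h
  proof -
    define A where "A = (LINT x|lebesgue. \<bar>w x\<bar>)"
    have A: "0 \<le> A" by (simp add: A_def)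
    have bound: "\<bar>LINT x|lebesgue. h x * w x\<bar> \<le> e * A" if e: "0 < e" for e
    proof -
      have "continuous_on C h" using h continuous_on_subset by blast
      then obtain P where P: "real_polynomial_function P" "\<And>x. x \<in> C \<Longrightarrow> \<bar>h x - P x\<bar> < e"
        using Stone_Weierstrass_real_polynomial_function[OF C(1)] e by blast
      have Pc: "continuous_on UNIV P"
        using P(1) by (simp add: continuous_on_polymonial_function real_polynomial_function_eq)
      have "(LINT x|lebesgue. h x * w x) = (LINT x|lebesgue. h x * w x - P x * w x)"
        using int[OF h] int[OF Pc] orth[OF P(1)] by simp
      also have "\<bar>\<dots>\<bar> \<le> (LINT x|lebesgue. e * \<bar>w x\<bar>)"
      proof (rule integral_abs_bound_integral)
        show "integrable lebesgue (\<lambda>x. h x * w x - P x * w x)" using int[OF h] int[OF Pc] by simp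
        show "integrable lebesgue (\<lambda>x. e * \<bar>w x\<bar>)" using w by simp
        fix x
        show "\<bar>h x * w x - P x * w x\<bar> \<le> e * \<bar>w x\<bar>"
        proof (cases "x \<in> C")
          case True
          then show ?thesis using P(2)[of x]
            by (simp add: left_diff_distrib[symmetric] abs_mult mult_right_mono)
        qed (simp add: C(2))
      qed
      finally show ?thesis by (simp add: A_def)
    qed
    \<comment> \<open>The tolerance is \<open>e / (A + 1)\<close> rather than \<open>e / A\<close>
      because \<open>A\<close> may be 0.\<close>
    have "\<bar>LINT x|lebesgue. h x * w x\<bar> \<le> 0 + e" if "0 < e" for e
    proof -
      have "\<bar>LINT x|lebesgue. h x * w x\<bar> \<le> (e / (A + 1)) * A"
        using A that by (intro bound) simp
      also have "\<dots> \<le> e" using A that by (simp add: field_simps)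
      finally show ?thesis by simp
    qed
    then have "\<bar>LINT x|lebesgue. h x * w x\<bar> \<le> 0" by (rule field_le_epsilon)
    then show ?thesis by simp
  qed
  have "(\<lambda>x. sgn (w x)) \<in> borel_measurable lebesgue" using w_meas by measurable
  then have "(\<lambda>x. sgn (w x)) measurable_on UNIV"
    by (simp add: measurable_on_iff_borel_measurable lebesgue_on_UNIV_eq)
  then obtain N g where N: "negligible N" and g: "\<And>n::nat. continuous_on UNIV (g n)"
    and lim: "\<And>x. x \<notin> N \<Longrightarrow> (\<lambda>n. g n x) \<longlonglongrightarrow> sgn (w x)"
    unfolding measurable_on_def by auto
  \<comment> \<open>Truncation to [-1, 1] makes |w| a majorant for dominated convergence and does
    not disturb the limit, since \<open>sgn\<close> takes values in this interval.\<close>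
  define h where "h = (\<lambda>n x. max (-1) (min 1 (g n x)))"
  have h: "continuous_on UNIV (h n)" for n unfolding h_def using g by (intro continuous_intros)
  have hm: "h n \<in> borel_measurable lebesgue" for n
    using borel_measurable_continuous_onI[OF h] by (simp add: measurable_completion)
  have AE_N: "AE x in lebesgue. x \<notin> N"
    using N by (simp add: negligible_iff_null_sets AE_not_in)
  have "(\<lambda>n. LINT x|lebesgue. h n x * w x) \<longlonglongrightarrow> (LINT x|lebesgue. \<bar>w x\<bar>)"
  proof (rule integral_dominated_convergence)
    show "(\<lambda>x. h n x * w x) \<in> borel_measurable lebesgue" for n using hm w_meas by measurable
    show "integrable lebesgue (\<lambda>x. \<bar>w x\<bar>)" using w by simp
    show "AE x in lebesgue. norm (h n x * w x) \<le> \<bar>w x\<bar>" for n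
    proof (rule AE_I2)
      fix x
      have "\<bar>h n x\<bar> \<le> 1" by (auto simp: h_def)
      then show "norm (h n x * w x) \<le> \<bar>w x\<bar>" by (simp add: abs_mult mult_left_le_one_le)
    qed
    show "AE x in lebesgue. (\<lambda>n. h n x * w x) \<longlonglongrightarrow> \<bar>w x\<bar>"
      using AE_N
    proof eventually_elim
      case (elim x)
      have "(\<lambda>n. h n x * w x) \<longlonglongrightarrow> max (-1) (min 1 (sgn (w x))) * w x"
        unfolding h_def by (intro tendsto_intros lim elim)
      also have "max (-1) (min 1 (sgn (w x))) * w x = \<bar>w x\<bar>" by (auto simp: sgn_if)
      finally show ?case .
    qed
  qed (use w_meas in measurable)
  then have "(LINT x|lebesgue. \<bar>w x\<bar>) = 0" using cont[OF h] by (simp add: LIMSEQ_const_iff)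
  then have "AE x in lebesgue. \<bar>w x\<bar> = 0"
    using w by (subst (asm) integral_nonneg_eq_0_iff_AE) auto
  then show ?thesis by simp
qed

text \<open>Products of one bump function with polynomials are enough test functions: by
  Stone--Weierstrass, polynomials are dense in the continuous functions.\<close>

lemma fundamental_lemma:
  fixes g :: "point \<Rightarrow> real"
  assumes D: "open D" "bounded D" and g: "g \<in> L2 D"
    and orth: "\<And>\<phi> G. C1c D \<phi> G \<Longrightarrow> ip D \<phi> g = 0"
  shows "AE x in lebesgue_on D. g x = 0"
proof -
  have ball: "AE x in lebesgue. x \<in> ball z r \<longrightarrow> g x = 0" if zr: "0 < r" "cball z r \<subseteq> D" for z r
  proof -
    obtain \<phi> G where \<phi>: "C1c D \<phi> G" "\<And>x. 0 < \<phi> x \<longleftrightarrow> x \<in> ball z r" "\<And>x. 0 \<le> \<phi> x"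
      using C1c_bump[OF zr] by metis
    define w where "w = (\<lambda>x. if x \<in> D then \<phi> x * g x else 0)"
    have "AE x in lebesgue. w x = 0"
    proof (rule integrable_eq_0_if_orthogonal_to_polynomials)
      show "integrable lebesgue w"
        unfolding w_def using L2_integrable_inner[OF C1c_L2(1)[OF \<phi>(1) D] g] D(1)
        by (simp add: Lebesgue_Measure.integrable_restrict_UNIV)
      show "compact (cball z r)" by simp
      show "w x = 0" if "x \<notin> cball z r" for x
        using that \<phi>(2)[of x] \<phi>(3)[of x] by (auto simp: w_def)
      fix P :: "point \<Rightarrow> real" assume "real_polynomial_function P"
      then obtain H where H: "C1 P H" using C1_real_polynomial_function by blast
      have "(LINT x|lebesgue. P x * w x) = (LINT x|lebesgue. (if x \<in> D then \<phi> x * P x * g x else 0))"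
        by (rule Bochner_Integration.integral_cong) (auto simp: w_def)
      also have "\<dots> = (LINT x|lebesgue_on D. \<phi> x * P x * g x)"
        using D(1) by (simp add: Lebesgue_Measure.integral_restrict_UNIV)
      also have "\<dots> = ip D (\<lambda>x. \<phi> x * P x) g" by (simp add: ip_def)
      also have "\<dots> = 0" using orth[OF C1c_mult[OF \<phi>(1) H]] .
      finally show "(LINT x|lebesgue. P x * w x) = 0" .
    qed
    then show ?thesis
    proof eventually_elim
      case (elim x)
      show ?case
      proof
        assume x: "x \<in> ball z r"
        then have "x \<in> D" using zr(2) ball_subset_cball by blast
        then show "g x = 0" using elim x \<phi>(2)[of x] by (simp add: w_def)
      qed
    qed
  qed
  \<comment> \<open>Each ball leaves its own null set of exceptions; by Lindelof's theorem countably
    many balls cover \<open>D\<close>, so the union of the exceptions is still null.\<close>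
  define F where "F = {ball z r | z r. 0 < r \<and> cball z r \<subseteq> D}"
  have "\<And>S. S \<in> F \<Longrightarrow> open S" by (auto simp: F_def)
  then obtain F' where F': "F' \<subseteq> F" "countable F'" "\<Union>F' = \<Union>F" by (rule Lindelof)
  have "D \<subseteq> \<Union>F"
  proof
    fix x assume "x \<in> D"
    then obtain r where "0 < r" "cball x r \<subseteq> D" using D(1) open_contains_cball by blast
    then have "ball x r \<in> F" unfolding F_def by blast
    then show "x \<in> \<Union>F" by (rule UnionI) (simp add: \<open>0 < r\<close>)
  qed
  moreover have "AE x in lebesgue. \<forall>B\<in>F'. x \<in> B \<longrightarrow> g x = 0"
    using F'(1) by (intro AE_ball_countable'[OF _ F'(2)]) (auto simp: F_def intro: ball)
  ultimately have "AE x in lebesgue. x \<in> D \<longrightarrow> g x = 0"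
    using F'(3) by (auto elim!: eventually_mono)
  then show ?thesis using D(1) by (simp add: AE_restrict_space_iff)
qed

section \<open>Calculus of weak derivatives\<close>

lemma has_weak_grad_restrict:
  assumes "has_weak_grad \<Omega> v g" "D \<subseteq> \<Omega>" "open D" "open \<Omega>"
  shows "has_weak_grad D v g"
  unfolding has_weak_grad_def
proof (intro allI impI)
  fix \<phi> G assume \<phi>: "C1c D \<phi> G"
  have *: "(LINT x|lebesgue_on D. h x) = (LINT x|lebesgue_on \<Omega>. h x)"
    if "\<And>x. x \<notin> D \<Longrightarrow> h x = 0" for h :: "point \<Rightarrow> point"
  proof -
    have "(LINT x|lebesgue_on D. h x) = (LINT x|lebesgue_on \<Omega>. (if x \<in> D then h x else 0))"
      using assms by (subst Lebesgue_Measure.integral_restrict) auto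
    also have "(\<lambda>x. if x \<in> D then h x else 0) = h" using that by (auto simp: fun_eq_iff)
    finally show ?thesis .
  qed
  have "(LINT x|lebesgue_on D. v x *\<^sub>R G x) = (LINT x|lebesgue_on \<Omega>. v x *\<^sub>R G x)"
    "(LINT x|lebesgue_on D. \<phi> x *\<^sub>R g x) = (LINT x|lebesgue_on \<Omega>. \<phi> x *\<^sub>R g x)"
    by (rule *; simp add: C1c_outside[OF \<phi>])+
  moreover have "C1c \<Omega> \<phi> G" using \<phi> assms(2) by (rule C1c_mono)
  ultimately show "(LINT x|lebesgue_on D. v x *\<^sub>R G x) = - (LINT x|lebesgue_on D. \<phi> x *\<^sub>R g x)"
    using assms(1) by (simp add: has_weak_grad_def)
qed

text \<open>Splits the vector-valued integrals into coordinates so that the rules for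
  \<open>ip\<close> and the fundamental lemma apply. Square integrability enters because
  \<open>fst\<close> and \<open>snd\<close> are exchanged with integrals of integrable
  functions.\<close>

lemma has_weak_grad_iff:
  assumes D: "open D" "bounded D" and v: "v \<in> L2 D" and g: "g \<in> L2 D"
  shows "has_weak_grad D v g \<longleftrightarrow> (\<forall>\<phi> G. C1c D \<phi> G \<longrightarrow>
      ip D v (\<lambda>x. fst (G x)) = - ip D \<phi> (\<lambda>x. fst (g x)) \<and>
      ip D v (\<lambda>x. snd (G x)) = - ip D \<phi> (\<lambda>x. snd (g x)))"
proof -
  have "(LINT x|lebesgue_on D. v x *\<^sub>R G x) = - (LINT x|lebesgue_on D. \<phi> x *\<^sub>R g x) \<longleftrightarrow>
      ip D v (\<lambda>x. fst (G x)) = - ip D \<phi> (\<lambda>x. fst (g x)) \<and>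
      ip D v (\<lambda>x. snd (G x)) = - ip D \<phi> (\<lambda>x. snd (g x))" if "C1c D \<phi> G" for \<phi> G
  proof -
    note L = C1c_L2[OF that D]
    have i: "integrable (lebesgue_on D) (\<lambda>x. v x *\<^sub>R G x)"
      "integrable (lebesgue_on D) (\<lambda>x. \<phi> x *\<^sub>R g x)"
      using L v g by (auto intro: L2_integrable_scaleR)
    show ?thesis
      unfolding prod_eq_iff fst_uminus snd_uminus
        integral_fst[OF i(1), symmetric] integral_fst[OF i(2), symmetric]
        integral_snd[OF i(1), symmetric] integral_snd[OF i(2), symmetric]
      by (simp add: ip_def)
  qed
  then show ?thesis unfolding has_weak_grad_def by blast
qed

lemma has_weak_grad_diff:
  assumes D: "open D" "bounded D" and L: "v \<in> L2 D" "w \<in> L2 D" "g \<in> L2 D" "h \<in> L2 D"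
    and "has_weak_grad D v g" "has_weak_grad D w h"
  shows "has_weak_grad D (\<lambda>x. v x - w x) (\<lambda>x. g x - h x)"
  unfolding has_weak_grad_iff[OF D L2_diff[OF L(1,2)] L2_diff[OF L(3,4)]]
proof (intro allI impI)
  fix \<phi> G assume \<phi>: "C1c D \<phi> G"
  note L' = C1c_L2[OF \<phi> D]
  show "ip D (\<lambda>x. v x - w x) (\<lambda>x. fst (G x)) = - ip D \<phi> (\<lambda>x. fst (g x - h x)) \<and>
      ip D (\<lambda>x. v x - w x) (\<lambda>x. snd (G x)) = - ip D \<phi> (\<lambda>x. snd (g x - h x))"
    using assms(7,8) \<phi> L' L
    by (simp add: has_weak_grad_iff[OF D] ip_diff_left ip_diff_right L2_fst L2_snd)
qed

lemma has_weak_grad_unique: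
  assumes D: "open D" "bounded D" and L: "v \<in> L2 D" "g \<in> L2 D" "h \<in> L2 D"
    and "has_weak_grad D v g" "has_weak_grad D v h"
  shows "AE x in lebesgue_on D. g x = h x"
proof -
  have 0: "ip D \<phi> (\<lambda>x. fst (g x) - fst (h x)) = 0" "ip D \<phi> (\<lambda>x. snd (g x) - snd (h x)) = 0"
    if \<phi>: "C1c D \<phi> G" for \<phi> G
    using assms(6,7) \<phi> L C1c_L2[OF \<phi> D]
    by (auto simp add: has_weak_grad_iff[OF D] ip_diff_right L2_fst L2_snd)
  have "AE x in lebesgue_on D. fst (g x) - fst (h x) = 0"
    using L 0(1) by (intro fundamental_lemma[OF D] L2_diff L2_fst) auto
  moreover have "AE x in lebesgue_on D. snd (g x) - snd (h x) = 0"
    using L 0(2) by (intro fundamental_lemma[OF D] L2_diff L2_snd) auto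
  ultimately show ?thesis by eventually_elim (simp add: prod_eq_iff)
qed

lemma has_weak_div_unique:
  assumes D: "open D" "bounded D" and L: "d \<in> L2 D" "e \<in> L2 D"
    and "has_weak_div D \<tau> d" "has_weak_div D \<tau> e"
  shows "AE x in lebesgue_on D. d x = e x"
proof -
  have "AE x in lebesgue_on D. d x - e x = 0"
  proof (rule fundamental_lemma[OF D L2_diff[OF L]])
    fix \<phi> G assume \<phi>: "C1c D \<phi> G"
    then have "ip D d \<phi> = ip D e \<phi>"
      using assms(5,6) unfolding has_weak_div_def by (metis neg_equal_iff_equal)
    then show "ip D \<phi> (\<lambda>x. d x - e x) = 0"
      using L C1c_L2[OF \<phi> D] by (simp add: ip_diff_right ip_commute)
  qed
  then show ?thesis by simp
qed

lemma has_weak_div_diff: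
  assumes D: "open D" "bounded D" and L: "\<sigma> \<in> L2 D" "\<tau> \<in> L2 D" "d \<in> L2 D" "e \<in> L2 D"
    and "has_weak_div D \<sigma> d" "has_weak_div D \<tau> e"
  shows "has_weak_div D (\<lambda>x. \<sigma> x - \<tau> x) (\<lambda>x. d x - e x)"
  unfolding has_weak_div_def
proof (intro allI impI)
  fix \<phi> G assume \<phi>: "C1c D \<phi> G"
  then have "ip D \<sigma> G = - ip D d \<phi>" "ip D \<tau> G = - ip D e \<phi>"
    using assms(7,8) unfolding has_weak_div_def by blast+
  then show "ip D (\<lambda>x. \<sigma> x - \<tau> x) G = - ip D (\<lambda>x. d x - e x) \<phi>"
    using L C1c_L2[OF \<phi> D] by (simp add: ip_diff_left)
qed

lemma has_weak_div_cong_AE: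
  assumes D: "open D" "bounded D" and "\<sigma> \<in> L2 D" "\<tau> \<in> L2 D"
    and "AE x in lebesgue_on D. \<sigma> x = \<tau> x" "has_weak_div D \<sigma> d"
  shows "has_weak_div D \<tau> d"
  unfolding has_weak_div_def
proof (intro allI impI)
  fix \<phi> G assume \<phi>: "C1c D \<phi> G"
  have "ip D \<tau> G = ip D \<sigma> G"
    using assms C1c_L2[OF \<phi> D] by (intro ip_cong_AE) auto
  then show "ip D \<tau> G = - ip D d \<phi>" using assms(6) \<phi> by (simp add: has_weak_div_def)
qed

lemma H1_L2: "v \<in> H1 D \<Longrightarrow> v \<in> L2 D"
  by (simp add: H1_def)

lemma Hdiv_L2: "v \<in> Hdiv D \<Longrightarrow> v \<in> L2 D"
  by (simp add: Hdiv_def)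

lemma wgrad:
  assumes "v \<in> H1 D"
  shows "wgrad D v \<in> L2 D" "has_weak_grad D v (wgrad D v)"
proof -
  have "wgrad D v \<in> L2 D \<and> has_weak_grad D v (wgrad D v)"
    using assms unfolding wgrad_def H1_def
    by (intro someI_ex[where P = "\<lambda>g. g \<in> L2 D \<and> has_weak_grad D v g"]) blast
  then show "wgrad D v \<in> L2 D" "has_weak_grad D v (wgrad D v)" by auto
qed

lemma wdiv:
  assumes "\<tau> \<in> Hdiv D"
  shows "wdiv D \<tau> \<in> L2 D" "has_weak_div D \<tau> (wdiv D \<tau>)"
proof -
  have "wdiv D \<tau> \<in> L2 D \<and> has_weak_div D \<tau> (wdiv D \<tau>)"
    using assms unfolding wdiv_def Hdiv_def
    by (intro someI_ex[where P = "\<lambda>d. d \<in> L2 D \<and> has_weak_div D \<tau> d"]) blast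
  then show "wdiv D \<tau> \<in> L2 D" "has_weak_div D \<tau> (wdiv D \<tau>)" by auto
qed

lemma wgrad_eq_AE:
  assumes D: "open D" "bounded D" and "v \<in> L2 D" "g \<in> L2 D" "has_weak_grad D v g"
  shows "v \<in> H1 D" "AE x in lebesgue_on D. wgrad D v x = g x"
proof -
  show "v \<in> H1 D" using assms by (auto simp: H1_def)
  then show "AE x in lebesgue_on D. wgrad D v x = g x"
    using assms wgrad by (intro has_weak_grad_unique[OF D]) auto
qed

lemma wdiv_eq_AE:
  assumes D: "open D" "bounded D" and "\<tau> \<in> L2 D" "d \<in> L2 D" "has_weak_div D \<tau> d"
  shows "\<tau> \<in> Hdiv D" "AE x in lebesgue_on D. wdiv D \<tau> x = d x"
proof -
  show "\<tau> \<in> Hdiv D" using assms by (auto simp: Hdiv_def)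
  then show "AE x in lebesgue_on D. wdiv D \<tau> x = d x"
    using assms wdiv by (intro has_weak_div_unique[OF D]) auto
qed

lemma wgrad_diff:
  assumes D: "open D" "bounded D" and "v \<in> H1 D" "w \<in> H1 D"
  shows "(\<lambda>x. v x - w x) \<in> H1 D"
    "AE x in lebesgue_on D. wgrad D (\<lambda>x. v x - w x) x = wgrad D v x - wgrad D w x"
proof -
  note g = wgrad[OF assms(3)] wgrad[OF assms(4)]
  note L = H1_L2[OF assms(3)] H1_L2[OF assms(4)] g(1,3)
  note * = wgrad_eq_AE[OF D L2_diff[OF L(1,2)] L2_diff[OF L(3,4)]
      has_weak_grad_diff[OF D L g(2,4)]]
  show "(\<lambda>x. v x - w x) \<in> H1 D"
    "AE x in lebesgue_on D. wgrad D (\<lambda>x. v x - w x) x = wgrad D v x - wgrad D w x"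
    using * .
qed

lemma wdiv_diff:
  assumes D: "open D" "bounded D" and "\<sigma> \<in> Hdiv D" "\<tau> \<in> Hdiv D"
  shows "(\<lambda>x. \<sigma> x - \<tau> x) \<in> Hdiv D"
    "AE x in lebesgue_on D. wdiv D (\<lambda>x. \<sigma> x - \<tau> x) x = wdiv D \<sigma> x - wdiv D \<tau> x"
proof -
  note d = wdiv[OF assms(3)] wdiv[OF assms(4)]
  note L = Hdiv_L2[OF assms(3)] Hdiv_L2[OF assms(4)] d(1,3)
  note * = wdiv_eq_AE[OF D L2_diff[OF L(1,2)] L2_diff[OF L(3,4)]
      has_weak_div_diff[OF D L d(2,4)]]
  show "(\<lambda>x. \<sigma> x - \<tau> x) \<in> Hdiv D"
    "AE x in lebesgue_on D. wdiv D (\<lambda>x. \<sigma> x - \<tau> x) x = wdiv D \<sigma> x - wdiv D \<tau> x"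
    using * .
qed

text \<open>Test functions on the smaller set are test functions on the larger one; uniqueness up to
  null sets then ties the two chosen gradients together.\<close>

lemma wgrad_restrict:
  assumes \<Omega>: "open \<Omega>" "bounded \<Omega>" and D: "D \<subseteq> \<Omega>" "open D" and v: "v \<in> H1 \<Omega>"
  shows "v \<in> H1 D" "AE x in lebesgue_on D. wgrad D v x = wgrad \<Omega> v x"
proof -
  have "bounded D" using \<Omega> D bounded_subset by blast
  moreover have "v \<in> L2 D" "wgrad \<Omega> v \<in> L2 D"
    using \<Omega> D wgrad[OF v] H1_L2[OF v] by (auto intro: L2_restrict)
  moreover have "has_weak_grad D v (wgrad \<Omega> v)"
    using wgrad[OF v] \<Omega> D by (auto intro: has_weak_grad_restrict)
  ultimately show "v \<in> H1 D" "AE x in lebesgue_on D. wgrad D v x = wgrad \<Omega> v x"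
    using wgrad_eq_AE D by auto
qed

text \<open>The product of \<open>\<phi>\<close> and \<open>m\<close> inherits compact support in
  \<open>D\<close>, so the integrals of its partial derivatives vanish, whatever the boundary of
  \<open>D\<close> looks like.\<close>

lemma C1_integration_by_parts:
  assumes D: "open D" "bounded D" and \<phi>: "C1c D \<phi> G" and m: "C1 m H"
  shows "ip D m (\<lambda>x. fst (G x)) = - ip D \<phi> (\<lambda>x. fst (H x))"
    "ip D m (\<lambda>x. snd (G x)) = - ip D \<phi> (\<lambda>x. snd (H x))"
proof -
  have c: "C1 (\<lambda>x. \<phi> x * m x) (\<lambda>x. \<phi> x *\<^sub>R H x + m x *\<^sub>R G x)"
    using \<phi> m by (auto simp: C1c_def intro: C1_mult)
  note out = C1c_outside[OF \<phi>]
  note L = C1c_L2[OF \<phi> D] C1_L2[OF m D]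
  note i = L2_integrable_inner[OF L(1) L2_fst[OF L(4)]] L2_integrable_inner[OF L(1) L2_snd[OF L(4)]]
    L2_integrable_inner[OF L(3) L2_fst[OF L(2)]] L2_integrable_inner[OF L(3) L2_snd[OF L(2)]]
  have "ip D \<phi> (\<lambda>x. fst (H x)) + ip D m (\<lambda>x. fst (G x)) = 0"
    using integral_C1_fst[OF c D] out i by (simp add: ip_def)
  then show "ip D m (\<lambda>x. fst (G x)) = - ip D \<phi> (\<lambda>x. fst (H x))" by simp
  have "ip D \<phi> (\<lambda>x. snd (H x)) + ip D m (\<lambda>x. snd (G x)) = 0"
    using integral_C1_snd[OF c D] out i by (simp add: ip_def)
  then show "ip D m (\<lambda>x. snd (G x)) = - ip D \<phi> (\<lambda>x. snd (H x))" by simp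
qed

lemma C1_has_weak_grad:
  assumes D: "open D" "bounded D" and m: "C1 m H"
  shows "has_weak_grad D m H"
  using C1_integration_by_parts[OF D _ m] C1_L2[OF m D] by (simp add: has_weak_grad_iff[OF D])

lemma C1_wgrad:
  assumes D: "open D" "bounded D" and m: "C1 m H"
  shows "m \<in> H1 D" "AE x in lebesgue_on D. wgrad D m x = H x"
  using wgrad_eq_AE[OF D C1_L2[OF m D] C1_has_weak_grad[OF D m]] .

lemma C1_has_weak_div:
  assumes D: "open D" "bounded D" and m: "C1 m H" "C1 m' H'"
  shows "has_weak_div D (\<lambda>x. (m x, m' x)) (\<lambda>x. fst (H x) + snd (H' x))"
  unfolding has_weak_div_def
proof (intro allI impI)
  fix \<phi> G assume \<phi>: "C1c D \<phi> G"
  note L = C1c_L2[OF \<phi> D] C1_L2[OF m(1) D] C1_L2[OF m(2) D]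
  have "ip D (\<lambda>x. (m x, m' x)) G = ip D m (\<lambda>x. fst (G x)) + ip D m' (\<lambda>x. snd (G x))"
    using L2_integrable_inner[OF L(3) L2_fst[OF L(2)]] L2_integrable_inner[OF L(5) L2_snd[OF L(2)]]
    by (simp add: ip_def inner_prod_def)
  also have "\<dots> = - ip D \<phi> (\<lambda>x. fst (H x)) - ip D \<phi> (\<lambda>x. snd (H' x))"
    using C1_integration_by_parts[OF D \<phi>] m by simp
  also have "\<dots> = - ip D (\<lambda>x. fst (H x) + snd (H' x)) \<phi>"
    using L by (simp add: ip_commute[of D _ \<phi>] ip_add_right L2_fst L2_snd)
  finally show "ip D (\<lambda>x. (m x, m' x)) G = - ip D (\<lambda>x. fst (H x) + snd (H' x)) \<phi>" .
qed

section \<open>Polynomials in two variables\<close>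

lemma finite_Pol_index: "finite {(i, j). int (i + j) \<le> l}"
  by (rule finite_subset[where B = "{..nat l} \<times> {..nat l}"]) auto

lemma Pol_add:
  assumes "q \<in> Pol l" "r \<in> Pol l"
  shows "(\<lambda>x. q x + r x) \<in> Pol l"
proof -
  obtain c d where
    "q = (\<lambda>x. \<Sum>(i, j)\<in>{(i, j). int (i + j) \<le> l}. c i j * fst x ^ i * snd x ^ j)"
    "r = (\<lambda>x. \<Sum>(i, j)\<in>{(i, j). int (i + j) \<le> l}. d i j * fst x ^ i * snd x ^ j)"
    using assms unfolding Pol_def by blast
  then have "(\<lambda>x. q x + r x) =
      (\<lambda>x. \<Sum>(i, j)\<in>{(i, j). int (i + j) \<le> l}. (c i j + d i j) * fst x ^ i * snd x ^ j)"
    by (auto simp: fun_eq_iff sum.distrib[symmetric] case_prod_unfold algebra_simps)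
  then show ?thesis unfolding Pol_def mem_Collect_eq by (rule exI[of _ "\<lambda>i j. c i j + d i j"])
qed

lemma Pol_scale:
  assumes "q \<in> Pol l"
  shows "(\<lambda>x. a * q x) \<in> Pol l"
proof -
  obtain c where
    "q = (\<lambda>x. \<Sum>(i, j)\<in>{(i, j). int (i + j) \<le> l}. c i j * fst x ^ i * snd x ^ j)"
    using assms unfolding Pol_def by blast
  then have "(\<lambda>x. a * q x) =
      (\<lambda>x. \<Sum>(i, j)\<in>{(i, j). int (i + j) \<le> l}. (a * c i j) * fst x ^ i * snd x ^ j)"
    by (auto simp: fun_eq_iff sum_distrib_left case_prod_unfold algebra_simps)
  then show ?thesis unfolding Pol_def mem_Collect_eq by (rule exI[of _ "\<lambda>i j. a * c i j"])
qed

lemma Pol_0: "(\<lambda>_. 0) \<in> Pol l"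
  unfolding Pol_def by (auto intro!: exI[of _ "\<lambda>_ _. 0"])

lemma Pol_sum: "(\<And>i. i \<in> I \<Longrightarrow> q i \<in> Pol l) \<Longrightarrow> (\<lambda>x. \<Sum>i\<in>I. q i x) \<in> Pol l"
  by (induction I rule: infinite_finite_induct) (auto intro: Pol_0 Pol_add)

lemma Pol_minus: "q \<in> Pol l \<Longrightarrow> (\<lambda>x. - q x) \<in> Pol l"
  using Pol_scale[of q l "-1"] by simp

lemma Pol_diff: "\<lbrakk>q \<in> Pol l; r \<in> Pol l\<rbrakk> \<Longrightarrow> (\<lambda>x. q x - r x) \<in> Pol l"
  using Pol_add[of q l "\<lambda>x. - r x"] Pol_minus by simp

lemma Pol_monomial:
  assumes "int (i + j) \<le> l"
  shows "(\<lambda>x. fst x ^ i * snd x ^ j) \<in> Pol l"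
proof -
  have "fst x ^ i * snd x ^ j = (\<Sum>(a, b)\<in>{(a, b). int (a + b) \<le> l}.
      of_bool ((a, b) = (i, j)) * fst x ^ a * snd x ^ b)" for x :: point
  proof -
    have "(\<Sum>(a, b)\<in>{(a, b). int (a + b) \<le> l}. of_bool ((a, b) = (i, j)) * fst x ^ a * snd x ^ b)
        = (\<Sum>p\<in>{(a, b). int (a + b) \<le> l}. if p = (i, j) then fst x ^ i * snd x ^ j else 0)"
      by (rule sum.cong) auto
    also have "\<dots> = fst x ^ i * snd x ^ j"
      using assms finite_Pol_index[of l] by (subst sum.delta) auto
    finally show ?thesis by simp
  qed
  then show ?thesis
    unfolding Pol_def by (auto intro!: exI[of _ "\<lambda>a b. of_bool ((a, b) = (i, j))"] simp: fun_eq_iff)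
qed

lemma Pol_const: "0 \<le> l \<Longrightarrow> (\<lambda>_. c) \<in> Pol l"
  using Pol_scale[OF Pol_monomial[of 0 0 l], of c] by simp

lemma Pol_cases:
  assumes "q \<in> Pol l"
  obtains c where "q = (\<lambda>x. \<Sum>(i, j)\<in>{(i, j). int (i + j) \<le> l}. c i j * (fst x ^ i * snd x ^ j))"
  using assms unfolding Pol_def by (auto simp: mult.assoc)

text \<open>Where the truncated exponent \<open>i - 1\<close> or \<open>j - 1\<close> would be
  wrong, namely at 0, its factor \<open>real i\<close> or \<open>real j\<close> is 0.\<close>

definition monomial_grad :: "nat \<Rightarrow> nat \<Rightarrow> point \<Rightarrow> point" where
  "monomial_grad i j x =
    (real i * (fst x ^ (i - 1) * snd x ^ j), real j * (fst x ^ i * snd x ^ (j - 1)))"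

lemma C1_monomial: "C1 (\<lambda>x. fst x ^ i * snd x ^ j) (monomial_grad i j)"
proof -
  have "GDERIV (\<lambda>x. fst x ^ i * snd x ^ j) x :> monomial_grad i j x" for x
    unfolding gderiv_def monomial_grad_def
    by (auto intro!: derivative_eq_intros simp: fun_eq_iff algebra_simps)
  moreover have "continuous_on UNIV (monomial_grad i j)"
    unfolding monomial_grad_def by (intro continuous_intros)
  ultimately show ?thesis unfolding C1_def by blast
qed

lemma C1_sum:
  "(\<And>i. i \<in> I \<Longrightarrow> C1 (q i) (H i)) \<Longrightarrow> C1 (\<lambda>x. \<Sum>i\<in>I. q i x) (\<lambda>x. \<Sum>i\<in>I. H i x)"
  by (induction I rule: infinite_finite_induct) (auto intro: C1_const C1_add)

lemma C1_Pol_sum: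
  "C1 (\<lambda>x. \<Sum>(i, j)\<in>I. c i j * (fst x ^ i * snd x ^ j))
      (\<lambda>x. \<Sum>(i, j)\<in>I. c i j *\<^sub>R monomial_grad i j x)"
  unfolding case_prod_unfold by (intro C1_sum C1_scale C1_monomial)

lemma monomial_grad_Pol:
  assumes "int (i + j) \<le> l"
  shows "(\<lambda>x. fst (monomial_grad i j x)) \<in> Pol (l - 1)"
    and "(\<lambda>x. snd (monomial_grad i j x)) \<in> Pol (l - 1)"
proof -
  show "(\<lambda>x. fst (monomial_grad i j x)) \<in> Pol (l - 1)"
  proof (cases i)
    case (Suc k)
    then show ?thesis
      unfolding monomial_grad_def fst_conv using assms by (intro Pol_scale Pol_monomial) simp
  qed (simp add: monomial_grad_def Pol_0)
  show "(\<lambda>x. snd (monomial_grad i j x)) \<in> Pol (l - 1)"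
  proof (cases j)
    case (Suc k)
    then show ?thesis
      unfolding monomial_grad_def snd_conv using assms by (intro Pol_scale Pol_monomial) simp
  qed (simp add: monomial_grad_def Pol_0)
qed

lemma Pol_C1:
  assumes "q \<in> Pol l"
  obtains H where "C1 q H" "(\<lambda>x. fst (H x)) \<in> Pol (l - 1)" "(\<lambda>x. snd (H x)) \<in> Pol (l - 1)"
proof -
  obtain c where q: "q = (\<lambda>x. \<Sum>(i, j)\<in>{(i, j). int (i + j) \<le> l}. c i j * (fst x ^ i * snd x ^ j))"
    using assms by (rule Pol_cases)
  define H where "H = (\<lambda>x. \<Sum>(i, j)\<in>{(i, j). int (i + j) \<le> l}. c i j *\<^sub>R monomial_grad i j x)"
  have "C1 q H" unfolding q H_def by (rule C1_Pol_sum)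
  moreover have "(\<lambda>x. fst (H x)) \<in> Pol (l - 1)" "(\<lambda>x. snd (H x)) \<in> Pol (l - 1)"
    unfolding H_def case_prod_unfold fst_sum snd_sum fst_scaleR snd_scaleR real_scaleR_def
    by (intro Pol_sum Pol_scale; auto intro: monomial_grad_Pol)+
  ultimately show ?thesis by (rule that)
qed

text \<open>Pointwise gradients of polynomials are automatically continuous, which gives access to
  the rules for \<open>C1\<close>.\<close>

lemma gradPol_iff: "G \<in> gradPol l \<longleftrightarrow> (\<exists>q\<in>Pol l. C1 q G)"
proof
  assume "G \<in> gradPol l"
  then obtain q where q: "q \<in> Pol l" "\<And>x. GDERIV q x :> G x" unfolding gradPol_def by blast
  obtain H where H: "C1 q H" using q(1) by (rule Pol_C1)
  have "H = G" using GDERIV_unique[OF C1_GDERIV[OF H] q(2)] by (rule ext)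
  then show "\<exists>q\<in>Pol l. C1 q G" using q(1) H by blast
next
  assume "\<exists>q\<in>Pol l. C1 q G"
  then show "G \<in> gradPol l" unfolding gradPol_def using C1_GDERIV by blast
qed

section \<open>The identity theorem and the projection onto gradients of polynomials\<close>

lemma Pol_real_polynomial_function:
  assumes "q \<in> Pol l"
  shows "real_polynomial_function q"
proof -
  obtain c where q: "q = (\<lambda>x. \<Sum>(i, j)\<in>{(i, j). int (i + j) \<le> l}. c i j * (fst x ^ i * snd x ^ j))"
    using assms by (rule Pol_cases)
  have f: "real_polynomial_function (fst :: point \<Rightarrow> real)" "real_polynomial_function (snd :: point \<Rightarrow> real)"
    using bounded_linear_fst bounded_linear_snd by (auto intro: real_polynomial_function.intros)
  show ?thesis
    unfolding q case_prod_unfold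
    by (intro real_polynomial_function_sum finite_Pol_index[unfolded case_prod_unfold] real_polynomial_function.intros(4)
        real_polynomial_function.intros(2) real_polynomial_function_power f)
qed

text \<open>On the line from \<open>z\<close> to \<open>x\<close> the polynomial becomes univariate
  and has infinitely many zeros near \<open>z\<close>, hence vanishes at \<open>x\<close> as
  well.\<close>

lemma Pol_identity:
  assumes q: "q \<in> Pol l" and D: "open D" "z \<in> D" "\<And>x. x \<in> D \<Longrightarrow> q x = 0"
  shows "q x = 0"
proof -
  define f where "f = (\<lambda>t::real. z + t *\<^sub>R (x - z))"
  have "polynomial_function f"
    unfolding f_def by (intro polynomial_function_add polynomial_function_mult) auto
  then have "real_polynomial_function (q \<circ> f)"
    using Pol_real_polynomial_function[OF q] by (rule real_polynomial_function_compose)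
  then obtain a n where an: "q \<circ> f = (\<lambda>t. \<Sum>i\<le>n. a i * t ^ i)"
    unfolding real_polynomial_function_iff_sum by blast
  have "continuous_on UNIV f" unfolding f_def by (intro continuous_intros)
  then have "open (f -` D)" using D(1) by (rule open_vimage[rotated])
  moreover have "0 \<in> f -` D" using D(2) by (simp add: f_def)
  ultimately obtain e where e: "0 < e" "ball 0 e \<subseteq> f -` D"
    using open_contains_ball by blast
  have "infinite (ball (0::real) e)" using e(1) by (simp add: ball_eq_greaterThanLessThan)
  moreover have "ball 0 e \<subseteq> {t. (\<Sum>i\<le>n. a i * t ^ i) = 0}"
  proof
    fix t :: real assume "t \<in> ball 0 e"
    then have "q (f t) = 0" using e(2) D(3) by blast
    then show "t \<in> {t. (\<Sum>i\<le>n. a i * t ^ i) = 0}" using fun_cong[OF an, of t] by simp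
  qed
  ultimately have "infinite {t. (\<Sum>i\<le>n. a i * t ^ i) = 0}" using finite_subset by blast
  then have "\<forall>i\<le>n. a i = 0" using polyfun_finite_roots[of a n] by blast
  then have "(q \<circ> f) 1 = 0" by (simp add: an)
  then show ?thesis by (simp add: f_def)
qed

text \<open>Continuity removes the null set inside \<open>D\<close>, and the identity theorem leads
  from \<open>D\<close> to the whole plane. This is how a.e. uniqueness of a projection becomes
  equality of total functions.\<close>

lemma Pol_grad_eq_0:
  assumes q: "q \<in> Pol l" "C1 q H" and D: "open D" "D \<noteq> {}"
    and AE: "AE x in lebesgue_on D. H x = 0"
  shows "H = (\<lambda>_. 0)" "\<exists>c. q = (\<lambda>_. c)"
proof -
  obtain H' where H': "C1 q H'" "(\<lambda>x. fst (H' x)) \<in> Pol (l - 1)" "(\<lambda>x. snd (H' x)) \<in> Pol (l - 1)"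
    using q(1) by (rule Pol_C1)
  have eq: "H' = H" using C1_unique[OF H'(1) q(2)] .
  have "closed {x. H x = 0}"
    using C1_continuous_grad[OF q(2)] by (intro closed_Collect_eq) auto
  moreover have "AE x\<in>D in lebesgue. x \<in> {x. H x = 0}"
    using AE D(1) by (simp add: AE_restrict_space_iff)
  ultimately have 0: "H x = 0" if "x \<in> D" for x
    using mem_closed_if_AE_lebesgue_open[OF D(1)] that by blast
  obtain z where z: "z \<in> D" using D(2) by blast
  have "fst (H x) = 0" "snd (H x) = 0" for x
    using Pol_identity[OF H'(2) D(1) z] Pol_identity[OF H'(3) D(1) z] 0 by (auto simp: eq)
  then show H0: "H = (\<lambda>_. 0)" by (auto simp: fun_eq_iff prod_eq_iff)
  have "(q has_derivative (\<lambda>_. 0)) (at x)" for x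
    using C1_has_derivative[OF q(2), of x] by (simp add: H0)
  then have "\<exists>c. \<forall>x\<in>UNIV. q x = c"
    by (intro has_derivative_zero_constant) (auto simp: has_derivative_at_withinI)
  then show "\<exists>c. q = (\<lambda>_. c)" by (auto intro!: ext)
qed

text \<open>The gradients of the monomials are linearly dependent, the constant monomial having
  gradient 0; this is why the abstract projection must tolerate dependent families.\<close>

lemma Pol_grad_projection:
  assumes D: "open D" "bounded D" and v: "v \<in> L2 D"
  obtains q R where "q \<in> Pol l" "C1 q R"
    "\<And>r S. \<lbrakk>r \<in> Pol l; C1 r S\<rbrakk> \<Longrightarrow> ip D (\<lambda>x. v x - R x) S = 0"
proof -
  define I where "I = {(i, j). int (i + j) \<le> l}"
  define g where "g = (\<lambda>(i, j). monomial_grad i j)"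
  have g_L2: "g i \<in> L2 D" for i
    using C1_L2[OF C1_monomial D] by (simp add: g_def case_prod_unfold)
  obtain c where c: "\<forall>k\<in>I. ip D (\<lambda>x. v x - (\<Sum>i\<in>I. c i *\<^sub>R g i x)) (g k) = 0"
    using orthogonal_projection_exists[of I g D v] finite_Pol_index[of l] g_L2 v
    unfolding I_def by blast
  define q where "q = (\<lambda>x::point. \<Sum>(i, j)\<in>I. c (i, j) * (fst x ^ i * snd x ^ j))"
  define R where "R = (\<lambda>x. \<Sum>i\<in>I. c i *\<^sub>R g i x)"
  have R: "R = (\<lambda>x. \<Sum>(i, j)\<in>I. c (i, j) *\<^sub>R monomial_grad i j x)"
    by (simp add: R_def g_def case_prod_unfold)
  have "q \<in> Pol l"
    unfolding q_def case_prod_unfold by (intro Pol_sum Pol_scale Pol_monomial) (auto simp: I_def)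
  moreover have C1: "C1 q R" unfolding q_def R using C1_Pol_sum[of "\<lambda>i j. c (i, j)" I] by simp
  moreover have "ip D (\<lambda>x. v x - R x) S = 0" if rS: "r \<in> Pol l" "C1 r S" for r S
  proof -
    obtain b where b: "r = (\<lambda>x. \<Sum>(i, j)\<in>I. b i j * (fst x ^ i * snd x ^ j))"
      using rS(1) unfolding I_def by (rule Pol_cases)
    have "C1 r (\<lambda>x. \<Sum>(i, j)\<in>I. b i j *\<^sub>R monomial_grad i j x)"
      unfolding b by (rule C1_Pol_sum)
    then have S: "S = (\<lambda>x. \<Sum>k\<in>I. b (fst k) (snd k) *\<^sub>R g k x)"
      using C1_unique rS(2) by (auto simp: g_def case_prod_unfold)
    have "ip D (\<lambda>x. v x - R x) S = (\<Sum>k\<in>I. ip D (\<lambda>x. v x - R x) (\<lambda>x. b (fst k) (snd k) *\<^sub>R g k x))"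
      unfolding S using v C1_L2[OF C1 D] g_L2 by (intro ip_sum_right L2_diff L2_scaleR)
    also have "\<dots> = 0" using c by (simp add: ip_scaleR_right R_def)
    finally show ?thesis .
  qed
  ultimately show ?thesis by (rule that)
qed

text \<open>The degrees match both spaces: \<open>l = p\<close> gives a Laplacian of degree
  \<open>p - 2\<close> in the primal space, and \<open>l = p + 1\<close> gives components of degree
  \<open>p\<close> with divergence and rotation of degree \<open>p - 1\<close> in the mixed
  space.\<close>

lemma gradPol_differential:
  assumes D: "open D" "bounded D" and M: "M \<in> gradPol l"
  shows "M \<in> L2 D" "\<exists>d\<in>Pol (l - 2). has_weak_div D M d" "\<exists>d\<in>Pol (l - 2). has_weak_rot D M d"
    "\<exists>m m' H H'. C1 m H \<and> C1 m' H' \<and> M = (\<lambda>x. (m x, m' x)) \<and> m \<in> Pol (l - 1) \<and> m' \<in> Pol (l - 1)"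
proof -
  obtain q where q: "q \<in> Pol l" "C1 q M" using M by (auto simp: gradPol_iff)
  obtain M' where "C1 q M'" "(\<lambda>x. fst (M' x)) \<in> Pol (l - 1)" "(\<lambda>x. snd (M' x)) \<in> Pol (l - 1)"
    using q(1) by (rule Pol_C1)
  then have m: "(\<lambda>x. fst (M x)) \<in> Pol (l - 1)" "(\<lambda>x. snd (M x)) \<in> Pol (l - 1)"
    using C1_unique[OF q(2)] by auto
  obtain H where H: "C1 (\<lambda>x. fst (M x)) H" "(\<lambda>x. fst (H x)) \<in> Pol (l - 1 - 1)"
    "(\<lambda>x. snd (H x)) \<in> Pol (l - 1 - 1)" using m(1) by (rule Pol_C1)
  obtain H' where H': "C1 (\<lambda>x. snd (M x)) H'" "(\<lambda>x. fst (H' x)) \<in> Pol (l - 1 - 1)"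
    "(\<lambda>x. snd (H' x)) \<in> Pol (l - 1 - 1)" using m(2) by (rule Pol_C1)
  show "M \<in> L2 D" using C1_L2(2)[OF q(2) D] .
  have l: "l - 1 - 1 = l - 2" by simp
  show "\<exists>d\<in>Pol (l - 2). has_weak_div D M d"
    using C1_has_weak_div[OF D H(1) H'(1)] Pol_add[OF H(2) H'(3)] by (auto simp: l)
  have "C1 (\<lambda>x. - snd (M x)) (\<lambda>x. - H' x)" using C1_scale[OF H'(1), of "-1"] by simp
  then have "has_weak_div D (\<lambda>x. (- snd (M x), fst (M x))) (\<lambda>x. - fst (H' x) + snd (H x))"
    using C1_has_weak_div[OF D _ H(1)] by fastforce
  moreover have "(\<lambda>x. - fst (H' x) + snd (H x)) \<in> Pol (l - 2)"
    using Pol_add[OF Pol_minus[OF H'(2)] H(3)] by (simp only: l)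
  ultimately show "\<exists>d\<in>Pol (l - 2). has_weak_rot D M d" unfolding has_weak_rot_def by blast
  show "\<exists>m m' H H'. C1 m H \<and> C1 m' H' \<and> M = (\<lambda>x. (m x, m' x)) \<and> m \<in> Pol (l - 1) \<and> m' \<in> Pol (l - 1)"
    using m H(1) H'(1)
    by (intro exI[of _ "\<lambda>x. fst (M x)"] exI[of _ "\<lambda>x. snd (M x)"] exI[of _ H] exI[of _ H'] conjI) auto
qed

section \<open>Green's formula across one edge\<close>

lemma isCont_extend_by_zero:
  fixes h :: "'a::real_normed_vector \<Rightarrow> real"
  assumes U: "open U" and h: "isCont h x" and zero: "x \<in> frontier U \<Longrightarrow> h x = 0"
  shows "isCont (\<lambda>x. if x \<in> U then h x else 0) x"
proof -
  consider "x \<in> U" | "x \<in> - closure U" | "x \<in> frontier U"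
    using closure_Un_frontier by blast
  then show ?thesis
  proof cases
    case 1
    have "isCont (\<lambda>x. if x \<in> U then h x else 0) x \<longleftrightarrow> isCont h x"
      by (rule isCont_cong) (use eventually_nhds_in_open[OF U 1] in \<open>auto elim!: eventually_mono\<close>)
    then show ?thesis using h by simp
  next
    case 2
    have "eventually (\<lambda>y. y \<in> - closure U) (nhds x)"
      by (rule eventually_nhds_in_open) (use 2 in auto)
    then have "isCont (\<lambda>x. if x \<in> U then h x else 0) x \<longleftrightarrow> isCont (\<lambda>_. 0::real) x"
      by (intro isCont_cong) (auto elim!: eventually_mono dest: subsetD[OF closure_subset])
    then show ?thesis by simp
  next
    case 3
    then have "x \<notin> U" using U frontier_disjoint_eq open_closed by blast
    have "(\<lambda>x. if x \<in> U then h x else 0) \<midarrow>x\<rightarrow> 0"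
    proof (rule Lim_null_comparison)
      show "\<forall>\<^sub>F y in at x. norm (if y \<in> U then h y else 0) \<le> norm (h y)"
        by (rule always_eventually) auto
      show "((\<lambda>y. norm (h y)) \<longlongrightarrow> 0) (at x)"
        using h zero[OF 3] tendsto_norm_zero[of h "at x"] by (simp add: isCont_def)
    qed
    then show ?thesis using \<open>x \<notin> U\<close> by (simp add: isCont_def)
  qed
qed

text \<open>The step function \<open>J\<close> compensates the jump, at the single point \<open>z\<close>, of \<open>h\<close> cut off
  outside \<open>U\<close>.\<close>

lemma integral_open_set_jump:
  fixes h h' J :: "real \<Rightarrow> real"
  assumes U: "open U" "U \<subseteq> {-R<..<R}" "0 \<le> R" and B: "finite B" "frontier U \<subseteq> B"
    and h: "\<And>x. (h has_real_derivative h' x) (at x)" "continuous_on UNIV h'"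
    and zero: "\<And>x. \<lbrakk>x \<in> B; x \<noteq> z\<rbrakk> \<Longrightarrow> h x = 0"
    and J: "\<And>x. x \<noteq> z \<Longrightarrow> (J has_real_derivative 0) (at x)"
    and z: "isCont (\<lambda>x. (if x \<in> U then h x else 0) + J x) z"
  shows "(LINT x|lborel. indicator U x * h' x) = J R - J (-R)"
proof -
  define W where "W = (\<lambda>x. (if x \<in> U then h x else 0) + J x)"
  have "(LINT x|lborel. indicator U x * h' x) = W R - W (-R)"
  proof (rule integral_eq_boundary_values[where B = "insert z B"])
    show "integrable lborel (\<lambda>x. indicator U x * h' x)"
      using U h(2) bounded_subset[of "{-R<..<R}" U]
      by (intro integrable_indicator_continuous) auto
    show "indicator U x * h' x = 0" if "x \<notin> {-R..R}" for x
      using that U(2) by (auto simp: indicator_def)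
    show "(W has_real_derivative indicator U x * h' x) (at x)"
      if x: "x \<in> {-R<..<R} - insert z B" for x
    proof -
      have "((\<lambda>x. if x \<in> U then h x else 0) has_real_derivative indicator U x * h' x) (at x)"
      proof (cases "x \<in> U")
        case True
        have "(h has_real_derivative indicator U x * h' x) (at x)" using h(1) True by simp
        then show ?thesis
          by (rule has_field_derivative_transform_within_open[OF _ U(1) True]) auto
      next
        case False
        then have x': "x \<in> - closure U" using x B(2) closure_Un_frontier[of U] by auto
        have "((\<lambda>_. 0) has_real_derivative indicator U x * h' x) (at x)"
          using False by simp
        then show ?thesis
          by (rule has_field_derivative_transform_within_open[OF _ _ x'])
            (use closure_subset[of U] in auto)
      qed
      from DERIV_add[OF this J[of x]] show ?thesis using x by (simp add: W_def)
    qed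
    have "isCont W x" for x
    proof (cases "x = z")
      case False
      have "isCont (\<lambda>x. if x \<in> U then h x else 0) x"
        using B(2) zero[of x] False h(1) DERIV_isCont
        by (intro isCont_extend_by_zero[OF U(1)]) blast+
      moreover have "isCont J x" using J[OF False] by (rule DERIV_isCont)
      ultimately show ?thesis unfolding W_def by (rule isCont_add)
    qed (use z in \<open>simp add: W_def\<close>)
    then show "continuous_on {-R..R} W" by (simp add: continuous_at_imp_continuous_on)
  qed (use U B in auto)
  \<comment> \<open>The cut-off function vanishes at both ends of the interval, so only
    \<open>J\<close> contributes there.\<close>
  moreover have "R \<notin> U" "-R \<notin> U" using U(2) by auto
  ultimately show ?thesis by (simp add: W_def)
qed

lemma DERIV_step:
  fixes z :: real
  assumes "x \<noteq> z" "\<And>y. y < z \<Longrightarrow> J y = a" "\<And>y. z < y \<Longrightarrow> J y = b"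
  shows "(J has_real_derivative 0) (at x)"
proof (cases "x < z")
  case True
  have "((\<lambda>_. a) has_real_derivative 0) (at x)" by simp
  then show ?thesis
    by (rule has_field_derivative_transform_within_open[where S = "{..<z}"]) (use True assms in auto)
next
  case False
  have "((\<lambda>_. b) has_real_derivative 0) (at x)" by simp
  then show ?thesis
    by (rule has_field_derivative_transform_within_open[where S = "{z<..}"]) (use False assms in auto)
qed

context
  fixes h h' :: "real \<Rightarrow> real" and U B :: "real set" and R :: real
  assumes U: "open U" "U \<subseteq> {-R<..<R}" "0 \<le> R" and B: "finite B" "frontier U \<subseteq> B"
    and h: "\<And>x. (h has_real_derivative h' x) (at x)" "continuous_on UNIV h'"
begin

lemma integral_open_set_no_jump:
  assumes zero: "\<And>x. x \<in> B \<Longrightarrow> h x = 0"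
  shows "(LINT x|lborel. indicator U x * h' x) = 0"
proof -
  have "isCont (\<lambda>x. if x \<in> U then h x else 0) 0"
    using B(2) zero DERIV_isCont[OF h(1)] by (intro isCont_extend_by_zero[OF U(1)]) auto
  then show ?thesis
    using integral_open_set_jump[OF U B h, of 0 "\<lambda>_. 0"] zero by simp
qed

text \<open>The value of \<open>J\<close> at \<open>z\<close> is left open. As \<open>z\<close> is
  outside \<open>U\<close>, continuity of the compensated function asks for \<open>J z = j\<close>
  if \<open>U\<close> lies to the left of \<open>z\<close>, and for \<open>J z = 0\<close> if it
  lies to the right.\<close>

lemma integral_open_set_step:
  assumes zero: "\<And>x. \<lbrakk>x \<in> B; x \<noteq> z\<rbrakk> \<Longrightarrow> h x = 0" and z: "-R < z" "z < R" "z \<notin> U" and r: "0 < r"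
    and J: "\<And>x. x < z \<Longrightarrow> J x = 0" "\<And>x. z < x \<Longrightarrow> J x = j"
    and near: "\<And>x. \<bar>x - z\<bar> < r \<Longrightarrow> \<bar>(if x \<in> U then h x else 0) + J x - J z\<bar> \<le> \<bar>h x - h z\<bar>"
  shows "(LINT x|lborel. indicator U x * h' x) = j"
proof -
  have "(\<lambda>x. (if x \<in> U then h x else 0) + J x - J z) \<midarrow>z\<rightarrow> 0"
  proof (rule Lim_null_comparison)
    have "\<forall>\<^sub>F x in at z. x \<in> {z - r<..<z + r}"
      using r by (intro eventually_at_in_open') auto
    then show "\<forall>\<^sub>F x in at z. norm ((if x \<in> U then h x else 0) + J x - J z) \<le> \<bar>h x - h z\<bar>"
      by eventually_elim (unfold real_norm_def, rule near, auto)
    have "h \<midarrow>z\<rightarrow> h z" using h(1) DERIV_isCont isCont_def by blast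
    then show "(\<lambda>x. \<bar>h x - h z\<bar>) \<midarrow>z\<rightarrow> 0" by (simp add: LIM_zero tendsto_rabs_zero)
  qed
  then have "isCont (\<lambda>x. (if x \<in> U then h x else 0) + J x) z"
    using z(3) by (simp add: isCont_def LIM_zero_cancel)
  moreover have "(J has_real_derivative 0) (at x)" if "x \<noteq> z" for x
    using that J by (rule DERIV_step)
  ultimately have "(LINT x|lborel. indicator U x * h' x) = J R - J (-R)"
    using integral_open_set_jump[OF U B h zero] by blast
  then show ?thesis using z J by simp
qed

end

text \<open>Twice the signed area of the triangle \<open>a b p\<close>; its sign tells on which side of the line
  through \<open>a\<close> and \<open>b\<close> the point \<open>p\<close> lies.\<close>

definition side_of :: "point \<Rightarrow> point \<Rightarrow> point \<Rightarrow> real" where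
  "side_of a b p = (fst b - fst a) * (snd p - snd a) - (snd b - snd a) * (fst p - fst a)"

text \<open>With \<open>s\<close> equal to 1 or -1 this records the orientation, which the vertex
  list does not reveal. Points on the line itself are left unspecified.\<close>

definition locally_on_side :: "real \<Rightarrow> point \<Rightarrow> point \<Rightarrow> point set \<Rightarrow> point \<Rightarrow> bool" where
  "locally_on_side s a b U z \<longleftrightarrow> (\<exists>r>0. \<forall>p\<in>ball z r.
      (0 < s * side_of a b p \<longrightarrow> p \<in> U) \<and> (s * side_of a b p < 0 \<longrightarrow> p \<notin> U))"

section \<open>Slices through a single edge\<close>

lemma side_of_linepath: "side_of a b (linepath a b t) = 0"
  by (simp add: side_of_def linepath_def algebra_simps)

lemma side_of_shift: "side_of a b (x + h, y) = side_of a b (x, y) - (snd b - snd a) * h"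
  by (simp add: side_of_def algebra_simps)

text \<open>Almost every horizontal line meets the frontier in finitely many points, and
  \<open>\<psi>\<close> vanishes at all of them except possibly the crossing with the edge. The
  slice integral is therefore the value at that crossing, with a sign telling on which side the set
  lies. Integration over the heights, substituted by the edge parameter, gives the edge integral:
  the Jacobian \<bar>\<delta>\<bar> and the sign of s \<delta> combine to s \<delta>.\<close>

lemma green_edge_fst:
  assumes U: "open U" "bounded U" and \<psi>: "C1 \<psi> H" and V: "finite V"
    and fin: "\<And>y. y \<notin> V \<Longrightarrow> finite {x. (x, y) \<in> frontier U}"
    and zero: "\<And>p. \<lbrakk>p \<in> frontier U; p \<notin> open_segment a b\<rbrakk> \<Longrightarrow> \<psi> p = 0"
    and on_edge: "\<And>p. p \<in> open_segment a b \<Longrightarrow> p \<notin> U"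
    and s: "\<bar>s\<bar> = 1" and side: "\<And>z. z \<in> open_segment a b \<Longrightarrow> locally_on_side s a b U z"
  shows "(LINT p|lebesgue_on U. fst (H p)) =
    s * (snd b - snd a) * (LINT t|lebesgue_on {0..1}. \<psi> (linepath a b t))"
proof -
  define \<delta> where "\<delta> = snd b - snd a"
  define I where "I = (\<lambda>y. LINT x|lborel. indicator U (x, y) * fst (H (x, y)))"
  \<comment> \<open>The expected slice integral. For a horizontal edge \<delta> is 0, and then
    \<open>sgn (s * \<delta>) = 0\<close> makes \<open>F\<close> vanish whatever the division by
    zero returns.\<close>
  define F where "F = (\<lambda>y. indicator {0..1} ((y - snd a) / \<delta>) * sgn (s * \<delta>) *
      \<psi> (linepath a b ((y - snd a) / \<delta>)))"
  have H: "continuous_on UNIV (\<lambda>p. fst (H p))"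
    using C1_continuous_grad[OF \<psi>] by (intro continuous_intros)
  have "bounded (U \<union> closed_segment a b)" using U(2) by (simp add: compact_imp_bounded)
  then obtain R where R: "0 < R" "\<And>p. p \<in> U \<union> closed_segment a b \<Longrightarrow> norm p < R"
    by (meson bounded_pos_less)
  have slice: "I y = F y" if y: "y \<notin> insert (snd a) (insert (snd b) V)" for y
  proof -
    define D where "D = {x. (x, y) \<in> U}"
    define B where "B = {x. (x, y) \<in> frontier U}"
    have cp: "continuous_on A (\<lambda>x. (x, y))" for A :: "real set" by (intro continuous_intros)
    have D: "open D"
    proof -
      have "open ((\<lambda>x. (x, y)) -` U)" using U(1) cp by (rule open_vimage)
      then show ?thesis by (simp add: D_def vimage_def)
    qed
    have bound: "\<bar>x\<bar> < R" if "(x, y) \<in> U \<union> closed_segment a b" for x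
      using R(2)[OF that] norm_fst_le[of x y] by simp
    have DR: "D \<subseteq> {-R<..<R}"
    proof
      fix x assume "x \<in> D"
      then show "x \<in> {-R<..<R}" using bound[of x] by (auto simp: D_def)
    qed
    have finB: "finite B" unfolding B_def using fin y by blast
    have frB: "frontier D \<subseteq> B"
    proof
      fix x assume x: "x \<in> frontier D"
      have "closure D \<subseteq> (\<lambda>x. (x, y)) -` closure U"
        using cp closure_subset by (intro closure_minimal closed_vimage) (auto simp: D_def)
      then have "(x, y) \<in> closure U" using x by (auto simp: frontier_def)
      moreover have "(x, y) \<notin> U" using x D by (auto simp: frontier_def D_def interior_open)
      ultimately show "x \<in> B" using U(1) by (simp add: B_def frontier_def interior_open)
    qed
    have h: "((\<lambda>x. \<psi> (x, y)) has_real_derivative fst (H (x, y))) (at x)" for x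
      using \<psi> by (rule C1_slice)
    have h': "continuous_on UNIV (\<lambda>x. fst (H (x, y)))"
      by (rule continuous_on_compose2[OF H]) (auto intro!: continuous_intros)
    have I: "I y = (LINT x|lborel. indicator D x * fst (H (x, y)))"
      by (simp add: I_def D_def indicator_def)
    note 0 = D DR less_imp_le[OF R(1)] finB frB h h'
    define t where "t = (y - snd a) / \<delta>"
    show ?thesis
    proof (cases "0 < t \<and> t < 1")
      case False
      have "\<psi> (x, y) = 0" if "x \<in> B" for x
      proof (rule zero)
        show "(x, y) \<in> frontier U" using that by (simp add: B_def)
        show "(x, y) \<notin> open_segment a b"
        proof
          assume "(x, y) \<in> open_segment a b"
          then obtain u where u: "0 < u" "u < 1" "(x, y) = (1 - u) *\<^sub>R a + u *\<^sub>R b"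
            by (auto simp: in_segment)
          then have yu: "y = (1 - u) * snd a + u * snd b" by (metis snd_add snd_scaleR snd_conv real_scaleR_def)
          then have "y - snd a = u * \<delta>" by (simp add: \<delta>_def algebra_simps)
          moreover have "\<delta> \<noteq> 0" using yu y by (auto simp: \<delta>_def algebra_simps)
          ultimately have "t = u" by (simp add: t_def)
          then show False using u False by simp
        qed
      qed
      then have "I y = 0" unfolding I by (rule integral_open_set_no_jump[OF 0])
      \<comment> \<open>The closed interval in \<open>F\<close> would also count
        \<open>t = 0\<close> and \<open>t = 1\<close>, but these belong to the heights of the two
        endpoints, which are excluded.\<close>
      moreover have "t \<noteq> 0 \<and> t \<noteq> 1 \<or> \<delta> = 0" using y by (auto simp: t_def \<delta>_def)
      ultimately show ?thesis using False by (auto simp: F_def t_def[symmetric] indicator_def)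
    next
      case True
      then have \<delta>0: "\<delta> \<noteq> 0" by (auto simp: t_def)
      define z where "z = fst (linepath a b t)"
      have "snd (linepath a b t) = y"
      proof -
        have "snd (linepath a b t) = snd a + t * \<delta>" by (simp add: linepath_def \<delta>_def algebra_simps)
        also have "\<dots> = y" using \<delta>0 by (simp add: t_def)
        finally show ?thesis .
      qed
      then have zy: "linepath a b t = (z, y)" by (simp add: z_def prod_eq_iff)
      have "a \<noteq> b" using \<delta>0 by (auto simp: \<delta>_def)
      then have zseg: "(z, y) \<in> open_segment a b"
        using True zy[symmetric] by (auto simp: in_segment linepath_def)
      obtain r where r: "0 < r" "\<And>p. p \<in> ball (z, y) r \<Longrightarrow>
          (0 < s * side_of a b p \<longrightarrow> p \<in> U) \<and> (s * side_of a b p < 0 \<longrightarrow> p \<notin> U)"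
        using side[OF zseg] unfolding locally_on_side_def by blast
      \<comment> \<open>A horizontal shift by \<open>h\<close> changes \<open>side_of\<close> by
        \<open>- \<delta> * h\<close>. Hence the slice lies to the left of \<open>z\<close> if
        \<open>s * \<delta>\<close> is positive, and to the right if it is negative.\<close>
      have near: "s * \<delta> * h < 0 \<Longrightarrow> z + h \<in> D" "0 < s * \<delta> * h \<Longrightarrow> z + h \<notin> D" if "\<bar>h\<bar> < r" for h
      proof -
        have "(z + h, y) \<in> ball (z, y) r" using that by (simp add: dist_Pair_Pair dist_real_def)
        moreover have "side_of a b (z + h, y) = - (\<delta> * h)"
          using side_of_shift[of a b z h y] side_of_linepath[of a b t] by (simp add: zy \<delta>_def)
        ultimately show "s * \<delta> * h < 0 \<Longrightarrow> z + h \<in> D" "0 < s * \<delta> * h \<Longrightarrow> z + h \<notin> D"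
          using r(2)[of "(z + h, y)"] by (simp_all add: D_def mult.assoc)
      qed
      have zero': "\<psi> (x, y) = 0" if "x \<in> B" "x \<noteq> z" for x
      proof (rule zero)
        show "(x, y) \<in> frontier U" using that by (simp add: B_def)
        show "(x, y) \<notin> open_segment a b"
        proof
          assume "(x, y) \<in> open_segment a b"
          then obtain u where u: "(x, y) = linepath a b u"
            by (auto simp: in_segment linepath_def)
          then have "y = (1 - u) * snd a + u * snd b" by (metis linepath_def snd_add snd_scaleR snd_conv real_scaleR_def)
          then have "y - snd a = u * \<delta>" by (simp add: \<delta>_def algebra_simps)
          then have "t = u" using \<delta>0 by (simp add: t_def)
          then show False using u zy that(2) by simp
        qed
      qed
      have zR: "-R < z" "z < R"
        using bound[of z] zseg segment_open_subset_closed[of a b] by auto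
      have zD: "z \<notin> D" using zseg on_edge by (auto simp: D_def)
      have "I y = sgn (s * \<delta>) * \<psi> (z, y)"
      proof (cases "0 < s * \<delta>")
        case True
        have "I y = \<psi> (z, y)"
          unfolding I
        proof (rule integral_open_set_step[OF 0 zero' zR zD r(1)])
          let ?J = "\<lambda>x. if x < z then 0 else \<psi> (z, y)"
          show "\<bar>(if x \<in> D then \<psi> (x, y) else 0) + ?J x - ?J z\<bar> \<le> \<bar>\<psi> (x, y) - \<psi> (z, y)\<bar>"
            if "\<bar>x - z\<bar> < r" for x
            using near[of "x - z"] that zD mult_pos_neg[OF True, of "x - z"] mult_pos_pos[OF True, of "x - z"]
            by (cases x z rule: linorder_cases) auto
        qed auto
        then show ?thesis using True by simp
      next
        case False
        then have neg: "s * \<delta> < 0" using s \<delta>0 by (smt (verit) mult_eq_0_iff)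
        have "I y = - \<psi> (z, y)"
          unfolding I
        proof (rule integral_open_set_step[OF 0 zero' zR zD r(1)])
          let ?J = "\<lambda>x. if x \<le> z then 0 else - \<psi> (z, y)"
          show "\<bar>(if x \<in> D then \<psi> (x, y) else 0) + ?J x - ?J z\<bar> \<le> \<bar>\<psi> (x, y) - \<psi> (z, y)\<bar>"
            if "\<bar>x - z\<bar> < r" for x
            using near[of "x - z"] that zD mult_neg_pos[OF neg, of "x - z"] mult_neg_neg[OF neg, of "x - z"]
            by (cases x z rule: linorder_cases) auto
        qed auto
        then show ?thesis using neg by simp
      qed
      then show ?thesis using True by (simp add: F_def t_def[symmetric] zy)
    qed
  qed
  have \<psi>c: "continuous_on UNIV (\<lambda>t. \<psi> (linepath a b t))"
    by (rule continuous_on_compose2[OF C1_continuous[OF \<psi>]]) (auto intro: continuous_intros)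
  have "(LINT p|lebesgue_on U. fst (H p)) = (LINT y|lborel. I y)"
    unfolding I_def by (rule integral_slices[OF U H])
  also have "\<dots> = (LINT y|lborel. F y)"
  proof (rule integral_cong_AE)
    have "integrable (lborel \<Otimes>\<^sub>M lborel) (\<lambda>p. indicator U p * fst (H p))"
      using integrable_indicator_continuous[OF U H] by (simp add: lborel_prod)
    then have "integrable lborel I"
      unfolding I_def using lborel_pair.integrable_snd[of "\<lambda>x y. indicator U (x, y) * fst (H (x, y))"]
      by (simp add: case_prod_unfold)
    then show "I \<in> borel_measurable lborel" by simp
    have "(\<lambda>y. \<psi> (linepath a b ((y - snd a) / \<delta>))) \<in> borel_measurable borel"
      by (rule measurable_compose[OF _ borel_measurable_continuous_onI[OF \<psi>c]]) measurable
    then show "F \<in> borel_measurable lborel" unfolding F_def by measurable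
    have "AE y in lborel. y \<notin> insert (snd a) (insert (snd b) V)"
      using V by (intro AE_not_in finite_imp_null_set_lborel) auto
    then show "AE y in lborel. I y = F y" by eventually_elim (rule slice)
  qed
  also have "\<dots> = s * \<delta> * (LINT t|lborel. indicator {0..1} t * \<psi> (linepath a b t))"
  proof (cases "\<delta> = 0")
    case True
    then show ?thesis by (simp add: F_def)
  next
    case False
    have "(LINT y|lborel. F y) = \<bar>\<delta>\<bar> *\<^sub>R (LINT t|lborel. F (snd a + \<delta> * t))"
      using False by (rule lborel_integral_real_affine)
    also have "\<dots> = \<bar>\<delta>\<bar> * (LINT t|lborel. sgn (s * \<delta>) * (indicator {0..1} t * \<psi> (linepath a b t)))"
      using False by (simp add: F_def mult.assoc mult.left_commute)
    also have "\<dots> = (\<bar>\<delta>\<bar> * sgn (s * \<delta>)) * (LINT t|lborel. indicator {0..1} t * \<psi> (linepath a b t))"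
      by simp
    also have "\<bar>\<delta>\<bar> * sgn (s * \<delta>) = s * \<delta>"
      using s by (auto simp: sgn_if abs_if mult_less_0_iff zero_less_mult_iff split: if_splits)
    finally show ?thesis .
  qed
  also have "(LINT t|lborel. indicator {0..1} t * \<psi> (linepath a b t)) =
      (LINT t|lebesgue. indicator {0..1} t * \<psi> (linepath a b t))"
    using borel_measurable_continuous_onI[OF \<psi>c] by (intro integral_completion[symmetric]) simp
  also have "\<dots> = (LINT t|lebesgue_on {0..1}. \<psi> (linepath a b t))"
    by (subst Bochner_Integration.integral_restrict_space) auto
  finally show ?thesis by (simp add: \<delta>_def)
qed

text \<open>Exchanging the coordinates reverses orientation: \<open>side_of\<close> changes sign, so
  the formula for the first component is used with \<open>- s\<close>.\<close>

lemma green_edge_snd: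
  assumes U: "open U" "bounded U" and \<psi>: "C1 \<psi> H" and V: "finite V"
    and fin: "\<And>x. x \<notin> V \<Longrightarrow> finite {y. (x, y) \<in> frontier U}"
    and zero: "\<And>p. \<lbrakk>p \<in> frontier U; p \<notin> open_segment a b\<rbrakk> \<Longrightarrow> \<psi> p = 0"
    and on_edge: "\<And>p. p \<in> open_segment a b \<Longrightarrow> p \<notin> U"
    and s: "\<bar>s\<bar> = 1" and side: "\<And>z. z \<in> open_segment a b \<Longrightarrow> locally_on_side s a b U z"
  shows "(LINT p|lebesgue_on U. snd (H p)) =
    - s * (fst b - fst a) * (LINT t|lebesgue_on {0..1}. \<psi> (linepath a b t))"
proof -
  let ?sw = "prod.swap :: point \<Rightarrow> point"
  have lin: "linear ?sw" by (simp add: linear_iff)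
  have inj: "inj ?sw" by simp
  have mem: "p \<in> ?sw ` A \<longleftrightarrow> prod.swap p \<in> A" for p A by (simp add: swap_image_eq_vimage)
  note U' = open_bounded_swap[OF U]
  have fr: "frontier (?sw ` U) = ?sw ` frontier U"
    using lin inj U(1) U'(1)
    by (simp add: frontier_def closure_injective_linear_image interior_open image_set_diff)
  have seg: "open_segment (?sw a) (?sw b) = ?sw ` open_segment a b"
    using lin inj by (rule open_segment_linear_image)
  have so: "side_of (?sw a) (?sw b) p = - side_of a b (?sw p)" for p
    by (simp add: side_of_def)
  have dist: "dist (?sw p) (?sw q) = dist p q" for p q
    by (cases p; cases q) (simp add: dist_Pair_Pair add.commute)
  have H: "continuous_on UNIV (\<lambda>p. snd (H p))"
    using C1_continuous_grad[OF \<psi>] by (intro continuous_intros)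
  have swap_line: "prod.swap (linepath (?sw a) (?sw b) t) = linepath a b t" for t
    by (simp add: linepath_def prod_eq_iff)
  have "(LINT p|lebesgue_on U. snd (H p)) =
      (LINT p|lebesgue_on (?sw ` U). fst (prod.swap (H (prod.swap p))))"
    using integral_swap[OF U(1) H] by simp
  also have "\<dots> = (- s) * (snd (?sw b) - snd (?sw a)) *
      (LINT t|lebesgue_on {0..1}. \<psi> (prod.swap (linepath (?sw a) (?sw b) t)))"
  proof (rule green_edge_fst[OF U' C1_swap[OF \<psi>] V])
    show "finite {x. (x, y) \<in> frontier (?sw ` U)}" if "y \<notin> V" for y
      using fin[OF that] by (simp add: fr mem)
    show "\<psi> (prod.swap p) = 0" if "p \<in> frontier (?sw ` U)" "p \<notin> open_segment (?sw a) (?sw b)" for p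
      using that zero by (simp add: fr mem seg)
    show "p \<notin> ?sw ` U" if "p \<in> open_segment (?sw a) (?sw b)" for p
      using that on_edge by (simp add: mem seg)
    show "locally_on_side (- s) (?sw a) (?sw b) (?sw ` U) z" if "z \<in> open_segment (?sw a) (?sw b)" for z
    proof -
      have "locally_on_side s a b U (?sw z)" using side that by (simp add: seg mem)
      then obtain r where r: "0 < r" "\<And>p. p \<in> ball (?sw z) r \<Longrightarrow>
          (0 < s * side_of a b p \<longrightarrow> p \<in> U) \<and> (s * side_of a b p < 0 \<longrightarrow> p \<notin> U)"
        unfolding locally_on_side_def by blast
      show ?thesis
        unfolding locally_on_side_def
      proof (intro exI[of _ r] conjI ballI r(1))
        fix p assume "p \<in> ball z r"
        then have "?sw p \<in> ball (?sw z) r" by (simp add: dist)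
        then show "0 < - s * side_of (?sw a) (?sw b) p \<longrightarrow> p \<in> ?sw ` U"
          "- s * side_of (?sw a) (?sw b) p < 0 \<longrightarrow> p \<notin> ?sw ` U"
          using r(2)[of "?sw p"] by (simp_all add: so mem)
      qed
    qed
  qed (use s in auto)
  also have "(LINT t|lebesgue_on {0..1}. \<psi> (prod.swap (linepath (?sw a) (?sw b) t))) =
      (LINT t|lebesgue_on {0..1}. \<psi> (linepath a b t))"
    unfolding swap_line ..
  finally show ?thesis by simp
qed

section \<open>Simple polygons\<close>

text \<open>Needed to carry the Jordan curve theorem from the complex plane to pairs of reals. A
  linear isomorphism is a homeomorphism of the complements that preserves boundedness, so it maps
  bounded components to bounded components.\<close>

lemma inside_injective_linear_image:
  fixes f :: "'a::euclidean_space \<Rightarrow> 'b::euclidean_space"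
  assumes f: "linear f" "inj f" "surj f"
  shows "inside (f ` S) = f ` inside S" "outside (f ` S) = f ` outside S"
proof -
  obtain g where g: "linear g" "g \<circ> f = id" using linear_injective_left_inverse[OF f(1,2)] by blast
  then have gf: "g (f x) = x" for x by (metis comp_apply id_apply)
  have fg: "f (g y) = y" for y using f(3) gf by (metis surjD)
  have img: "f ` (- S) = - f ` S" using f(2,3) by (simp add: bij_image_Compl_eq bij_def)
  have hom: "homeomorphism (- S) (- f ` S) f g"
    unfolding homeomorphism_def img[symmetric] using f(1) g(1)
    by (auto simp: gf fg image_image linear_continuous_on linear_conv_bounded_linear)
  have bd: "bounded (f ` A) \<longleftrightarrow> bounded A" for A
  proof
    assume "bounded (f ` A)"
    then have "bounded (g ` f ` A)" using g(1) by (simp add: bounded_linear_image linear_conv_bounded_linear)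
    then show "bounded A" by (simp add: image_image gf)
  qed (use f(1) in \<open>simp add: bounded_linear_image linear_conv_bounded_linear\<close>)
  have cc: "connected_component_set (- f ` S) (f x) = f ` connected_component_set (- S) x"
    if "x \<notin> S" for x
    using connected_component_set_homeomorphism[OF hom] that by simp
  have mem: "f x \<in> f ` A \<longleftrightarrow> x \<in> A" for x A using f(2) by (simp add: inj_image_mem_iff)
  show "inside (f ` S) = f ` inside S"
  proof (rule set_eqI)
    fix y show "y \<in> inside (f ` S) \<longleftrightarrow> y \<in> f ` inside S"
      using cc[of "g y"] mem[of "g y"] bd by (cases "g y \<in> S") (auto simp: inside_def fg)
  qed
  show "outside (f ` S) = f ` outside S"
  proof (rule set_eqI)
    fix y show "y \<in> outside (f ` S) \<longleftrightarrow> y \<in> f ` outside S"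
      using cc[of "g y"] mem[of "g y"] bd by (cases "g y \<in> S") (auto simp: outside_def fg)
  qed
qed

lemma Jordan_plane:
  fixes c :: "real \<Rightarrow> point"
  assumes "simple_path c" "pathfinish c = pathstart c"
  shows "inside (path_image c) \<noteq> {}" "bounded (inside (path_image c))"
    "frontier (inside (path_image c)) = path_image c"
    "frontier (outside (path_image c)) = path_image c"
proof -
  define f where "f = (\<lambda>p::point. Complex (fst p) (snd p))"
  have lin: "linear f" by (rule linearI) (auto simp: f_def complex_eq_iff)
  have inj: "inj f" by (auto simp: f_def inj_on_def)
  have surj: "surj f" by (rule surjI[of _ "\<lambda>z. (Re z, Im z)"]) (simp add: f_def)
  define S where "S = path_image c"
  have "simple_path (f \<circ> c)" using assms(1) simple_path_linear_image_eq[OF lin inj] by blast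
  moreover have "pathfinish (f \<circ> c) = pathstart (f \<circ> c)"
    using assms(2) by (simp add: pathfinish_def pathstart_def)
  moreover have S: "path_image (f \<circ> c) = f ` S" by (simp add: path_image_compose S_def)
  ultimately have J: "inside (f ` S) \<noteq> {}"
    "frontier (inside (f ` S)) = f ` S" "frontier (outside (f ` S)) = f ` S"
    using Jordan_inside_outside[of "f \<circ> c"] by auto
  have fr: "frontier (f ` A) = f ` frontier A" if "open A" "open (f ` A)" for A
    using that lin inj closure_injective_linear_image[OF lin inj, of A]
    by (simp add: frontier_def interior_open image_set_diff)
  have "closed S" unfolding S_def using assms(1) by (rule closed_simple_path_image)
  then have op: "open (inside S)" "open (outside S)" by (auto intro: open_inside open_outside)
  have "closed (f ` S)" using \<open>closed S\<close> lin inj by (rule closed_injective_linear_image)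
  then have op': "open (f ` inside S)" "open (f ` outside S)"
    unfolding inside_injective_linear_image[OF lin inj surj, symmetric]
    by (auto intro: open_inside open_outside)
  have "f ` frontier (inside S) = f ` S" "f ` frontier (outside S) = f ` S"
    using J(2,3) unfolding inside_injective_linear_image[OF lin inj surj]
    by (simp_all add: fr[OF op(1) op'(1)] fr[OF op(2) op'(2)])
  then show "frontier (inside (path_image c)) = path_image c"
    "frontier (outside (path_image c)) = path_image c"
    using inj by (simp_all add: inj_image_eq_iff S_def)
  show "inside (path_image c) \<noteq> {}"
    using J(1) unfolding inside_injective_linear_image[OF lin inj surj] by (simp add: S_def)
  show "bounded (inside (path_image c))"
    using assms(1) by (simp add: bounded_inside bounded_simple_path_image)
qed

text \<open>\<open>edge_param m i s\<close> is the parameter at which a polygonal path with \<open>m + 1\<close> edges passes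
  through the point of its \<open>i\<close>-th edge with parameter \<open>s\<close>.\<close>

fun edge_param :: "nat \<Rightarrow> nat \<Rightarrow> real \<Rightarrow> real" where
  "edge_param 0 i s = s"
| "edge_param (Suc m) 0 s = s / 2"
| "edge_param (Suc m) (Suc i) s = 1 / 2 + edge_param m i s / 2"

lemma edge_param_closed: "s \<in> {0..1} \<Longrightarrow> edge_param m i s \<in> {0..1}"
  by (induction m i s rule: edge_param.induct) auto

lemma edge_param_open: "s \<in> {0<..<1} \<Longrightarrow> edge_param m i s \<in> {0<..<1}"
  by (induction m i s rule: edge_param.induct) auto

text \<open>Only one of the two parameters may be an endpoint: at a joint, the end of an edge and
  the start of the next one have the same path parameter.\<close>

lemma edge_param_inj:
  "\<lbrakk>edge_param m i s = edge_param m j s'; i \<le> m; j \<le> m; s \<in> {0<..<1}; s' \<in> {0..1}\<rbrakk> \<Longrightarrow> i = j \<and> s = s'"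
proof (induction m arbitrary: i j)
  case (Suc m)
  show ?case
  proof (cases i; cases j)
    fix i' j' assume "i = Suc i'" "j = Suc j'"
    then show ?thesis using Suc.IH[of i' j'] Suc.prems by simp
  next
    fix j' assume "i = 0" "j = Suc j'"
    then show ?thesis using Suc.prems edge_param_closed[of s' m j'] by simp
  next
    fix i' assume "i = Suc i'" "j = 0"
    then show ?thesis using Suc.prems edge_param_open[of s m i'] by simp
  qed (use Suc.prems in simp)
qed simp

lemma polygonal_path_ends:
  "xs \<noteq> [] \<Longrightarrow> pathstart (polygonal_path xs) = hd xs \<and> pathfinish (polygonal_path xs) = last xs"
  by (induction xs rule: polygonal_path.induct) auto

lemma polygonal_path_edge_param:
  "\<lbrakk>length xs = m + 2; i \<le> m; s \<in> {0..1}\<rbrakk> \<Longrightarrow>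
    polygonal_path xs (edge_param m i s) = linepath (xs ! i) (xs ! Suc i) s"
proof (induction xs arbitrary: m i rule: polygonal_path.induct)
  case (4 a b c xs)
  obtain m' where m: "m = Suc m'" using "4.prems"(1) by (cases m) auto
  show ?case
  proof (cases i)
    case 0
    then show ?thesis using "4.prems" m by (simp add: joinpaths_def)
  next
    case (Suc i')
    have IH: "polygonal_path (b # c # xs) (edge_param m' i' s) =
        linepath ((b # c # xs) ! i') ((b # c # xs) ! Suc i') s"
      using "4.IH"[of m' i'] "4.prems" m Suc by simp
    \<comment> \<open>At parameter 1/2 a joined path still follows its first part, so the start of
      the remaining path is a separate case; both parts take the value \<open>b\<close>
      there.\<close>
    have "0 \<le> edge_param m' i' s" using edge_param_closed[OF "4.prems"(3)] by simp
    moreover have "polygonal_path (b # c # xs) 0 = b"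
      using polygonal_path_ends[of "b # c # xs"] by (simp add: pathstart_def)
    ultimately show ?thesis
      using IH m Suc by (cases "edge_param m' i' s = 0") (simp_all add: joinpaths_def linepath_def)
  qed
qed (auto simp: linepath_def)

lemma path_image_polygonal_path:
  "length xs = m + 2 \<Longrightarrow>
    path_image (polygonal_path xs) = (\<Union>i\<le>m. closed_segment (xs ! i) (xs ! Suc i))"
proof (induction xs arbitrary: m rule: polygonal_path.induct)
  case (4 a b c xs)
  obtain m' where m: "m = Suc m'" using "4.prems"(1) by (cases m) auto
  have "path_image (polygonal_path (a # b # c # xs)) =
      closed_segment a b \<union> path_image (polygonal_path (b # c # xs))"
    using polygonal_path_ends[of "b # c # xs"] by (simp add: path_image_join)
  also have "\<dots> = (\<Union>i\<le>m. closed_segment ((a # b # c # xs) ! i) ((a # b # c # xs) ! Suc i))"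
    using "4.IH"[of m'] "4.prems" by (simp add: m atMost_Suc_eq_insert_0)
  finally show ?case .
qed auto

section \<open>Edges and vertices of a simple polygon\<close>

definition polygon_edge :: "polygon \<Rightarrow> nat \<Rightarrow> edge" where
  "polygon_edge P i = (P ! i, P ! (Suc i mod length P))"

lemma edges_eq: "edges P = polygon_edge P ` {..<length P}"
  by (auto simp: edges_def polygon_edge_def)

lemma finite_edges: "finite (edges P)"
  by (simp add: edges_eq)

text \<open>Reconciles the two ways of closing the cycle, by an index modulo the length and by an
  appended head.\<close>

lemma boundary_nth:
  assumes "i < length P"
  shows "((P @ [hd P]) ! i, (P @ [hd P]) ! Suc i) = polygon_edge P i"
proof (cases "Suc i < length P")
  case False
  then have "Suc i = length P" using assms by simp
  moreover have "P \<noteq> []" using assms by auto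
  ultimately show ?thesis using assms by (simp add: polygon_edge_def nth_append hd_conv_nth)
qed (use assms in \<open>simp add: polygon_edge_def nth_append\<close>)

context
  fixes P :: polygon
  assumes P: "simple_polygon P"
begin

lemma length_polygon: "3 \<le> length P"
  using P by (simp add: simple_polygon_def)

lemma simple_boundary_path: "simple_path (boundary_path P)"
  using P by (simp add: simple_polygon_def)

lemma closed_boundary_path: "pathfinish (boundary_path P) = pathstart (boundary_path P)"
proof -
  have "P \<noteq> []" using length_polygon by auto
  then show ?thesis
    using polygonal_path_ends[of "P @ [hd P]"] by (simp add: boundary_path_def)
qed

lemma boundary_path_edge_param:
  assumes "i < length P" "s \<in> {0..1}"
  shows "boundary_path P (edge_param (length P - 1) i s) =
    linepath (fst (polygon_edge P i)) (snd (polygon_edge P i)) s"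
proof -
  have "boundary_path P (edge_param (length P - 1) i s) =
      linepath ((P @ [hd P]) ! i) ((P @ [hd P]) ! Suc i) s"
    unfolding boundary_path_def using assms length_polygon
    by (intro polygonal_path_edge_param) auto
  then show ?thesis by (simp only: boundary_nth[OF assms(1), symmetric] fst_conv snd_conv)
qed

lemma path_image_boundary: "path_image (boundary_path P) = (\<Union>e\<in>edges P. seg e)"
proof -
  have "path_image (boundary_path P) =
      (\<Union>i\<le>length P - 1. closed_segment ((P @ [hd P]) ! i) ((P @ [hd P]) ! Suc i))"
    unfolding boundary_path_def using length_polygon by (intro path_image_polygonal_path) simp
  also have "{..length P - 1} = {..<length P}" using length_polygon by auto
  also have "(\<Union>i<length P. closed_segment ((P @ [hd P]) ! i) ((P @ [hd P]) ! Suc i)) =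
      (\<Union>i<length P. seg (polygon_edge P i))"
    by (intro SUP_cong) (auto simp: seg_def boundary_nth[symmetric])
  finally show ?thesis by (simp add: edges_eq)
qed

lemma simple_path_param_inj:
  "\<lbrakk>simple_path c; c t = c t'; t \<in> {0<..<1}; t' \<in> {0..1}\<rbrakk> \<Longrightarrow> t = t'"
  unfolding simple_path_def loop_free_def by (metis atLeastAtMost_iff greaterThanLessThan_iff less_eq_real_def less_irrefl)

lemma boundary_param_inj:
  assumes "i < length P" "j < length P" "s \<in> {0<..<1}" "s' \<in> {0..1}"
    and eq: "linepath (fst (polygon_edge P i)) (snd (polygon_edge P i)) s =
      linepath (fst (polygon_edge P j)) (snd (polygon_edge P j)) s'"
  shows "i = j \<and> s = s'"
proof -
  let ?t = "edge_param (length P - 1)"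
  have "boundary_path P (?t i s) = boundary_path P (?t j s')"
    using eq assms(3) boundary_path_edge_param[OF assms(1), of s]
      boundary_path_edge_param[OF assms(2,4)] by simp
  moreover have "?t i s \<in> {0<..<1}" "?t j s' \<in> {0..1}"
    using assms(3,4) edge_param_open edge_param_closed by blast+
  ultimately have "?t i s = ?t j s'"
    using simple_path_param_inj[OF simple_boundary_path, of "?t i s" "?t j s'"] by auto
  then show ?thesis using assms by (intro edge_param_inj) auto
qed

text \<open>On a degenerate edge the points at one quarter and at three quarters would coincide,
  against injectivity of the boundary path.\<close>

lemma edge_nondegenerate: "i < length P \<Longrightarrow> fst (polygon_edge P i) \<noteq> snd (polygon_edge P i)"
  using boundary_param_inj[of i i "1 / 4" "3 / 4"] by auto

lemma edge_disjoint:
  assumes "i < length P" "j < length P" "z \<in> open_seg (polygon_edge P i)" "z \<in> seg (polygon_edge P j)"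
  shows "i = j"
proof -
  obtain s where s: "s \<in> {0<..<1}" "z = linepath (fst (polygon_edge P i)) (snd (polygon_edge P i)) s"
    using assms(3) by (auto simp: open_seg_def in_segment linepath_def)
  obtain s' where s': "s' \<in> {0..1}" "z = linepath (fst (polygon_edge P j)) (snd (polygon_edge P j)) s'"
    using assms(4) by (auto simp: seg_def in_segment linepath_def)
  show ?thesis using boundary_param_inj[OF assms(1,2) s(1) s'(1)] s s' by simp
qed

lemma region_facts:
  "open (region P)" "bounded (region P)" "region P \<noteq> {}"
  "frontier (region P) = (\<Union>e\<in>edges P. seg e)"
  using Jordan_plane[OF simple_boundary_path closed_boundary_path]
    closed_simple_path_image[OF simple_boundary_path] path_image_boundary
  by (auto simp: region_def intro: open_inside)

text \<open>Ensures that a function vanishing on all other edges also vanishes at both endpoints of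
  the \<open>i\<close>-th edge, so that corners contribute nothing to Green's formula.\<close>

lemma vertex_on_other_edge:
  assumes "i < length P" "p \<in> {fst (polygon_edge P i), snd (polygon_edge P i)}"
  obtains d where "d \<in> edges P" "d \<noteq> polygon_edge P i" "p \<in> seg d"
proof -
  let ?n = "length P"
  have n: "3 \<le> ?n" by (rule length_polygon)
  have neq: "polygon_edge P j \<noteq> polygon_edge P i" if "j < ?n" "j \<noteq> i" for j
  proof
    assume eq: "polygon_edge P j = polygon_edge P i"
    have "linepath (fst (polygon_edge P i)) (snd (polygon_edge P i)) (1 / 2) =
        linepath (fst (polygon_edge P j)) (snd (polygon_edge P j)) (1 / 2)" by (simp add: eq)
    then show False using boundary_param_inj[of i j "1 / 2" "1 / 2"] assms(1) that by simp
  qed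
  show ?thesis
  proof (cases "p = fst (polygon_edge P i)")
    case True
    define j where "j = (if i = 0 then ?n - 1 else i - 1)"
    have j: "j < ?n" "j \<noteq> i" "Suc j mod ?n = i" using assms(1) n by (auto simp: j_def)
    have "p \<in> seg (polygon_edge P j)" using True j by (simp add: seg_def polygon_edge_def)
    then show ?thesis using that[of "polygon_edge P j"] neq j by (auto simp: edges_eq)
  next
    case False
    define j where "j = Suc i mod ?n"
    have j: "j < ?n" "j \<noteq> i" 
      using assms(1) n by (auto simp: j_def mod_Suc split: if_splits)
    have "p \<in> seg (polygon_edge P j)" using False assms(2) by (simp add: seg_def polygon_edge_def j_def)
    then show ?thesis using that[of "polygon_edge P j"] neq j by (auto simp: edges_eq)
  qed
qed

end

section \<open>Green's formula on a polygon\<close>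

text \<open>If the segment is parallel to the slicing line, the hypothesis makes the slice empty;
  otherwise the fixed coordinate determines the parameter on the segment.\<close>

lemma finite_segment_slice:
  "y \<noteq> snd (fst d) \<Longrightarrow> finite {x. (x, y) \<in> seg d}"
  "x \<noteq> fst (fst d) \<Longrightarrow> finite {y. (x, y) \<in> seg d}"
proof -
  obtain a1 a2 b1 b2 where d: "d = ((a1, a2), (b1, b2))" by (metis prod.collapse)
  have seg: "\<exists>u. p - a1 = u * (b1 - a1) \<and> q - a2 = u * (b2 - a2)" if "(p, q) \<in> seg d" for p q
    using that by (auto simp: seg_def in_segment d algebra_simps)
  show "finite {x. (x, y) \<in> seg d}" if y: "y \<noteq> snd (fst d)"
  proof (rule finite_subset)
    show "{x. (x, y) \<in> seg d} \<subseteq> {a1 + (y - a2) / (b2 - a2) * (b1 - a1)}"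
    proof
      fix x assume "x \<in> {x. (x, y) \<in> seg d}"
      then obtain u where u: "x - a1 = u * (b1 - a1)" "y - a2 = u * (b2 - a2)" using seg by blast
      have "b2 - a2 \<noteq> 0" using u(2) y by (auto simp: d)
      then have "(y - a2) / (b2 - a2) = u" unfolding u(2) by simp
      then show "x \<in> {a1 + (y - a2) / (b2 - a2) * (b1 - a1)}" using u(1) by simp
    qed
  qed simp
  show "finite {y. (x, y) \<in> seg d}" if x: "x \<noteq> fst (fst d)"
  proof (rule finite_subset)
    show "{y. (x, y) \<in> seg d} \<subseteq> {a2 + (x - a1) / (b1 - a1) * (b2 - a2)}"
    proof
      fix y assume "y \<in> {y. (x, y) \<in> seg d}"
      then obtain u where u: "x - a1 = u * (b1 - a1)" "y - a2 = u * (b2 - a2)" using seg by blast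
      have "b1 - a1 \<noteq> 0" using u(1) x by (auto simp: d)
      then have "(x - a1) / (b1 - a1) = u" unfolding u(1) by simp
      then show "y \<in> {a2 + (x - a1) / (b1 - a1) * (b2 - a2)}" using u(2) by simp
    qed
  qed simp
qed

section \<open>The side of an edge on which the region lies\<close>

lemma side_of_inner: "side_of a b p = (snd a - snd b, fst b - fst a) \<bullet> p - (snd a - snd b, fst b - fst a) \<bullet> a"
  by (cases p; cases a; cases b) (simp add: side_of_def algebra_simps)

text \<open>The direction is the edge vector after a quarter turn, that is, the normal pointing to
  the positive side, with length \<open>dist a b\<close>.\<close>

lemma side_of_direction:
  "side_of a b (p + t *\<^sub>R (snd a - snd b, fst b - fst a)) = side_of a b p + t * (dist a b)\<^sup>2"
proof -
  have "(dist a b)\<^sup>2 = (fst a - fst b)\<^sup>2 + (snd a - snd b)\<^sup>2"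
    by (simp add: dist_prod_def dist_real_def)
  then have "side_of a b p + t * (dist a b)\<^sup>2 =
      side_of a b p + t * ((fst a - fst b)\<^sup>2 + (snd a - snd b)\<^sup>2)" by (rule arg_cong)
  then show ?thesis by (simp add: side_of_def power2_eq_square algebra_simps)
qed

lemma side_of_closed_segment: "z \<in> closed_segment a b \<Longrightarrow> side_of a b z = 0"
  using side_of_linepath[of a b] by (auto simp: in_segment linepath_def)

lemma nearby_on_side:
  fixes a b :: point
  assumes "a \<noteq> b" "0 < r"
  obtains t where "0 < t" "\<And>p. p + t *\<^sub>R (snd a - snd b, fst b - fst a) \<in> ball p r"
proof -
  define \<nu> where "\<nu> = (snd a - snd b, fst b - fst a)"
  \<comment> \<open>Adding 1 keeps the denominator positive, and \<open>t * norm \<nu>\<close> still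
    stays within \<open>r / 2\<close>.\<close>
  define t where "t = r / (2 * (norm \<nu> + 1))"
  have pos: "0 < norm \<nu> + 1" by (rule add_nonneg_pos) auto
  then have t: "0 < t" using assms(2) by (simp add: t_def)
  have "t * norm \<nu> \<le> t * (norm \<nu> + 1)" using t by simp
  also have "\<dots> = r / 2" using pos by (simp add: t_def field_simps)
  also have "\<dots> < r" using assms(2) by simp
  finally have lt: "t * norm \<nu> < r" .
  have "p + t *\<^sub>R \<nu> \<in> ball p r" for p
    using lt t by (simp add: dist_norm)
  then show ?thesis unfolding \<nu>_def by (rule that[OF t])
qed

lemma open_not_on_line:
  assumes "a \<noteq> b" "open W" "W \<noteq> {}"
  obtains p where "p \<in> W" "side_of a b p \<noteq> 0"
proof -
  obtain p where p: "p \<in> W" using assms(3) by blast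
  obtain r where r: "0 < r" "ball p r \<subseteq> W" using assms(2) p open_contains_ball by blast
  obtain t where t: "0 < t" "\<And>p. p + t *\<^sub>R (snd a - snd b, fst b - fst a) \<in> ball p r"
    using nearby_on_side[OF assms(1) r(1)] by metis
  define q where "q = p + t *\<^sub>R (snd a - snd b, fst b - fst a)"
  have "q \<in> W" using t(2)[of p] r(2) by (auto simp: q_def)
  moreover have "side_of a b q = side_of a b p + t * (dist a b)\<^sup>2"
    unfolding q_def by (rule side_of_direction)
  moreover have "0 < t * (dist a b)\<^sup>2" using t(1) assms(1) by simp
  ultimately show ?thesis using that[of p] that[of q] p by fastforce
qed

text \<open>A short step from \<open>z\<close> along the normal reaches a point that one property
  puts into \<open>U\<close> and the other one outside.\<close>

lemma not_locally_on_both_sides: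
  assumes "a \<noteq> b" "side_of a b z = 0" "locally_on_side 1 a b U z" "locally_on_side (-1) a b U z"
  shows False
proof -
  obtain r where r: "0 < r" "\<And>p. p \<in> ball z r \<Longrightarrow> 0 < side_of a b p \<Longrightarrow> p \<in> U"
    using assms(3) unfolding locally_on_side_def by auto
  obtain r' where r': "0 < r'" "\<And>p. p \<in> ball z r' \<Longrightarrow> 0 < side_of a b p \<Longrightarrow> p \<notin> U"
    using assms(4) unfolding locally_on_side_def by auto
  obtain t where t: "0 < t" "\<And>p. p + t *\<^sub>R (snd a - snd b, fst b - fst a) \<in> ball p (min r r')"
    using nearby_on_side[OF assms(1), of "min r r'"] r(1) r'(1) by (metis min_less_iff_conj)
  define q where "q = z + t *\<^sub>R (snd a - snd b, fst b - fst a)"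
  have "0 < side_of a b q"
    using t(1) assms(1) unfolding q_def side_of_direction assms(2) by simp
  moreover have "q \<in> ball z r" "q \<in> ball z r'" using t(2)[of z] by (simp_all add: q_def)
  ultimately show False using r(2) r'(2) by blast
qed

context
  fixes P :: polygon and i :: nat
  assumes P: "simple_polygon P" and i: "i < length P"
begin

text \<open>The other edges form a closed set that misses \<open>z\<close>, so in a small disc the
  boundary lies on one line. The two open half discs are convex and avoid the boundary, hence each
  is entirely inside or entirely outside. By the Jordan curve theorem \<open>z\<close> is a limit of
  both inside and outside points, so the half discs are of different kinds.\<close>

lemma locally_on_some_side:
  assumes z: "z \<in> open_seg (polygon_edge P i)"
  defines "a \<equiv> fst (polygon_edge P i)" and "b \<equiv> snd (polygon_edge P i)"
  shows "locally_on_side 1 a b (region P) z \<or> locally_on_side (-1) a b (region P) z"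
proof -
  have ab: "a \<noteq> b" unfolding a_def b_def by (rule edge_nondegenerate[OF P i])
  define B where "B = path_image (boundary_path P)"
  have B: "B = (\<Union>e\<in>edges P. seg e)" unfolding B_def by (rule path_image_boundary[OF P])
  define C where "C = (\<Union>j\<in>{..<length P} - {i}. seg (polygon_edge P j))"
  have "closed C" unfolding C_def seg_def by (intro closed_UN) auto
  moreover have "z \<notin> C" using edge_disjoint[OF P i _ z] by (auto simp: C_def)
  ultimately obtain r where r: "0 < r" "ball z r \<subseteq> - C"
    using open_contains_ball[of "- C"] by (auto simp: open_Compl)
  have near: "side_of a b p = 0" if "p \<in> ball z r" "p \<in> B" for p
  proof -
    have "p \<in> seg (polygon_edge P i)" using that r(2) by (auto simp: B C_def edges_eq)
    then show ?thesis unfolding seg_def a_def b_def by (rule side_of_closed_segment)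
  qed
  have zB: "z \<in> B"
    using z i segment_open_subset_closed[of a b]
    by (auto simp: B edges_eq open_seg_def seg_def a_def b_def)
  have io: "inside B \<inter> outside B = {}" "inside B \<union> outside B = - B"
    by (simp_all add: inside_Int_outside inside_Un_outside)
  have cB: "closed B" unfolding B_def using simple_boundary_path[OF P] by (rule closed_simple_path_image)
  then have op: "open (inside B)" "open (outside B)" by (auto intro: open_inside open_outside)
  have fr: "frontier (inside B) = B" "frontier (outside B) = B"
    using Jordan_plane[OF simple_boundary_path[OF P] closed_boundary_path[OF P]] by (auto simp: B_def)
  define Hp where "Hp = ball z r \<inter> {p. 0 < side_of a b p}"
  define Hm where "Hm = ball z r \<inter> {p. side_of a b p < 0}"
  have conv: "convex Hp" "convex Hm"
    unfolding Hp_def Hm_def side_of_inner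
    by (intro convex_Int convex_ball; simp add: convex_halfspace_gt convex_halfspace_lt)+
  have side: "H \<subseteq> inside B \<or> H \<subseteq> outside B" if "convex H" "H \<inter> B = {}" for H
  proof -
    have "connected H" using that(1) by (rule convex_connected)
    then show ?thesis
      using connectedD[of H "inside B" "outside B"] op io that(2) by blast
  qed
  have Hp: "Hp \<subseteq> inside B \<or> Hp \<subseteq> outside B" and Hm: "Hm \<subseteq> inside B \<or> Hm \<subseteq> outside B"
    using near by (auto simp: Hp_def Hm_def intro!: side[OF conv(1), unfolded Hp_def] side[OF conv(2), unfolded Hm_def])
  \<comment> \<open>Near a frontier point an open set contains a small open piece, which cannot be
    confined to the line and therefore meets a half disc.\<close>
  have meets: "Hp \<inter> W \<noteq> {} \<or> Hm \<inter> W \<noteq> {}" if "open W" "frontier W = B" for W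
  proof -
    have "z \<in> closure W" using zB that(2) by (auto simp: frontier_def)
    then have "W \<inter> ball z r \<noteq> {}" using r(1) by (metis closure_approachable disjoint_iff dist_commute mem_ball)
    moreover have "open (W \<inter> ball z r)" using that(1) by (simp add: open_Int)
    ultimately obtain p where "p \<in> W \<inter> ball z r" "side_of a b p \<noteq> 0"
      using open_not_on_line[OF ab] by blast
    then show ?thesis by (cases "0 < side_of a b p") (auto simp: Hp_def Hm_def)
  qed
  have "(Hp \<subseteq> inside B \<and> Hm \<subseteq> outside B) \<or> (Hm \<subseteq> inside B \<and> Hp \<subseteq> outside B)"
    using Hp Hm meets[OF op(1) fr(1)] meets[OF op(2) fr(2)] io(1) by blast
  moreover have "locally_on_side s a b (region P) z"
    if "\<And>p. \<lbrakk>p \<in> ball z r; 0 < s * side_of a b p\<rbrakk> \<Longrightarrow> p \<in> inside B"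
      "\<And>p. \<lbrakk>p \<in> ball z r; s * side_of a b p < 0\<rbrakk> \<Longrightarrow> p \<in> outside B" for s
    unfolding locally_on_side_def region_def B_def[symmetric]
    using r(1) that io(1) by (intro exI[of _ r]) blast
  ultimately show ?thesis
    using IntI[of _ "ball z r"] unfolding Hp_def Hm_def
    by (elim disjE) (rule disjI1, force, rule disjI2, force)
qed

text \<open>The side is locally constant, because a neighbourhood that works for one point works for
  all nearby points, and the open edge is connected.\<close>

lemma same_side_along_edge:
  defines "a \<equiv> fst (polygon_edge P i)" and "b \<equiv> snd (polygon_edge P i)"
  obtains s where "\<bar>s\<bar> = (1::real)" "\<And>z. z \<in> open_segment a b \<Longrightarrow> locally_on_side s a b (region P) z"
proof -
  have ab: "a \<noteq> b" unfolding a_def b_def by (rule edge_nondegenerate[OF P i])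
  define f where "f = locally_on_side 1 a b (region P)"
  have both: "locally_on_side 1 a b (region P) z \<or> locally_on_side (-1) a b (region P) z"
    if "z \<in> open_segment a b" for z
    using locally_on_some_side[of z] that by (simp add: open_seg_def a_def b_def)
  have zero: "side_of a b z = 0" if "z \<in> open_segment a b" for z
    using that segment_open_subset_closed[of a b] side_of_closed_segment by blast
  have f_neg: "f z \<longleftrightarrow> \<not> locally_on_side (-1) a b (region P) z" if "z \<in> open_segment a b" for z
    using both[OF that] not_locally_on_both_sides[OF ab zero[OF that]] by (auto simp: f_def)
  have nbh: "\<exists>r>0. \<forall>w\<in>ball z r. locally_on_side s a b (region P) w"
    if "locally_on_side s a b (region P) z" for s z
  proof -
    obtain r where r: "0 < r" "\<forall>p\<in>ball z r. (0 < s * side_of a b p \<longrightarrow> p \<in> region P) \<and>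
        (s * side_of a b p < 0 \<longrightarrow> p \<notin> region P)"
      using \<open>locally_on_side s a b (region P) z\<close> unfolding locally_on_side_def by blast
    have "locally_on_side s a b (region P) w" if w: "w \<in> ball z r" for w
    proof -
      obtain r' where "0 < r'" "ball w r' \<subseteq> ball z r" using w open_contains_ball open_ball by metis
      then show ?thesis unfolding locally_on_side_def using r(2) by (intro exI[of _ r']) blast
    qed
    then show ?thesis using r(1) by blast
  qed
  have "f constant_on open_segment a b"
  proof (rule locally_constant_imp_constant)
    show "connected (open_segment a b)" by (simp add: convex_connected)
    fix z assume z: "z \<in> open_segment a b"
    obtain r where r: "0 < r" "\<forall>w\<in>ball z r. w \<in> open_segment a b \<longrightarrow> f w = f z"
    proof (cases "f z")
      case True
      then show ?thesis using nbh[of 1 z] that unfolding f_def by blast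
    next
      case False
      then have "locally_on_side (-1) a b (region P) z" using f_neg[OF z] by simp
      then obtain r where "0 < r" "\<forall>w\<in>ball z r. locally_on_side (-1) a b (region P) w"
        using nbh by blast
      then show ?thesis using False f_neg that by blast
    qed
    show "\<exists>T. openin (top_of_set (open_segment a b)) T \<and> z \<in> T \<and> (\<forall>x\<in>T. f x = f z)"
    proof (intro exI conjI ballI)
      show "openin (top_of_set (open_segment a b)) (open_segment a b \<inter> ball z r)"
        by (rule openin_open_Int[OF open_ball])
      show "z \<in> open_segment a b \<inter> ball z r" using z r(1) by simp
      show "f x = f z" if "x \<in> open_segment a b \<inter> ball z r" for x using that r(2) by simp
    qed
  qed
  then obtain c where c: "\<And>z. z \<in> open_segment a b \<Longrightarrow> f z = c" unfolding constant_on_def by blast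
  show ?thesis
  proof (cases c)
    case True
    then show ?thesis using that[of 1] c by (simp add: f_def)
  next
    case False
    then show ?thesis using that[of "-1"] c f_neg by simp
  qed
qed

text \<open>The vector \<open>\<nu>\<close> is the same for all test functions. This is what matters
  later: a field with polynomial components then has a polynomial normal component along the
  edge.\<close>

lemma green_polygon:
  defines "e \<equiv> polygon_edge P i"
  obtains \<nu> where "\<And>\<psi> H. \<lbrakk>C1 \<psi> H; \<forall>d\<in>edges P. d \<noteq> e \<longrightarrow> (\<forall>x\<in>seg d. \<psi> x = 0)\<rbrakk> \<Longrightarrow>
      (LINT p|lebesgue_on (region P). fst (H p)) = fst \<nu> * edge_int e \<psi> \<and>
      (LINT p|lebesgue_on (region P). snd (H p)) = snd \<nu> * edge_int e \<psi>"
proof -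
  define a b where "a = fst e" and "b = snd e"
  have ab: "a \<noteq> b" unfolding a_def b_def e_def by (rule edge_nondegenerate[OF P i])
  note region = region_facts[OF P]
  obtain s where s: "\<bar>s\<bar> = 1" "\<And>z. z \<in> open_segment a b \<Longrightarrow> locally_on_side s a b (region P) z"
    using same_side_along_edge unfolding a_def b_def e_def by blast
  have fin1: "finite {x. (x, y) \<in> frontier (region P)}" if "y \<notin> (snd \<circ> fst) ` edges P" for y
  proof -
    have "{x. (x, y) \<in> frontier (region P)} = (\<Union>d\<in>edges P. {x. (x, y) \<in> seg d})"
      by (auto simp: region(4))
    then show ?thesis
      using that by (auto simp: image_iff intro!: finite_UN_I finite_edges finite_segment_slice(1))
  qed
  have fin2: "finite {y. (x, y) \<in> frontier (region P)}" if "x \<notin> (fst \<circ> fst) ` edges P" for x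
  proof -
    have "{y. (x, y) \<in> frontier (region P)} = (\<Union>d\<in>edges P. {y. (x, y) \<in> seg d})"
      by (auto simp: region(4))
    then show ?thesis
      using that by (auto simp: image_iff intro!: finite_UN_I finite_edges finite_segment_slice(2))
  qed
  have on_edge: "p \<notin> region P" if "p \<in> open_segment a b" for p
  proof -
    have "p \<in> seg e" using that segment_open_subset_closed[of a b] by (auto simp: seg_def a_def b_def)
    then have "p \<in> frontier (region P)" using i by (auto simp: region(4) edges_eq e_def)
    then show ?thesis using region(1) frontier_disjoint_eq by blast
  qed
  \<comment> \<open>The edge vector after a quarter turn, scaled to unit length because
    \<open>edge_int\<close> contains the factor \<open>dist a b\<close>, and oriented by
    \<open>s\<close>.\<close>
  define \<nu> where "\<nu> = (s * (snd b - snd a) / dist a b, - s * (fst b - fst a) / dist a b)"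
  show ?thesis
  proof (rule that)
    fix \<psi> H assume \<psi>: "C1 \<psi> H" and van: "\<forall>d\<in>edges P. d \<noteq> e \<longrightarrow> (\<forall>x\<in>seg d. \<psi> x = 0)"
    have zero: "\<psi> p = 0" if p: "p \<in> frontier (region P)" "p \<notin> open_segment a b" for p
    proof -
      obtain d where d: "d \<in> edges P" "p \<in> seg d" using p(1) region(4) by blast
      show ?thesis
      proof (cases "d = e")
        case False
        then show ?thesis using van d by blast
      next
        case True
        then have "p \<in> {a, b}" using d(2) p(2) by (auto simp: seg_def open_segment_def a_def b_def)
        then obtain d' where "d' \<in> edges P" "d' \<noteq> e" "p \<in> seg d'"
          using vertex_on_other_edge[OF P i, of p] unfolding a_def b_def e_def by blast
        then show ?thesis using van by blast
      qed
    qed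
    have ei: "edge_int e \<psi> = dist a b * (LINT t|lebesgue_on {0..1}. \<psi> (linepath a b t))"
      by (simp add: edge_int_def a_def b_def)
    have "(LINT p|lebesgue_on (region P). fst (H p)) =
        s * (snd b - snd a) * (LINT t|lebesgue_on {0..1}. \<psi> (linepath a b t))"
      by (rule green_edge_fst[OF region(1,2) \<psi> _ fin1 zero on_edge s]) (auto simp: finite_edges)
    moreover have "(LINT p|lebesgue_on (region P). snd (H p)) =
        - s * (fst b - fst a) * (LINT t|lebesgue_on {0..1}. \<psi> (linepath a b t))"
      by (rule green_edge_snd[OF region(1,2) \<psi> _ fin2 zero on_edge s]) (auto simp: finite_edges)
    ultimately show "(LINT p|lebesgue_on (region P). fst (H p)) = fst \<nu> * edge_int e \<psi> \<and>
        (LINT p|lebesgue_on (region P). snd (H p)) = snd \<nu> * edge_int e \<psi>"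
      using ab by (simp add: ei \<nu>_def)
  qed
qed

end

section \<open>The flux of the continuous solutions\<close>

lemma L2_integrable:
  fixes v :: "point \<Rightarrow> real"
  assumes "v \<in> L2 D" "open D" "bounded D"
  shows "integrable (lebesgue_on D) v"
  using L2_integrable_inner[OF assms(1) L2_continuous[of "\<lambda>_. 1" D]] assms by simp

lemma has_trace_diff:
  assumes D: "open D" "bounded D" and L: "v \<in> L2 D" "w \<in> L2 D"
    and t: "has_trace D v x l" "has_trace D w x m"
  shows "has_trace D (\<lambda>y. v y - w y) x (l - m)"
proof -
  have int: "integrable (lebesgue_on (D \<inter> ball x r)) u" if "u \<in> L2 D" for u :: "point \<Rightarrow> real" and r
  proof (rule L2_integrable)
    show "u \<in> L2 (D \<inter> ball x r)"
      by (rule L2_restrict[OF that]) (simp_all add: D(1) open_Int borel_open)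
    show "open (D \<inter> ball x r)" "bounded (D \<inter> ball x r)"
      using D by (simp_all add: open_Int bounded_Int)
  qed
  have "(LINT y|lebesgue_on (D \<inter> ball x r). v y - w y) / measure lebesgue (D \<inter> ball x r) =
      (LINT y|lebesgue_on (D \<inter> ball x r). v y) / measure lebesgue (D \<inter> ball x r) -
      (LINT y|lebesgue_on (D \<inter> ball x r). w y) / measure lebesgue (D \<inter> ball x r)" for r
    using int[OF L(1)] int[OF L(2)] by (simp add: diff_divide_distrib)
  then show ?thesis using t unfolding has_trace_def by (simp add: tendsto_diff)
qed

lemma trace_eqI: "has_trace D v x l \<Longrightarrow> trace D v x = l"
  unfolding trace_def has_trace_def
  by (rule the_equality) (auto intro: tendsto_unique[rotated])

lemma has_trace_continuous:
  assumes D: "open D" "bounded D" and v: "v \<in> L2 D" "continuous_on (closure D) v" and x: "x \<in> closure D"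
  shows "has_trace D v x (v x)"
  unfolding has_trace_def
proof (rule tendstoI)
  fix \<epsilon> :: real assume \<epsilon>: "0 < \<epsilon>"
  obtain \<delta> where \<delta>: "0 < \<delta>" "\<And>y. \<lbrakk>y \<in> closure D; dist y x < \<delta>\<rbrakk> \<Longrightarrow> dist (v y) (v x) < \<epsilon> / 2"
    using v(2) x \<epsilon> unfolding continuous_on_iff by (metis half_gt_zero)
  have "dist ((LINT y|lebesgue_on (D \<inter> ball x r). v y) / measure lebesgue (D \<inter> ball x r)) (v x) < \<epsilon>"
    if r: "0 < r" "r < \<delta>" for r
  proof -
    let ?A = "D \<inter> ball x r"
    have A: "open ?A" "bounded ?A" using D by (auto intro: open_Int bounded_Int)
    have ne: "?A \<noteq> {}" using x r(1) by (metis closure_approachable disjoint_iff dist_commute mem_ball)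
    have lm: "?A \<in> lmeasurable" using A by (simp add: bounded_set_imp_lmeasurable)
    have pos: "0 < measure lebesgue ?A"
    proof -
      have "\<not> negligible ?A" using A(1) ne by (rule open_not_negligible)
      then show ?thesis using lm by (simp add: negligible_iff_measure zero_less_measure_iff) 
    qed
    have fin: "finite_measure (lebesgue_on ?A)" using lm by (rule finite_measure_lebesgue_on)
    have int: "integrable (lebesgue_on ?A) v"
      using L2_restrict[OF v(1), of ?A] A D(1) by (intro L2_integrable) auto
    have c: "(LINT y|lebesgue_on ?A. c) = c * measure lebesgue ?A" for c :: real
      using lm by (simp add: lebesgue_integral_const space_restrict_space measure_restrict_space)
    have intc: "integrable (lebesgue_on ?A) (\<lambda>_. c)" for c :: real
      using fin by (rule finite_measure.integrable_const)
    define m where "m = measure lebesgue ?A"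
    define I where "I = (LINT y|lebesgue_on ?A. v y)"
    have "\<bar>I - v x * m\<bar> = \<bar>LINT y|lebesgue_on ?A. v y - v x\<bar>"
      unfolding Bochner_Integration.integral_diff[OF int intc] c I_def m_def ..
    also have "\<dots> \<le> (LINT y|lebesgue_on ?A. \<epsilon> / 2)"
    proof (rule integral_abs_bound_integral)
      show "integrable (lebesgue_on ?A) (\<lambda>y. v y - v x)"
        using int intc by (rule Bochner_Integration.integrable_diff)
      show "\<bar>v y - v x\<bar> \<le> \<epsilon> / 2" if "y \<in> space (lebesgue_on ?A)" for y
      proof -
        have "y \<in> closure D" "dist y x < \<delta>"
          using that r closure_subset[of D] by (auto simp: dist_commute)
        then show ?thesis using \<delta>(2)[of y] by (simp add: dist_real_def)
      qed
    qed (rule intc)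
    also have "\<dots> = \<epsilon> / 2 * m" unfolding m_def by (rule c)
    finally have "\<bar>I - v x * m\<bar> \<le> \<epsilon> / 2 * m" .
    moreover have m: "0 < m" using pos by (simp add: m_def)
    moreover have "I / m - v x = (I - v x * m) / m" using m by (simp add: field_simps)
    ultimately have "\<bar>I / m - v x\<bar> \<le> \<epsilon> / 2"
      by (simp add: pos_divide_le_eq)
    then show ?thesis using \<epsilon> by (simp add: dist_real_def I_def m_def)
  qed
  then show "\<forall>\<^sub>F r in at_right 0. dist ((LINT y|lebesgue_on (D \<inter> ball x r). v y) /
      measure lebesgue (D \<inter> ball x r)) (v x) < \<epsilon>"
    using \<delta>(1) unfolding eventually_at_right_field by blast
qed

lemma bdry_int_minus: "bdry_int E \<Gamma> (\<lambda>x. - g x) = - bdry_int E \<Gamma> g"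
  by (simp add: bdry_int_def edge_int_def sum_negf)

lemma bdry_int_0: "(\<And>x. x \<in> \<Gamma> \<Longrightarrow> g x = 0) \<Longrightarrow> bdry_int E \<Gamma> g = 0"
  unfolding bdry_int_def edge_int_def
proof (intro sum.neutral ballI)
  fix e :: edge assume g: "\<And>x. x \<in> \<Gamma> \<Longrightarrow> g x = 0"
  have "indicator \<Gamma> x * g x = 0" for x using g by (auto simp: indicator_def)
  then show "dist (fst e) (snd e) * (LINT t|lebesgue_on {0..1}.
      indicator \<Gamma> (linepath (fst e) (snd e) t) * g (linepath (fst e) (snd e) t)) = 0"
    unfolding \<open>\<And>x. indicator \<Gamma> x * g x = 0\<close> by simp
qed

text \<open>Makes compactly supported functions admissible in the primal problem, with no
  contribution from the Neumann boundary.\<close>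

lemma C1c_has_trace_0:
  assumes \<phi>: "C1c D \<phi> G" and x: "x \<notin> D"
  shows "has_trace D \<phi> x 0"
proof -
  have "x \<in> - closure {x. \<phi> x \<noteq> 0}" using assms by (auto simp: C1c_def)
  then obtain r where r: "0 < r" "ball x r \<subseteq> - closure {x. \<phi> x \<noteq> 0}"
    using open_contains_ball[of "- closure {x. \<phi> x \<noteq> 0}"] by auto
  have zero: "\<phi> y = 0" if "dist x y < r" for y
    using that r(2) closure_subset[of "{x. \<phi> x \<noteq> 0}"] by fastforce
  have "(LINT y|lebesgue_on (D \<inter> ball x s). \<phi> y) = 0" if "s < r" for s
  proof -
    have "(LINT y|lebesgue_on (D \<inter> ball x s). \<phi> y) = (LINT y|lebesgue_on (D \<inter> ball x s). 0)"
      by (rule Bochner_Integration.integral_cong) (use zero that in auto)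
    then show ?thesis by simp
  qed
  then have "\<forall>\<^sub>F s in at_right 0. (LINT y|lebesgue_on (D \<inter> ball x s). \<phi> y) /
      measure lebesgue (D \<inter> ball x s) = 0"
    using r(1) unfolding eventually_at_right_field by (intro exI[of _ r]) auto
  then show ?thesis unfolding has_trace_def by (rule tendsto_eventually)
qed

lemma weighted_ip_eq_0:
  fixes \<tau> :: "point \<Rightarrow> point" and w :: "point \<Rightarrow> real"
  assumes \<tau>: "\<tau> \<in> L2 D" "(\<lambda>x. w x *\<^sub>R \<tau> x) \<in> L2 D"
    and w: "AE x in lebesgue_on D. 0 < w x" and 0: "ip D (\<lambda>x. w x *\<^sub>R \<tau> x) \<tau> = 0"
  shows "AE x in lebesgue_on D. \<tau> x = 0"
proof -
  have "integrable (lebesgue_on D) (\<lambda>x. w x *\<^sub>R \<tau> x \<bullet> \<tau> x)"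
    using L2_integrable_inner[OF \<tau>(2,1)] .
  moreover have "AE x in lebesgue_on D. 0 \<le> w x *\<^sub>R \<tau> x \<bullet> \<tau> x"
    using w by eventually_elim simp
  ultimately have "AE x in lebesgue_on D. w x *\<^sub>R \<tau> x \<bullet> \<tau> x = 0"
    using 0 integral_nonneg_eq_0_iff_AE unfolding ip_def by blast
  with w show ?thesis by eventually_elim simp
qed

lemma coefficient_L2:
  assumes "coefficient \<Omega> \<kappa>" "v \<in> L2 \<Omega>"
  shows "(\<lambda>x. \<kappa> x *\<^sub>R v x) \<in> L2 \<Omega>" "(\<lambda>x. inverse (\<kappa> x) *\<^sub>R v x) \<in> L2 \<Omega>"
    "AE x in lebesgue_on \<Omega>. 0 < \<kappa> x"
proof -
  obtain k K where k: "0 < k" "AE x in lebesgue_on \<Omega>. k \<le> \<kappa> x \<and> \<kappa> x \<le> K"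
    and m: "\<kappa> \<in> borel_measurable (lebesgue_on \<Omega>)"
    using assms(1) unfolding coefficient_def by blast
  show "(\<lambda>x. \<kappa> x *\<^sub>R v x) \<in> L2 \<Omega>"
  proof (rule L2_mult_bounded[OF assms(2) m])
    show "AE x in lebesgue_on \<Omega>. \<bar>\<kappa> x\<bar> \<le> K"
      using k(2) by eventually_elim (use k(1) in auto)
  qed
  show "(\<lambda>x. inverse (\<kappa> x) *\<^sub>R v x) \<in> L2 \<Omega>"
  proof (rule L2_mult_bounded[OF assms(2)])
    show "(\<lambda>x. inverse (\<kappa> x)) \<in> borel_measurable (lebesgue_on \<Omega>)" using m by measurable
    show "AE x in lebesgue_on \<Omega>. \<bar>inverse (\<kappa> x)\<bar> \<le> inverse k"
      using k(2) by eventually_elim (use k(1) in \<open>simp add: le_imp_inverse_le\<close>)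
  qed
  show "AE x in lebesgue_on \<Omega>. 0 < \<kappa> x"
    using k(2) by eventually_elim (use k(1) in auto)
qed

text \<open>The difference of the mixed flux \<open>\<sigma>\<close> and of \<open>- \<kappa> \<nabla>ut\<close> is divergence free and has zero
  normal component on the Neumann boundary; testing the mixed problem with it shows that its
  energy vanishes.\<close>

lemma mixed_flux_eq:
  assumes \<Omega>: "open \<Omega>" "bounded \<Omega>"
    and \<Gamma>: "frontier \<Omega> = \<Gamma>D \<union> \<Gamma>N" "\<Gamma>D \<inter> \<Gamma>N = {}"
    and \<kappa>: "coefficient \<Omega> \<kappa>" and f: "f \<in> L2 \<Omega>"
    and primal: "primal_solution \<Omega> E \<Gamma>D \<Gamma>N \<kappa> f gD gN ut"
    and mixed: "mixed_solution \<Omega> E \<Gamma>D \<Gamma>N \<kappa> f gD gN \<sigma> u"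
  shows "AE x in lebesgue_on \<Omega>. \<sigma> x = - (\<kappa> x *\<^sub>R wgrad \<Omega> ut x)"
proof -
  define g where "g = wgrad \<Omega> ut"
  have ut: "ut \<in> H1 \<Omega>" and ut_tr: "trace_eq \<Omega> E \<Gamma>D ut gD"
    and weak: "\<And>v. \<lbrakk>v \<in> H1 \<Omega>; trace_eq \<Omega> E \<Gamma>D v (\<lambda>_. 0)\<rbrakk> \<Longrightarrow>
      ip \<Omega> (\<lambda>x. \<kappa> x *\<^sub>R g x) (wgrad \<Omega> v) = ip \<Omega> f v + bdry_int E \<Gamma>N (\<lambda>x. gN x * trace \<Omega> v x)"
    using primal unfolding primal_solution_def g_def by blast+
  have \<sigma>: "\<sigma> \<in> Hdiv \<Omega>" and \<sigma>N: "normal_eq \<Omega> E \<Gamma>N \<sigma> (\<lambda>x. - gN x)" and u: "u \<in> L2 \<Omega>"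
    and flux: "\<And>\<tau>. \<lbrakk>\<tau> \<in> Hdiv \<Omega>; normal_eq \<Omega> E \<Gamma>N \<tau> (\<lambda>_. 0)\<rbrakk> \<Longrightarrow>
      form_a \<Omega> \<kappa> \<sigma> \<tau> + form_b \<Omega> \<tau> u = - dirichlet_pairing \<Omega> E \<Gamma>D gD \<tau>"
    and balance: "\<And>v. v \<in> L2 \<Omega> \<Longrightarrow> form_b \<Omega> \<sigma> v = - ip \<Omega> f v"
    using mixed unfolding mixed_solution_def by blast+
  have g: "g \<in> L2 \<Omega>" unfolding g_def by (rule wgrad[OF ut])
  note \<kappa>g = coefficient_L2[OF \<kappa> g]
  have \<Gamma>D: "frontier \<Omega> - \<Gamma>N = \<Gamma>D" using \<Gamma> by blast
  have not_in: "x \<notin> \<Omega>" if "x \<in> \<Gamma>D \<union> \<Gamma>N" for x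
    using that \<Gamma>(1) \<Omega>(1) frontier_disjoint_eq by blast
  define \<sigma>' where "\<sigma>' = (\<lambda>x. - (\<kappa> x *\<^sub>R g x))"
  have \<sigma>'_L2: "\<sigma>' \<in> L2 \<Omega>" unfolding \<sigma>'_def using \<kappa>g(1) by (rule L2_minus)
  \<comment> \<open>Testing the primal problem with compactly supported functions yields the strong
    equation for the divergence of \<open>\<sigma>'\<close>.\<close>
  have div: "has_weak_div \<Omega> \<sigma>' f"
    unfolding has_weak_div_def
  proof (intro allI impI)
    fix \<phi> G assume \<phi>: "C1c \<Omega> \<phi> G"
    note w = C1_wgrad[OF \<Omega>, of \<phi> G]
    have C1: "C1 \<phi> G" using \<phi> by (simp add: C1c_def)
    have tr0: "trace \<Omega> \<phi> x = 0" if "x \<in> \<Gamma>N" for x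
      using C1c_has_trace_0[OF \<phi>] not_in that by (intro trace_eqI) auto
    have "trace_eq \<Omega> E \<Gamma>D \<phi> (\<lambda>_. 0)"
      unfolding trace_eq_def using C1c_has_trace_0[OF \<phi>] not_in by (auto intro!: AE_I2)
    then have "ip \<Omega> (\<lambda>x. \<kappa> x *\<^sub>R g x) (wgrad \<Omega> \<phi>) = ip \<Omega> f \<phi>"
      using weak[OF w(1)[OF C1]] bdry_int_0[of \<Gamma>N "\<lambda>x. gN x * trace \<Omega> \<phi> x" E] tr0 by simp
    moreover have "ip \<Omega> (\<lambda>x. \<kappa> x *\<^sub>R g x) (wgrad \<Omega> \<phi>) = ip \<Omega> (\<lambda>x. \<kappa> x *\<^sub>R g x) G"
      using w(2)[OF C1] wgrad(1)[OF w(1)[OF C1]] C1_L2(2)[OF C1 \<Omega>] \<kappa>g(1) by (intro ip_cong_AE) auto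
    ultimately show "ip \<Omega> \<sigma>' G = - ip \<Omega> f \<phi>" by (simp add: \<sigma>'_def ip_minus_left)
  qed
  note wdiv' = wdiv_eq_AE[OF \<Omega> \<sigma>'_L2 f div]
  have wdiv_\<sigma>: "AE x in lebesgue_on \<Omega>. wdiv \<Omega> \<sigma> x = f x"
  proof -
    have d: "wdiv \<Omega> \<sigma> \<in> L2 \<Omega>" by (rule wdiv[OF \<sigma>])
    have "ip \<Omega> (\<lambda>x. wdiv \<Omega> \<sigma> x - f x) (\<lambda>x. wdiv \<Omega> \<sigma> x - f x) = 0"
      using balance[OF L2_diff[OF d f]] ip_diff_left[OF d f L2_diff[OF d f]] by (simp add: form_b_def)
    then have "AE x in lebesgue_on \<Omega>. wdiv \<Omega> \<sigma> x - f x = 0"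
      by (rule ip_self_eq_0[OF L2_diff[OF d f]])
    then show ?thesis by simp
  qed
  define \<tau> where "\<tau> = (\<lambda>x. \<sigma> x - \<sigma>' x)"
  note \<tau>_div = wdiv_diff[OF \<Omega> \<sigma> wdiv'(1), folded \<tau>_def]
  have \<tau>_L2: "\<tau> \<in> L2 \<Omega>" using \<tau>_div(1) by (rule Hdiv_L2)
  have wdiv_\<tau>: "AE x in lebesgue_on \<Omega>. wdiv \<Omega> \<tau> x = 0"
    using \<tau>_div(2) wdiv_\<sigma> wdiv'(2) by eventually_elim simp
  have b0: "ip \<Omega> (wdiv \<Omega> \<tau>) v = 0" if "v \<in> L2 \<Omega>" for v
  proof -
    have "ip \<Omega> (wdiv \<Omega> \<tau>) v = ip \<Omega> (\<lambda>_. 0) v"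
      using wdiv[OF \<tau>_div(1)] that wdiv_\<tau> by (intro ip_cong_AE) (auto intro: L2_0)
    then show ?thesis by (simp add: ip_0_left)
  qed
  \<comment> \<open>The load terms of the two problems cancel, and so do the Neumann terms. This
    orthogonality is the weak form of a vanishing normal component and is used a second time for the
    Dirichlet pairing.\<close>
  have orth: "ip \<Omega> \<tau> (wgrad \<Omega> v) = 0" if v: "v \<in> H1 \<Omega>" "trace_eq \<Omega> E \<Gamma>D v (\<lambda>_. 0)" for v
  proof -
    note L = H1_L2[OF v(1)] wgrad(1)[OF v(1)]
    have "ip \<Omega> (wdiv \<Omega> \<sigma>) v = ip \<Omega> f v"
      using wdiv[OF \<sigma>] f wdiv_\<sigma> L by (intro ip_cong_AE) auto
    then have "ip \<Omega> \<sigma> (wgrad \<Omega> v) = - bdry_int E \<Gamma>N (\<lambda>x. gN x * trace \<Omega> v x) - ip \<Omega> f v"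
      using \<sigma>N v unfolding normal_eq_def \<Gamma>D normal_pairing_def
      by (auto simp: bdry_int_minus)
    moreover have "ip \<Omega> \<sigma>' (wgrad \<Omega> v) = - bdry_int E \<Gamma>N (\<lambda>x. gN x * trace \<Omega> v x) - ip \<Omega> f v"
      using weak[OF v] by (simp add: \<sigma>'_def ip_minus_left)
    ultimately show ?thesis
      using Hdiv_L2[OF \<sigma>] \<sigma>'_L2 L by (simp add: \<tau>_def ip_diff_left)
  qed
  have "normal_eq \<Omega> E \<Gamma>N \<tau> (\<lambda>_. 0)"
    unfolding normal_eq_def \<Gamma>D normal_pairing_def
    using orth b0 H1_L2 by (auto simp: bdry_int_0)
  then have test: "ip \<Omega> (\<lambda>x. inverse (\<kappa> x) *\<^sub>R \<sigma> x) \<tau> = - dirichlet_pairing \<Omega> E \<Gamma>D gD \<tau>"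
    using flux[OF \<tau>_div(1)] b0[OF u] by (simp add: form_a_def form_b_def)
  \<comment> \<open>The lifting chosen in \<open>dirichlet_pairing\<close> need not be
    \<open>ut\<close>, but it differs from \<open>ut\<close> by a function with zero trace on the
    Dirichlet boundary, and \<open>\<tau>\<close> is orthogonal to the gradient of that
    difference.\<close>
  define w where "w = (SOME w. w \<in> H1 \<Omega> \<and> trace_eq \<Omega> E \<Gamma>D w gD)"
  have w: "w \<in> H1 \<Omega>" "trace_eq \<Omega> E \<Gamma>D w gD"
    using someI[of "\<lambda>w. w \<in> H1 \<Omega> \<and> trace_eq \<Omega> E \<Gamma>D w gD" ut] ut ut_tr by (auto simp: w_def)
  have "trace_eq \<Omega> E \<Gamma>D (\<lambda>x. w x - ut x) (\<lambda>_. 0)"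
    unfolding trace_eq_def
  proof
    fix e assume e: "e \<in> E"
    let ?l = "linepath (fst e) (snd e)"
    have "AE t in lebesgue_on {0..1}. ?l t \<in> \<Gamma>D \<longrightarrow> has_trace \<Omega> w (?l t) (gD (?l t))"
      "AE t in lebesgue_on {0..1}. ?l t \<in> \<Gamma>D \<longrightarrow> has_trace \<Omega> ut (?l t) (gD (?l t))"
      using w(2) ut_tr e unfolding trace_eq_def by blast+
    then show "AE t in lebesgue_on {0..1}. ?l t \<in> \<Gamma>D \<longrightarrow> has_trace \<Omega> (\<lambda>x. w x - ut x) (?l t) 0"
      by eventually_elim (use has_trace_diff[OF \<Omega> H1_L2[OF w(1)] H1_L2[OF ut]] in fastforce)
  qed
  note diff = wgrad_diff[OF \<Omega> w(1) ut]
  have "ip \<Omega> \<tau> (\<lambda>x. wgrad \<Omega> w x - g x) = ip \<Omega> \<tau> (wgrad \<Omega> (\<lambda>x. w x - ut x))"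
    using diff(2) \<tau>_L2 wgrad(1)[OF w(1)] g wgrad(1)[OF diff(1)]
    by (intro ip_cong_AE L2_diff) (auto simp: g_def)
  also have "\<dots> = 0" using orth[OF diff(1)] \<open>trace_eq \<Omega> E \<Gamma>D (\<lambda>x. w x - ut x) (\<lambda>_. 0)\<close> .
  finally have "ip \<Omega> \<tau> (wgrad \<Omega> w) = ip \<Omega> \<tau> g"
    using \<tau>_L2 wgrad(1)[OF w(1)] g by (simp add: ip_diff_right)
  then have "dirichlet_pairing \<Omega> E \<Gamma>D gD \<tau> = ip \<Omega> \<tau> g"
    unfolding dirichlet_pairing_def w_def[symmetric] normal_pairing_def
    using b0[OF H1_L2[OF w(1)]] by simp
  then have a\<sigma>: "ip \<Omega> (\<lambda>x. inverse (\<kappa> x) *\<^sub>R \<sigma> x) \<tau> = - ip \<Omega> g \<tau>"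
    using test by (simp add: ip_commute)
  note i = coefficient_L2(2)[OF \<kappa> Hdiv_L2[OF \<sigma>]] coefficient_L2(2)[OF \<kappa> \<sigma>'_L2]
    coefficient_L2(2)[OF \<kappa> \<tau>_L2]
  have "ip \<Omega> (\<lambda>x. inverse (\<kappa> x) *\<^sub>R \<sigma>' x) \<tau> = ip \<Omega> (\<lambda>x. - g x) \<tau>"
  proof (rule ip_cong_AE)
    show "AE x in lebesgue_on \<Omega>. inverse (\<kappa> x) *\<^sub>R \<sigma>' x = - g x"
      using \<kappa>g(3) by eventually_elim (simp add: \<sigma>'_def)
  qed (use i \<tau>_L2 L2_minus[OF g] in auto)
  then have "ip \<Omega> (\<lambda>x. inverse (\<kappa> x) *\<^sub>R \<tau> x) \<tau> = 0"
    using a\<sigma> i \<tau>_L2 by (simp add: \<tau>_def scaleR_diff_right ip_diff_left ip_minus_left)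
  moreover have "AE x in lebesgue_on \<Omega>. 0 < inverse (\<kappa> x)"
    using \<kappa>g(3) by eventually_elim simp
  ultimately have "AE x in lebesgue_on \<Omega>. \<tau> x = 0"
    using weighted_ip_eq_0[OF \<tau>_L2 i(3)] by blast
  then show ?thesis by eventually_elim (simp add: \<tau>_def \<sigma>'_def g_def eq_neg_iff_add_eq_0)
qed

section \<open>The local projections\<close>

lemma edge_int_cong: "(\<And>x. x \<in> seg e \<Longrightarrow> g x = h x) \<Longrightarrow> edge_int e g = edge_int e h"
  unfolding edge_int_def
  by (intro arg_cong2[where f = "(*)"] refl Bochner_Integration.integral_cong)
    (auto simp: seg_def linepath_in_path)

lemma integrable_linepath:
  assumes "continuous_on (seg e) g"
  shows "integrable (lebesgue_on {0..1}) (\<lambda>t. g (linepath (fst e) (snd e) t) :: real)"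
proof -
  have "continuous_on {0..1} (\<lambda>t. g (linepath (fst e) (snd e) t))"
    by (rule continuous_on_compose2[OF assms])
      (auto simp: seg_def linepath_in_path intro: continuous_intros)
  then show ?thesis by (rule continuous_imp_integrable_real)
qed

lemma edge_int_diff:
  assumes "continuous_on (seg e) g" "continuous_on (seg e) h"
  shows "edge_int e (\<lambda>x. g x - h x) = edge_int e g - edge_int e h"
  unfolding edge_int_def
  using integrable_linepath[OF assms(1)] integrable_linepath[OF assms(2)] by (simp add: right_diff_distrib)

lemma edge_int_add:
  assumes "continuous_on (seg e) g" "continuous_on (seg e) h"
  shows "edge_int e (\<lambda>x. g x + h x) = edge_int e g + edge_int e h"
  unfolding edge_int_def
  using integrable_linepath[OF assms(1)] integrable_linepath[OF assms(2)] by (simp add: distrib_left)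

lemma edge_int_scale: "edge_int e (\<lambda>x. c * g x) = c * edge_int e g"
  by (simp add: edge_int_def)

lemma edge_int_const: "edge_int e (\<lambda>_. c) = c * dist (fst e) (snd e)"
  by (simp add: edge_int_def measure_restrict_space)

text \<open>If \<open>g\<close> is not integrable along an edge, then the edge integral is \<open>0\<close> for every shift.\<close>

lemma shift_sum_edge_int:
  assumes "finite E"
  obtains c where "(\<Sum>e\<in>E. edge_int e (\<lambda>x. g x - c)) = 0"
proof -
  define h where "h = (\<lambda>e t. g (linepath (fst e) (snd e) t))"
  define F where "F = {e \<in> E. integrable (lebesgue_on {0..1}) (h e)}"
  define len where "len = (\<lambda>e::edge. dist (fst e) (snd e))"
  have F: "finite F" "F \<subseteq> E" using assms by (auto simp: F_def)
  have ei: "edge_int e (\<lambda>x. g x - c) = len e * (LINT t|lebesgue_on {0..1}. h e t - c)" for e c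
    by (simp add: edge_int_def h_def len_def)
  have const: "integrable (lebesgue_on {0..1::real}) (\<lambda>_. c :: real)" for c
    by (rule finite_measure.integrable_const) (simp add: finite_measure_lebesgue_on)
  have out: "edge_int e (\<lambda>x. g x - c) = 0" if "e \<in> E - F" for e c
  proof -
    have "\<not> integrable (lebesgue_on {0..1}) (\<lambda>t. h e t - c)"
    proof
      assume "integrable (lebesgue_on {0..1}) (\<lambda>t. h e t - c)"
      from Bochner_Integration.integrable_add[OF this const[of c]] show False using that by (simp add: F_def)
    qed
    then show ?thesis by (simp add: ei not_integrable_integral_eq)
  qed
  have ins: "edge_int e (\<lambda>x. g x - c) = edge_int e g - c * len e" if "e \<in> F" for e c
  proof -
    have "integrable (lebesgue_on {0..1}) (h e)" using that by (simp add: F_def)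
    then show ?thesis
      using const[of c] ei[of e 0]
      by (simp add: ei right_diff_distrib measure_restrict_space)
  qed
  have sum: "(\<Sum>e\<in>E. edge_int e (\<lambda>x. g x - c)) = (\<Sum>e\<in>F. edge_int e g) - c * (\<Sum>e\<in>F. len e)" for c
  proof -
    have "(\<Sum>e\<in>E. edge_int e (\<lambda>x. g x - c)) = (\<Sum>e\<in>F. edge_int e (\<lambda>x. g x - c))"
      using assms F out by (intro sum.mono_neutral_right) auto
    also have "\<dots> = (\<Sum>e\<in>F. edge_int e g - c * len e)" by (intro sum.cong refl ins)
    finally show ?thesis by (simp add: sum_subtractf sum_distrib_left)
  qed
  show ?thesis
  proof (cases "(\<Sum>e\<in>F. len e) = 0")
    case True
    then have "\<forall>e\<in>F. len e = 0" using F(1) by (subst (asm) sum_nonneg_eq_0_iff) (auto simp: len_def)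
    then have "(\<Sum>e\<in>F. edge_int e g) = 0" by (intro sum.neutral) (simp add: edge_int_def len_def)
    then show ?thesis using that[of 0] sum[of 0] by simp
  next
    case False
    then show ?thesis using that sum[of "(\<Sum>e\<in>F. edge_int e g) / (\<Sum>e\<in>F. len e)"] by simp
  qed
qed

text \<open>Source of the factors 2. Here \<open>v\<close> is the discrete and \<open>g\<close> the
  exact field, \<open>P\<close> and \<open>Q\<close> are their projections. Both projection
  residuals are orthogonal to \<open>P - Q\<close>; this removes the mixed terms with
  \<open>d\<close>, and only the product of \<open>a\<close> and \<open>e\<close> remains to be
  estimated.\<close>

lemma projection_error:
  assumes L: "v \<in> L2 D" "g \<in> L2 D" "P \<in> L2 D" "Q \<in> L2 D"
    and orth: "ip D (\<lambda>x. v x - P x) (\<lambda>x. P x - Q x) = 0" "ip D (\<lambda>x. g x - Q x) (\<lambda>x. P x - Q x) = 0"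
  defines "A \<equiv> ip D (\<lambda>x. g x - v x) (\<lambda>x. g x - v x)" and "B \<equiv> ip D (\<lambda>x. g x - Q x) (\<lambda>x. g x - Q x)"
  shows "ip D (\<lambda>x. v x - P x) (\<lambda>x. v x - P x) \<le> 2 * A + 2 * B"
    "ip D (\<lambda>x. P x - g x) (\<lambda>x. P x - g x) \<le> 2 * A + 2 * B"
proof -
  define a d e where "a = (\<lambda>x. v x - P x)" and "d = (\<lambda>x. P x - Q x)" and "e = (\<lambda>x. g x - Q x)"
  have ade: "a \<in> L2 D" "d \<in> L2 D" "e \<in> L2 D" using L by (auto simp: a_def d_def e_def intro: L2_diff)
  note L' = ade L2_diff[OF ade(3,2)] L2_diff[OF ade(2,3)] L2_diff[OF L2_diff[OF ade(3,2)] ade(1)]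
    L2_scaleR[OF ade(3), of 2] L2_diff[OF ade(1) L2_scaleR[OF ade(3), of 2]] L2_diff[OF ade(1,3)]
  have 0: "ip D a d = 0" "ip D d a = 0" "ip D e d = 0" "ip D d e = 0"
    using orth by (simp_all add: a_def d_def e_def ip_commute)
  have "(\<lambda>x. g x - v x) = (\<lambda>x. e x - d x - a x)" by (simp add: a_def d_def e_def)
  then have A: "A = ip D e e + ip D d d + ip D a a - 2 * ip D a e"
    unfolding A_def using L' by (simp add: ip_diff_left ip_diff_right 0 ip_commute[of D e a])
  have B: "B = ip D e e" by (simp add: B_def e_def)
  have "(\<lambda>x. P x - g x) = (\<lambda>x. d x - e x)" by (simp add: d_def e_def)
  then have Pg: "ip D (\<lambda>x. P x - g x) (\<lambda>x. P x - g x) = ip D d d + ip D e e"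
    using L' by (simp add: ip_diff_left ip_diff_right 0)
  \<comment> \<open>The squares are exact remainders: \<open>2 * A + 2 * B\<close> exceeds the
    energy of \<open>a\<close> by that of \<open>a - 2 e\<close> plus twice that of
    \<open>d\<close>, and it exceeds the energy of \<open>P - g\<close> by twice that of
    \<open>a - e\<close> plus those of \<open>d\<close> and \<open>e\<close>.\<close>
  have "0 \<le> ip D (\<lambda>x. a x - 2 *\<^sub>R e x) (\<lambda>x. a x - 2 *\<^sub>R e x)" by (rule ip_self_nonneg)
  then have 1: "0 \<le> ip D a a - 4 * ip D a e + 4 * ip D e e"
    using L' by (simp add: ip_diff_left ip_diff_right ip_scaleR_left ip_scaleR_right ip_commute[of D e a])
  have "0 \<le> ip D (\<lambda>x. a x - e x) (\<lambda>x. a x - e x)" by (rule ip_self_nonneg)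
  then have 2: "0 \<le> ip D a a - 2 * ip D a e + ip D e e"
    using L' by (simp add: ip_diff_left ip_diff_right ip_commute[of D e a])
  have nn: "0 \<le> ip D d d" "0 \<le> ip D e e" by (rule ip_self_nonneg)+
  show "ip D (\<lambda>x. v x - P x) (\<lambda>x. v x - P x) \<le> 2 * A + 2 * B"
    using 1 nn by (simp add: A B flip: a_def)
  show "ip D (\<lambda>x. P x - g x) (\<lambda>x. P x - g x) \<le> 2 * A + 2 * B"
    unfolding Pg using 2 nn by (simp add: A B)
qed

text \<open>A coefficient that is constant on the element turns both weighted projections into plain
  L2 projections onto gradients of polynomials, so one estimate serves the primal and the mixed
  method.\<close>

locale polygonal_element =
  fixes K :: polygon and \<kappa> :: "point \<Rightarrow> real" and k :: real and p :: nat
  assumes simple: "simple_polygon K"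
    and k_pos: "0 < k" and \<kappa>_eq: "\<And>x. x \<in> region K \<Longrightarrow> \<kappa> x = k"
begin

abbreviation "D \<equiv> region K"

lemmas region_open = region_facts(1)[OF simple]
lemmas region_bounded = region_facts(2)[OF simple]
lemmas region_nonempty = region_facts(3)[OF simple]
lemmas region = region_open region_bounded

lemma seg_closure: "e \<in> edges K \<Longrightarrow> seg e \<subseteq> closure D"
  using region_facts(4)[OF simple] by (auto simp: frontier_def)

section \<open>Weighted forms and the primal projection on one element\<close>

lemma ip_scale_coefficient: "ip D (\<lambda>x. \<kappa> x *\<^sub>R v x) w = k * ip D v w"
proof -
  have "ip D (\<lambda>x. \<kappa> x *\<^sub>R v x) w = ip D (\<lambda>x. k *\<^sub>R v x) w"
    unfolding ip_def by (rule Bochner_Integration.integral_cong) (auto simp: \<kappa>_eq)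
  then show ?thesis by (simp add: ip_scaleR_left)
qed

lemma form_a_eq: "form_a D \<kappa> v w = inverse k * ip D v w"
proof -
  have "form_a D \<kappa> v w = ip D (\<lambda>x. inverse k *\<^sub>R v x) w"
    unfolding form_a_def ip_def by (rule Bochner_Integration.integral_cong) (auto simp: \<kappa>_eq)
  then show ?thesis by (simp add: ip_scaleR_left)
qed

lemma energy_norm_sq: "(energy_norm \<kappa> K v)\<^sup>2 = k * ip D (wgrad D v) (wgrad D v)"
proof -
  have "(energy_norm \<kappa> K v)\<^sup>2 = ip D (\<lambda>x. sqrt k *\<^sub>R wgrad D v x) (\<lambda>x. sqrt k *\<^sub>R wgrad D v x)"
    unfolding energy_norm_def L2norm_sq ip_def
    by (rule Bochner_Integration.integral_cong) (auto simp: \<kappa>_eq)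
  then show ?thesis using k_pos by (simp add: ip_scaleR_left ip_scaleR_right flip: mult.assoc)
qed

lemma flux_norm_sq: "(flux_norm \<kappa> K \<tau>)\<^sup>2 = inverse k * ip D \<tau> \<tau>"
proof -
  have "(flux_norm \<kappa> K \<tau>)\<^sup>2 = ip D (\<lambda>x. inverse (sqrt k) *\<^sub>R \<tau> x) (\<lambda>x. inverse (sqrt k) *\<^sub>R \<tau> x)"
    unfolding flux_norm_def L2norm_sq ip_def
    by (rule Bochner_Integration.integral_cong) (auto simp: \<kappa>_eq)
  then show ?thesis
    using k_pos by (simp add: ip_scaleR_left ip_scaleR_right flip: mult.assoc inverse_mult_distrib)
qed

lemma wgrad_diff_Pol:
  assumes v: "v \<in> H1 D" and q: "C1 q R"
  shows "(\<lambda>x. v x - q x) \<in> H1 D" "AE x in lebesgue_on D. wgrad D (\<lambda>x. v x - q x) x = wgrad D v x - R x"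
proof -
  note * = wgrad_diff[OF region v C1_wgrad(1)[OF region q]]
  show "(\<lambda>x. v x - q x) \<in> H1 D" by (rule *(1))
  show "AE x in lebesgue_on D. wgrad D (\<lambda>x. v x - q x) x = wgrad D v x - R x"
    using *(2) C1_wgrad(2)[OF region q] by eventually_elim simp
qed

text \<open>Replaces the chosen weak gradients of polynomials by classical ones and drops the
  constant weight, so that the projection lemmas apply.\<close>

lemma is_Pi_nabla_iff:
  assumes v: "v \<in> H1 D" and q: "C1 q R"
  shows "is_Pi_nabla \<kappa> p K v q \<longleftrightarrow> q \<in> Pol (int p) \<and>
      (\<forall>r S. r \<in> Pol (int p) \<longrightarrow> C1 r S \<longrightarrow> ip D (\<lambda>x. wgrad D v x - R x) S = 0) \<and>
      (\<Sum>e\<in>edges K. edge_int e (\<lambda>x. trace D v x - q x)) = 0"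
proof -
  note w = wgrad_diff_Pol[OF v q]
  have L: "(\<lambda>x. wgrad D v x - R x) \<in> L2 D"
    using wgrad(1)[OF v] C1_L2(2)[OF q region] by (rule L2_diff)
  have eq: "ip D (\<lambda>x. \<kappa> x *\<^sub>R wgrad D (\<lambda>y. v y - q y) x) (wgrad D r) = k * ip D (\<lambda>x. wgrad D v x - R x) S"
    if "C1 r S" for r S
  proof -
    have "ip D (wgrad D (\<lambda>y. v y - q y)) (wgrad D r) = ip D (\<lambda>x. wgrad D v x - R x) S"
      using wgrad(1)[OF w(1)] L wgrad(1)[OF C1_wgrad(1)[OF region that]] C1_L2(2)[OF that region]
        w(2) C1_wgrad(2)[OF region that] by (rule ip_cong_AE)
    then show ?thesis by (simp add: ip_scale_coefficient)
  qed
  have "(\<forall>r\<in>Pol (int p). ip D (\<lambda>x. \<kappa> x *\<^sub>R wgrad D (\<lambda>y. v y - q y) x) (wgrad D r) = 0) \<longleftrightarrow>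
      (\<forall>r S. r \<in> Pol (int p) \<longrightarrow> C1 r S \<longrightarrow> ip D (\<lambda>x. wgrad D v x - R x) S = 0)" (is "?l \<longleftrightarrow> ?r")
  proof
    assume ?l
    then show ?r using eq k_pos by fastforce
  next
    assume r: ?r
    show ?l
    proof
      fix r assume "r \<in> Pol (int p)"
      moreover from this obtain S where "C1 r S" by (rule Pol_C1)
      ultimately show "ip D (\<lambda>x. \<kappa> x *\<^sub>R wgrad D (\<lambda>y. v y - q y) x) (wgrad D r) = 0"
        using r eq by simp
    qed
  qed
  then show ?thesis unfolding is_Pi_nabla_def by blast
qed

text \<open>The gradient condition fixes the polynomial up to a constant, which is then shifted to
  meet the boundary condition. For a general H1 function the trace is not known here to be
  integrable along the edges, and the shift lemma covers that case too.\<close>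

lemma Pi_nabla:
  assumes v: "v \<in> H1 D"
  shows "is_Pi_nabla \<kappa> p K v (Pi_nabla \<kappa> p K v)"
proof -
  obtain q R where q: "q \<in> Pol (int p)" "C1 q R"
    "\<And>r S. \<lbrakk>r \<in> Pol (int p); C1 r S\<rbrakk> \<Longrightarrow> ip D (\<lambda>x. wgrad D v x - R x) S = 0"
    using Pol_grad_projection[OF region wgrad(1)[OF v], of "int p"] by metis
  obtain c where c: "(\<Sum>e\<in>edges K. edge_int e (\<lambda>x. (trace D v x - q x) - c)) = 0"
    using finite_edges by (rule shift_sum_edge_int)
  have C1: "C1 (\<lambda>x. q x + c) R" using C1_add[OF q(2) C1_const[of c]] by simp
  have "(\<lambda>x. q x + c) \<in> Pol (int p)" using q(1) Pol_const[of "int p" c] by (intro Pol_add) auto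
  then have "is_Pi_nabla \<kappa> p K v (\<lambda>x. q x + c)"
    using q(3) c by (simp add: is_Pi_nabla_iff[OF v C1] diff_diff_eq)
  then show ?thesis unfolding Pi_nabla_def by (rule someI[of "is_Pi_nabla \<kappa> p K v"])
qed

lemma perimeter_pos: "0 < (\<Sum>e\<in>edges K. dist (fst e) (snd e))"
proof (rule sum_pos)
  show "finite (edges K)" by (rule finite_edges)
  show "edges K \<noteq> {}" using length_polygon[OF simple] by (auto simp: edges_eq lessThan_empty_iff)
  show "0 < dist (fst e) (snd e)" if "e \<in> edges K" for e
    using that edge_nondegenerate[OF simple] by (auto simp: edges_eq)
qed

lemma trace_continuous:
  assumes "v \<in> H1 D" "continuous_on (closure D) v" "e \<in> edges K" "x \<in> seg e"
  shows "trace D v x = v x"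
  using subsetD[OF seg_closure[OF assms(3)] assms(4)]
  by (intro trace_eqI has_trace_continuous[OF region H1_L2[OF assms(1)] assms(2)])

text \<open>Two solutions differ by a constant \<open>c\<close>, and their boundary conditions
  differ by \<open>c\<close> times the perimeter. Continuity up to the boundary makes the edge
  integrals additive.\<close>

lemma is_Pi_nabla_unique:
  assumes v: "v \<in> H1 D" "continuous_on (closure D) v"
    and q: "is_Pi_nabla \<kappa> p K v q" and r: "is_Pi_nabla \<kappa> p K v r"
  shows "q = r"
proof -
  have qP: "q \<in> Pol (int p)" and rP: "r \<in> Pol (int p)" using q r by (auto simp: is_Pi_nabla_def)
  obtain R S where R: "C1 q R" and S: "C1 r S" using Pol_C1[OF qP] Pol_C1[OF rP] by metis
  define d where "d = (\<lambda>x. q x - r x)"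
  define H where "H = (\<lambda>x. R x - S x)"
  have d: "d \<in> Pol (int p)" "C1 d H" unfolding d_def H_def using qP rP R S by (auto intro: Pol_diff C1_diff)
  have L: "wgrad D v \<in> L2 D" "R \<in> L2 D" "S \<in> L2 D" "H \<in> L2 D"
    using wgrad(1)[OF v(1)] C1_L2(2)[OF R region] C1_L2(2)[OF S region] C1_L2(2)[OF d(2) region] by auto
  have "ip D (\<lambda>x. wgrad D v x - R x) H = 0" "ip D (\<lambda>x. wgrad D v x - S x) H = 0"
    using q r d by (simp_all add: is_Pi_nabla_iff[OF v(1) R] is_Pi_nabla_iff[OF v(1) S])
  then have "ip D H H = 0" using L by (simp add: ip_diff_left) (simp add: H_def ip_diff_left L)
  then have "AE x in lebesgue_on D. H x = 0" by (rule ip_self_eq_0[OF L(4)])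
  then obtain c where c: "d = (\<lambda>_. c)" using Pol_grad_eq_0(2)[OF d region_open region_nonempty] by blast
  have cont: "continuous_on (seg e) (\<lambda>x. v x - q x)" if "e \<in> edges K" for e
    using continuous_on_subset[OF v(2) seg_closure[OF that]] C1_continuous[OF R] by (rule continuous_on_diff)
  have "(\<Sum>e\<in>edges K. edge_int e (\<lambda>x. trace D v x - q x)) = (\<Sum>e\<in>edges K. edge_int e (\<lambda>x. v x - q x))"
    by (intro sum.cong refl edge_int_cong) (simp add: trace_continuous[OF v])
  moreover have "(\<Sum>e\<in>edges K. edge_int e (\<lambda>x. trace D v x - r x)) =
      (\<Sum>e\<in>edges K. edge_int e (\<lambda>x. v x - q x) + c * dist (fst e) (snd e))"
  proof (intro sum.cong refl)
    fix e assume e: "e \<in> edges K"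
    have "v x - r x = (v x - q x) + c" for x using fun_cong[OF c, of x] by (simp add: d_def)
    then have "edge_int e (\<lambda>x. trace D v x - r x) = edge_int e (\<lambda>x. (v x - q x) + c)"
      using e by (intro edge_int_cong) (simp add: trace_continuous[OF v])
    also have "\<dots> = edge_int e (\<lambda>x. v x - q x) + edge_int e (\<lambda>_. c)"
      using cont[OF e] by (rule edge_int_add) auto
    finally show "edge_int e (\<lambda>x. trace D v x - r x) = edge_int e (\<lambda>x. v x - q x) + c * dist (fst e) (snd e)"
      by (simp add: edge_int_const)
  qed
  ultimately have "c * (\<Sum>e\<in>edges K. dist (fst e) (snd e)) = 0"
    using q r by (simp add: is_Pi_nabla_def sum.distrib sum_distrib_left)
  then have "c = 0" using perimeter_pos by simp
  then show ?thesis using c by (auto simp: d_def fun_eq_iff)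
qed

text \<open>The conditions on the space are linear, and a polynomial of degree \<open>p\<close> has
  a Laplacian of degree \<open>p - 2\<close>. Zero satisfies the conditions for the projection of
  the residual, so by uniqueness the chosen projection is zero as a total function.\<close>

lemma res_nabla_stab:
  assumes v: "v \<in> Vt_loc p K"
  shows "res_nabla \<kappa> p K v \<in> Vt_loc p K" "Pi_nabla \<kappa> p K (res_nabla \<kappa> p K v) = (\<lambda>_. 0)"
proof -
  define q where "q = Pi_nabla \<kappa> p K v"
  define w where "w = (\<lambda>x. v x - q x)"
  have w_eq: "res_nabla \<kappa> p K v = w" by (simp add: res_nabla_def w_def q_def)
  have vc: "continuous_on (closure D) v" and vH: "v \<in> H1 D"
    and ve: "\<And>e. e \<in> edges K \<Longrightarrow> poly_on (int p) (seg e) v"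
    using v by (auto simp: Vt_loc_def)
  obtain l where l: "l \<in> Pol (int p - 2)" "has_weak_div D (wgrad D v) l"
    using v by (auto simp: Vt_loc_def)
  have Pi: "is_Pi_nabla \<kappa> p K v q" unfolding q_def by (rule Pi_nabla[OF vH])
  then have q: "q \<in> Pol (int p)" by (simp add: is_Pi_nabla_def)
  obtain R where R: "C1 q R" using q by (rule Pol_C1)
  note w = wgrad_diff_Pol[OF vH R, folded w_def]
  have wc: "continuous_on (closure D) w"
    unfolding w_def using vc C1_continuous[OF R] by (rule continuous_on_diff)
  have "poly_on (int p) (seg e) w" if e: "e \<in> edges K" for e
  proof -
    obtain r where "r \<in> Pol (int p)" "\<forall>x\<in>seg e. v x = r x" using ve[OF e] by (auto simp: poly_on_def)
    then show ?thesis
      unfolding poly_on_def w_def using q by (intro bexI[of _ "\<lambda>x. r x - q x"]) (auto intro: Pol_diff)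
  qed
  moreover have "\<exists>d\<in>Pol (int p - 2). has_weak_div D (wgrad D w) d"
  proof -
    have RG: "R \<in> gradPol (int p)" using q R by (auto simp: gradPol_iff)
    obtain m where m: "m \<in> Pol (int p - 2)" "has_weak_div D R m"
      using gradPol_differential(2)[OF region RG] by blast
    obtain L M where LM: "C1 l L" "C1 m M" using Pol_C1[OF l(1)] Pol_C1[OF m(1)] by metis
    note L2s = wgrad(1)[OF vH] C1_L2(2)[OF R region] C1_L2(1)[OF LM(1) region] C1_L2(1)[OF LM(2) region]
    have "has_weak_div D (\<lambda>x. wgrad D v x - R x) (\<lambda>x. l x - m x)"
      using has_weak_div_diff[OF region L2s l(2) m(2)] .
    then have "has_weak_div D (wgrad D w) (\<lambda>x. l x - m x)"
      by (rule has_weak_div_cong_AE[OF region L2_diff[OF L2s(1,2)] wgrad(1)[OF w(1)], rotated])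
        (use w(2) in \<open>eventually_elim, simp\<close>)
    then show ?thesis using Pol_diff[OF l(1) m(1)] by blast
  qed
  ultimately show "res_nabla \<kappa> p K v \<in> Vt_loc p K"
    unfolding w_eq Vt_loc_def using wc w(1) by blast
  have "is_Pi_nabla \<kappa> p K w (\<lambda>_. 0)"
    unfolding is_Pi_nabla_def
  proof (intro conjI)
    show "(\<lambda>_. 0) \<in> Pol (int p)" by (rule Pol_0)
    show "\<forall>r\<in>Pol (int p). ip D (\<lambda>x. \<kappa> x *\<^sub>R wgrad D (\<lambda>y. w y - 0) x) (wgrad D r) = 0"
      using Pi by (simp add: is_Pi_nabla_def w_def)
    have "(\<Sum>e\<in>edges K. edge_int e (\<lambda>x. trace D w x - 0)) =
        (\<Sum>e\<in>edges K. edge_int e (\<lambda>x. trace D v x - q x))"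
      by (intro sum.cong refl edge_int_cong)
        (simp add: trace_continuous[OF vH vc] trace_continuous[OF w(1) wc], simp add: w_def)
    then show "(\<Sum>e\<in>edges K. edge_int e (\<lambda>x. trace D w x - 0)) = 0"
      using Pi by (simp add: is_Pi_nabla_def)
  qed
  then show "Pi_nabla \<kappa> p K (res_nabla \<kappa> p K v) = (\<lambda>_. 0)"
    unfolding w_eq using is_Pi_nabla_unique[OF w(1) wc Pi_nabla[OF w(1)]] by blast
qed

section \<open>The flux projection on one element\<close>

lemma Pi_mixed:
  assumes \<tau>: "\<tau> \<in> L2 D"
  shows "Pi_mixed \<kappa> p K \<tau> \<in> gradPol (int p + 1)"
    "\<And>s. s \<in> gradPol (int p + 1) \<Longrightarrow> ip D (\<lambda>x. \<tau> x - Pi_mixed \<kappa> p K \<tau> x) s = 0"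
proof -
  obtain q R where q: "q \<in> Pol (int p + 1)" "C1 q R"
    "\<And>r S. \<lbrakk>r \<in> Pol (int p + 1); C1 r S\<rbrakk> \<Longrightarrow> ip D (\<lambda>x. \<tau> x - R x) S = 0"
    using Pol_grad_projection[OF region \<tau>, of "int p + 1"] by metis
  have "R \<in> gradPol (int p + 1) \<and> (\<forall>s\<in>gradPol (int p + 1). form_a D \<kappa> (\<lambda>x. \<tau> x - R x) s = 0)"
    using q by (auto simp: gradPol_iff form_a_eq)
  then have "Pi_mixed \<kappa> p K \<tau> \<in> gradPol (int p + 1) \<and>
      (\<forall>s\<in>gradPol (int p + 1). form_a D \<kappa> (\<lambda>x. \<tau> x - Pi_mixed \<kappa> p K \<tau> x) s = 0)"
    unfolding Pi_mixed_def
    by (rule someI[of "\<lambda>r. r \<in> gradPol (int p + 1) \<and>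
        (\<forall>s\<in>gradPol (int p + 1). form_a D \<kappa> (\<lambda>x. \<tau> x - r x) s = 0)"])
  then show "Pi_mixed \<kappa> p K \<tau> \<in> gradPol (int p + 1)"
    "\<And>s. s \<in> gradPol (int p + 1) \<Longrightarrow> ip D (\<lambda>x. \<tau> x - Pi_mixed \<kappa> p K \<tau> x) s = 0"
    using k_pos by (auto simp: form_a_eq)
qed

text \<open>The chosen projection is orthogonal to itself, hence zero a.e. on the element; being the
  gradient of a polynomial, it is zero everywhere.\<close>

lemma Pi_mixed_eq_0:
  assumes \<tau>: "\<tau> \<in> L2 D" and orth: "\<And>s. s \<in> gradPol (int p + 1) \<Longrightarrow> ip D \<tau> s = 0"
  shows "Pi_mixed \<kappa> p K \<tau> = (\<lambda>_. 0)"
proof -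
  define R where "R = Pi_mixed \<kappa> p K \<tau>"
  note R = Pi_mixed[OF \<tau>, folded R_def]
  have R_L2: "R \<in> L2 D" using gradPol_differential(1)[OF region R(1)] .
  have "ip D R R = 0" using R(2)[OF R(1)] orth[OF R(1)] \<tau> R_L2 by (simp add: ip_diff_left)
  then have "AE x in lebesgue_on D. R x = 0" by (rule ip_self_eq_0[OF R_L2])
  moreover obtain q where "q \<in> Pol (int p + 1)" "C1 q R" using R(1) by (auto simp: gradPol_iff)
  ultimately show ?thesis
    using Pol_grad_eq_0(1)[OF _ _ region_open region_nonempty] by (simp add: R_def)
qed

text \<open>The products of the components of \<open>M\<close> with a test function vanish on the
  other edges along with it, so Green's formula for one edge applies to each. The normal component
  is the combination of the two components with the constant \<open>\<nu>\<close>, of degree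
  \<open>p\<close>.\<close>

lemma gradPol_edge_normal:
  assumes M: "M \<in> gradPol (int p + 1)" and e: "e \<in> edges K"
  obtains m where "m \<in> Pol (int p)" "edge_normal_eq K e M m"
proof -
  obtain i where i: "i < length K" "e = polygon_edge K i" using e by (auto simp: edges_eq)
  obtain \<nu> where \<nu>: "\<And>\<psi> H. \<lbrakk>C1 \<psi> H; \<forall>d\<in>edges K. d \<noteq> e \<longrightarrow> (\<forall>x\<in>seg d. \<psi> x = 0)\<rbrakk> \<Longrightarrow>
      (LINT x|lebesgue_on D. fst (H x)) = fst \<nu> * edge_int e \<psi> \<and>
      (LINT x|lebesgue_on D. snd (H x)) = snd \<nu> * edge_int e \<psi>"
    using green_polygon[OF simple i(1)] unfolding i(2) by metis
  obtain m m' H H' where m: "C1 m H" "C1 m' H'" "M = (\<lambda>x. (m x, m' x))"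
    "m \<in> Pol (int p)" "m' \<in> Pol (int p)"
    using gradPol_differential(4)[OF region M] by auto
  have M_L2: "M \<in> L2 D" using gradPol_differential(1)[OF region M] .
  note mL = C1_L2[OF m(1) region] C1_L2[OF m(2) region]
  have dL: "(\<lambda>x. fst (H x) + snd (H' x)) \<in> L2 D"
    using mL by (intro L2_add L2_fst L2_snd)
  have "has_weak_div D M (\<lambda>x. fst (H x) + snd (H' x))"
    unfolding m(3) by (rule C1_has_weak_div[OF region m(1,2)])
  note wd = wdiv_eq_AE[OF region M_L2 dL this]
  define n where "n = (\<lambda>x. fst \<nu> * m x + snd \<nu> * m' x)"
  have "n \<in> Pol (int p)" unfolding n_def using m by (intro Pol_add Pol_scale)
  moreover have "edge_normal_eq K e M n"
    unfolding edge_normal_eq_def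
  proof (intro allI impI)
    fix \<phi> G
    assume "C1 \<phi> G \<and> (\<forall>d\<in>edges K. d \<noteq> e \<longrightarrow> (\<forall>x\<in>seg d. \<phi> x = 0))"
    then have \<phi>: "C1 \<phi> G" and van: "\<forall>d\<in>edges K. d \<noteq> e \<longrightarrow> (\<forall>x\<in>seg d. \<phi> x = 0)" by auto
    note L = C1_L2[OF \<phi> region]
    note i1 = L2_integrable_inner[OF mL(1) L2_fst[OF L(2)]] L2_integrable_inner[OF mL(3) L2_snd[OF L(2)]]
      L2_integrable_inner[OF L2_fst[OF mL(2)] L(1)] L2_integrable_inner[OF L2_snd[OF mL(4)] L(1)]
    have "ip D (wdiv D M) \<phi> = ip D (\<lambda>x. fst (H x) + snd (H' x)) \<phi>"
      using wdiv(1)[OF wd(1)] dL L wd(2) by (intro ip_cong_AE) auto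
    then have "ip D M G + ip D (wdiv D M) \<phi> =
        (LINT x|lebesgue_on D. fst (m x *\<^sub>R G x + \<phi> x *\<^sub>R H x)) +
        (LINT x|lebesgue_on D. snd (m' x *\<^sub>R G x + \<phi> x *\<^sub>R H' x))"
      using i1 by (simp add: ip_def m(3) inner_prod_def distrib_right distrib_left mult.commute)
    also have "\<dots> = fst \<nu> * edge_int e (\<lambda>x. m x * \<phi> x) + snd \<nu> * edge_int e (\<lambda>x. m' x * \<phi> x)"
      using \<nu>[OF C1_mult[OF m(1) \<phi>]] \<nu>[OF C1_mult[OF m(2) \<phi>]] van by simp
    also have "\<dots> = edge_int e (\<lambda>x. fst \<nu> * (m x * \<phi> x) + snd \<nu> * (m' x * \<phi> x))"
      using C1_continuous[OF \<phi>] C1_continuous[OF m(1)] C1_continuous[OF m(2)]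
      by (subst edge_int_add) (auto simp: edge_int_scale intro!: continuous_intros)
    also have "(\<lambda>x. fst \<nu> * (m x * \<phi> x) + snd \<nu> * (m' x * \<phi> x)) = (\<lambda>x. n x * \<phi> x)"
      by (simp add: n_def algebra_simps)
    finally show "ip D M G + ip D (wdiv D M) \<phi> = edge_int e (\<lambda>x. n x * \<phi> x)" .
  qed
  ultimately show ?thesis by (rule that)
qed

text \<open>The conditions defining \<open>Sigma_loc\<close> are linear, and the projection meets
  each of them with polynomials of the right degree. The edge condition is the one that rests on
  Green's formula.\<close>

lemma res_mixed_stab:
  assumes \<tau>: "\<tau> \<in> Sigma_loc p K"
  shows "res_mixed \<kappa> p K \<tau> \<in> Sigma_loc p K" "Pi_mixed \<kappa> p K (res_mixed \<kappa> p K \<tau>) = (\<lambda>_. 0)"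
proof -
  define M where "M = Pi_mixed \<kappa> p K \<tau>"
  have res: "res_mixed \<kappa> p K \<tau> = (\<lambda>x. \<tau> x - M x)" by (simp add: res_mixed_def M_def)
  have \<tau>d: "\<tau> \<in> Hdiv D" and \<tau>n: "\<And>e. e \<in> edges K \<Longrightarrow> \<exists>m\<in>Pol (int p). edge_normal_eq K e \<tau> m"
    using \<tau> by (auto simp: Sigma_loc_def)
  obtain d r where d: "d \<in> Pol (int p - 1)" "has_weak_div D \<tau> d"
    and r: "r \<in> Pol (int p - 1)" "has_weak_rot D \<tau> r" using \<tau> by (auto simp: Sigma_loc_def)
  have \<tau>_L2: "\<tau> \<in> L2 D" using \<tau>d by (rule Hdiv_L2)
  note M = Pi_mixed[OF \<tau>_L2, folded M_def]
  have M_L2: "M \<in> L2 D" using gradPol_differential(1)[OF region M(1)] .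
  have p: "int p + 1 - 2 = int p - 1" by simp
  obtain d' where d': "d' \<in> Pol (int p - 1)" "has_weak_div D M d'"
    using gradPol_differential(2)[OF region M(1)] unfolding p by blast
  obtain r' where r': "r' \<in> Pol (int p - 1)" "has_weak_rot D M r'"
    using gradPol_differential(3)[OF region M(1)] unfolding p by blast
  have Pol_L2: "q \<in> L2 D" if "q \<in> Pol l" for q l
    using Pol_C1[OF that] C1_L2(1)[OF _ region] by metis
  have rot_L2: "(\<lambda>x. (- snd (v x), fst (v x))) \<in> L2 D" if "v \<in> L2 D" for v :: "point \<Rightarrow> point"
    using that by (rule L2_linear_comp) (auto simp: norm_Pair add.commute intro!: continuous_intros)
  have div: "has_weak_div D (\<lambda>x. \<tau> x - M x) (\<lambda>x. d x - d' x)"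
    using has_weak_div_diff[OF region \<tau>_L2 M_L2 Pol_L2[OF d(1)] Pol_L2[OF d'(1)] d(2) d'(2)] .
  have rot: "has_weak_rot D (\<lambda>x. \<tau> x - M x) (\<lambda>x. r x - r' x)"
    using has_weak_div_diff[OF region rot_L2[OF \<tau>_L2] rot_L2[OF M_L2] Pol_L2[OF r(1)] Pol_L2[OF r'(1)]
        r(2)[unfolded has_weak_rot_def] r'(2)[unfolded has_weak_rot_def]]
    by (simp add: has_weak_rot_def)
  have L: "(\<lambda>x. \<tau> x - M x) \<in> L2 D" using \<tau>_L2 M_L2 by (rule L2_diff)
  have dP: "(\<lambda>x. d x - d' x) \<in> Pol (int p - 1)" using d(1) d'(1) by (rule Pol_diff)
  have rP: "(\<lambda>x. r x - r' x) \<in> Pol (int p - 1)" using r(1) r'(1) by (rule Pol_diff)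
  have Md: "M \<in> Hdiv D" using M_L2 d' Pol_L2 by (auto simp: Hdiv_def)
  note dv = wdiv_diff[OF region \<tau>d Md]
  have "\<exists>m\<in>Pol (int p). edge_normal_eq K e (\<lambda>x. \<tau> x - M x) m" if e: "e \<in> edges K" for e
  proof -
    obtain m where m: "m \<in> Pol (int p)" "edge_normal_eq K e \<tau> m" using \<tau>n[OF e] by blast
    obtain m' where m': "m' \<in> Pol (int p)" "edge_normal_eq K e M m'"
      using gradPol_edge_normal[OF M(1) e] by blast
    obtain H H' where H: "C1 m H" "C1 m' H'" using Pol_C1[OF m(1)] Pol_C1[OF m'(1)] by metis
    have "edge_normal_eq K e (\<lambda>x. \<tau> x - M x) (\<lambda>x. m x - m' x)"
      unfolding edge_normal_eq_def
    proof (intro allI impI)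
      fix \<phi> G
      assume a: "C1 \<phi> G \<and> (\<forall>d\<in>edges K. d \<noteq> e \<longrightarrow> (\<forall>x\<in>seg d. \<phi> x = 0))"
      then have \<phi>: "C1 \<phi> G" by simp
      note L' = C1_L2[OF \<phi> region]
      have "ip D (wdiv D (\<lambda>x. \<tau> x - M x)) \<phi> = ip D (\<lambda>x. wdiv D \<tau> x - wdiv D M x) \<phi>"
        using wdiv(1)[OF dv(1)] wdiv(1)[OF \<tau>d] wdiv(1)[OF Md] L' dv(2)
        by (intro ip_cong_AE L2_diff) auto
      then have "ip D (\<lambda>x. \<tau> x - M x) G + ip D (wdiv D (\<lambda>x. \<tau> x - M x)) \<phi> =
          (ip D \<tau> G + ip D (wdiv D \<tau>) \<phi>) - (ip D M G + ip D (wdiv D M) \<phi>)"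
        using \<tau>_L2 M_L2 L' wdiv(1)[OF \<tau>d] wdiv(1)[OF Md] by (simp add: ip_diff_left)
      also have "\<dots> = edge_int e (\<lambda>x. m x * \<phi> x) - edge_int e (\<lambda>x. m' x * \<phi> x)"
        using m(2)[unfolded edge_normal_eq_def, rule_format, OF a]
          m'(2)[unfolded edge_normal_eq_def, rule_format, OF a] by simp
      also have "\<dots> = edge_int e (\<lambda>x. m x * \<phi> x - m' x * \<phi> x)"
        using C1_continuous[OF \<phi>] C1_continuous[OF H(1)] C1_continuous[OF H(2)]
        by (subst edge_int_diff) (auto intro!: continuous_intros)
      finally show "ip D (\<lambda>x. \<tau> x - M x) G + ip D (wdiv D (\<lambda>x. \<tau> x - M x)) \<phi> =
          edge_int e (\<lambda>x. (m x - m' x) * \<phi> x)" by (simp add: left_diff_distrib)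
    qed
    then show ?thesis using Pol_diff[OF m(1) m'(1)] by blast
  qed
  then show "res_mixed \<kappa> p K \<tau> \<in> Sigma_loc p K"
    unfolding res Sigma_loc_def
    using dv(1) L div rot dP rP Pol_L2 by (auto simp: Hrot_def)
  show "Pi_mixed \<kappa> p K (res_mixed \<kappa> p K \<tau>) = (\<lambda>_. 0)"
    unfolding res using L M(2) by (rule Pi_mixed_eq_0)
qed

end

section \<open>Local efficiency\<close>

lemma ip_self_add_le:
  assumes "v \<in> L2 D" "w \<in> L2 D"
  shows "ip D (\<lambda>x. v x + w x) (\<lambda>x. v x + w x) \<le> 2 * ip D v v + 2 * ip D w w"
proof -
  have "0 \<le> ip D (\<lambda>x. v x - w x) (\<lambda>x. v x - w x)" by (rule ip_self_nonneg)
  then show ?thesis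
    using assms by (simp add: ip_add_left ip_add_right ip_diff_left ip_diff_right L2_add L2_diff)
qed

context polygonal_element
begin

text \<open>Both stabilizations are bounded by residual energies, and the consistency term splits
  into the distances of the two projected discrete fields from the exact ones. All four quantities
  fall under \<open>projection_error\<close>.\<close>

lemma local_efficiency:
  assumes ut: "ut \<in> H1 D" and utn: "utn \<in> Vt_loc p K"
    and \<sigma>: "\<sigma> \<in> L2 D" and \<sigma>n: "\<sigma>n \<in> Sigma_loc p K"
    and flux: "AE x in lebesgue_on D. \<sigma> x = - (k *\<^sub>R wgrad D ut x)"
    and St: "primal_stab \<kappa> p K \<alpha>t_lo \<alpha>t (St K)" "0 \<le> \<alpha>t"
    and S: "mixed_stab \<kappa> p K \<alpha>_lo \<alpha> (S K)" "0 \<le> \<alpha>"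
  shows "eta_sq \<kappa> p St S utn \<sigma>n K \<le>
      4 * (1 + \<alpha>t) * (energy_norm \<kappa> K (\<lambda>x. ut x - utn x))\<^sup>2
      + 2 * (2 + \<alpha>t) * (energy_norm \<kappa> K (\<lambda>x. ut x - Pi_nabla \<kappa> p K ut x))\<^sup>2
      + 4 * (1 + \<alpha>) * (flux_norm \<kappa> K (\<lambda>x. \<sigma> x - \<sigma>n x))\<^sup>2
      + 2 * (2 + \<alpha>) * (flux_norm \<kappa> K (\<lambda>x. \<sigma> x - Pi_mixed \<kappa> p K \<sigma> x))\<^sup>2"
proof -
  have utnH: "utn \<in> H1 D" using utn by (simp add: Vt_loc_def)
  have \<sigma>nL: "\<sigma>n \<in> L2 D" using \<sigma>n Hdiv_L2 by (auto simp: Sigma_loc_def)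
  define g v where "g = wgrad D ut" and "v = wgrad D utn"
  have gv: "g \<in> L2 D" "v \<in> L2 D" unfolding g_def v_def using wgrad(1) ut utnH by auto
  define q r where "q = Pi_nabla \<kappa> p K utn" and "r = Pi_nabla \<kappa> p K ut"
  have is_q: "is_Pi_nabla \<kappa> p K utn q" and is_r: "is_Pi_nabla \<kappa> p K ut r"
    unfolding q_def r_def using Pi_nabla ut utnH by auto
  then have qr: "q \<in> Pol (int p)" "r \<in> Pol (int p)" by (auto simp: is_Pi_nabla_def)
  obtain P Q where PQ: "C1 q P" "C1 r Q" using Pol_C1[OF qr(1)] Pol_C1[OF qr(2)] by metis
  have PQ_L2: "P \<in> L2 D" "Q \<in> L2 D" using C1_L2(2)[OF _ region] PQ by auto
  have "(\<lambda>x. q x - r x) \<in> Pol (int p)" "C1 (\<lambda>x. q x - r x) (\<lambda>x. P x - Q x)"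
    using qr PQ by (auto intro: Pol_diff C1_diff)
  then have orth: "ip D (\<lambda>x. v x - P x) (\<lambda>x. P x - Q x) = 0"
    "ip D (\<lambda>x. g x - Q x) (\<lambda>x. P x - Q x) = 0"
    using is_q is_r unfolding g_def v_def
    by (auto simp: is_Pi_nabla_iff[OF utnH PQ(1)] is_Pi_nabla_iff[OF ut PQ(2)])
  define M N where "M = Pi_mixed \<kappa> p K \<sigma>n" and "N = Pi_mixed \<kappa> p K \<sigma>"
  note M = Pi_mixed[OF \<sigma>nL, folded M_def] and N = Pi_mixed[OF \<sigma>, folded N_def]
  have MN_L2: "M \<in> L2 D" "N \<in> L2 D" using gradPol_differential(1)[OF region] M(1) N(1) by auto
  have "(\<lambda>x. M x - N x) \<in> gradPol (int p + 1)"
  proof -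
    obtain m n where "m \<in> Pol (int p + 1)" "C1 m M" "n \<in> Pol (int p + 1)" "C1 n N"
      using M(1) N(1) by (auto simp: gradPol_iff)
    then have "(\<lambda>x. m x - n x) \<in> Pol (int p + 1)" "C1 (\<lambda>x. m x - n x) (\<lambda>x. M x - N x)"
      by (auto intro: Pol_diff C1_diff)
    then show ?thesis unfolding gradPol_iff by blast
  qed
  then have orth': "ip D (\<lambda>x. \<sigma>n x - M x) (\<lambda>x. M x - N x) = 0"
    "ip D (\<lambda>x. \<sigma> x - N x) (\<lambda>x. M x - N x) = 0" using M(2) N(2) by auto
  define A B where "A = ip D (\<lambda>x. g x - v x) (\<lambda>x. g x - v x)"
    and "B = ip D (\<lambda>x. g x - Q x) (\<lambda>x. g x - Q x)"
  define A' B' where "A' = ip D (\<lambda>x. \<sigma> x - \<sigma>n x) (\<lambda>x. \<sigma> x - \<sigma>n x)"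
    and "B' = ip D (\<lambda>x. \<sigma> x - N x) (\<lambda>x. \<sigma> x - N x)"
  note pe = projection_error[OF gv(2,1) PQ_L2 orth, folded A_def B_def]
  note me = projection_error[OF \<sigma>nL \<sigma> MN_L2 orth', folded A'_def B'_def]
  have energy: "(energy_norm \<kappa> K (\<lambda>x. u x - w x))\<^sup>2 = k * ip D (\<lambda>x. wgrad D u x - W x) (\<lambda>x. wgrad D u x - W x)"
    if "u \<in> H1 D" "(\<lambda>x. u x - w x) \<in> H1 D" "W \<in> L2 D"
      "AE x in lebesgue_on D. wgrad D (\<lambda>x. u x - w x) x = wgrad D u x - W x" for u w W
    unfolding energy_norm_sq using that wgrad(1)
    by (intro arg_cong[where f = "(*) k"] ip_cong_AE L2_diff) auto
  have eA: "(energy_norm \<kappa> K (\<lambda>x. ut x - utn x))\<^sup>2 = k * A"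
    unfolding A_def g_def v_def using wgrad_diff[OF region ut utnH] ut wgrad(1)[OF utnH] by (intro energy)
  have eB: "(energy_norm \<kappa> K (\<lambda>x. ut x - Pi_nabla \<kappa> p K ut x))\<^sup>2 = k * B"
    unfolding B_def g_def r_def[symmetric] using wgrad_diff_Pol[OF ut PQ(2)] ut PQ_L2 by (intro energy)
  have eR: "(energy_norm \<kappa> K (res_nabla \<kappa> p K utn))\<^sup>2 = k * ip D (\<lambda>x. v x - P x) (\<lambda>x. v x - P x)"
    unfolding res_nabla_def v_def q_def[symmetric] using wgrad_diff_Pol[OF utnH PQ(1)] utnH PQ_L2 by (intro energy)
  have stab: "St K (res_nabla \<kappa> p K utn) (res_nabla \<kappa> p K utn) \<le> \<alpha>t * (k * (2 * A + 2 * B))"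
  proof -
    have "St K (res_nabla \<kappa> p K utn) (res_nabla \<kappa> p K utn) \<le> \<alpha>t * (energy_norm \<kappa> K (res_nabla \<kappa> p K utn))\<^sup>2"
      using St(1) res_nabla_stab[OF utn] unfolding primal_stab_def Let_def by blast
    also have "\<dots> \<le> \<alpha>t * (k * (2 * A + 2 * B))"
      unfolding eR using pe(1) St(2) k_pos by (intro mult_left_mono) auto
    finally show ?thesis .
  qed
  have stab': "S K (res_mixed \<kappa> p K \<sigma>n) (res_mixed \<kappa> p K \<sigma>n) \<le> \<alpha> * (inverse k * (2 * A' + 2 * B'))"
  proof -
    have "S K (res_mixed \<kappa> p K \<sigma>n) (res_mixed \<kappa> p K \<sigma>n) \<le>
        \<alpha> * form_a D \<kappa> (res_mixed \<kappa> p K \<sigma>n) (res_mixed \<kappa> p K \<sigma>n)"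
      using S(1) res_mixed_stab[OF \<sigma>n] unfolding mixed_stab_def Let_def by blast
    also have "\<dots> \<le> \<alpha> * (inverse k * (2 * A' + 2 * B'))"
      unfolding form_a_eq res_mixed_def M_def[symmetric] using me(1) S(2) k_pos
      by (intro mult_left_mono) auto
    finally show ?thesis .
  qed
  define c where "c = sqrt k"
  have c: "0 < c" "c * c = k" using k_pos by (simp_all add: c_def)
  have L: "(\<lambda>x. c *\<^sub>R (P x - g x)) \<in> L2 D" "(\<lambda>x. inverse c *\<^sub>R (M x - \<sigma> x)) \<in> L2 D"
    using gv PQ_L2 MN_L2 \<sigma> by (auto intro: L2_scaleR L2_diff)
  have qH: "wgrad D q \<in> L2 D" "AE x in lebesgue_on D. wgrad D q x = P x"
    using wgrad(1)[OF C1_wgrad(1)[OF region PQ(1)]] C1_wgrad(2)[OF region PQ(1)] by auto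
  have "(L2norm D (\<lambda>x. sqrt (\<kappa> x) *\<^sub>R wgrad D q x + inverse (sqrt (\<kappa> x)) *\<^sub>R M x))\<^sup>2 =
      ip D (\<lambda>x. c *\<^sub>R wgrad D q x + inverse c *\<^sub>R M x) (\<lambda>x. c *\<^sub>R wgrad D q x + inverse c *\<^sub>R M x)"
    unfolding L2norm_sq ip_def by (rule Bochner_Integration.integral_cong) (auto simp: \<kappa>_eq c_def)
  \<comment> \<open>The exact fields, scaled by \<open>c\<close> and its inverse, sum to zero by the
    flux identity, so they may be subtracted inside the norm.\<close>
  also have "\<dots> = ip D (\<lambda>x. c *\<^sub>R (P x - g x) + inverse c *\<^sub>R (M x - \<sigma> x))
      (\<lambda>x. c *\<^sub>R (P x - g x) + inverse c *\<^sub>R (M x - \<sigma> x))"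
  proof -
    have "AE x in lebesgue_on D. c *\<^sub>R wgrad D q x + inverse c *\<^sub>R M x =
        c *\<^sub>R (P x - g x) + inverse c *\<^sub>R (M x - \<sigma> x)"
      using flux qH(2)
    proof eventually_elim
      case (elim x)
      have "inverse c *\<^sub>R \<sigma> x = - (c *\<^sub>R g x)"
        using elim(1) c(1) by (simp add: g_def flip: c(2))
      then show ?case using elim(2) by (simp add: scaleR_diff_right)
    qed
    moreover have "(\<lambda>x. c *\<^sub>R wgrad D q x + inverse c *\<^sub>R M x) \<in> L2 D"
      using qH(1) MN_L2(1) by (intro L2_add L2_scaleR)
    ultimately show ?thesis using L2_add[OF L] by (intro ip_cong_AE)
  qed
  also have "\<dots> \<le> 2 * (k * ip D (\<lambda>x. P x - g x) (\<lambda>x. P x - g x)) +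
      2 * (inverse k * ip D (\<lambda>x. M x - \<sigma> x) (\<lambda>x. M x - \<sigma> x))"
    using ip_self_add_le[OF L]
    by (simp add: ip_scaleR_left ip_scaleR_right c(2) flip: mult.assoc inverse_mult_distrib)
  also have "\<dots> \<le> 2 * (k * (2 * A + 2 * B)) + 2 * (inverse k * (2 * A' + 2 * B'))"
    using pe(2) me(2) k_pos by (intro add_mono mult_left_mono) auto
  finally have main: "eta_sq \<kappa> p St S utn \<sigma>n K \<le>
      2 * (k * (2 * A + 2 * B)) + 2 * (inverse k * (2 * A' + 2 * B')) +
      \<alpha>t * (k * (2 * A + 2 * B)) + \<alpha> * (inverse k * (2 * A' + 2 * B'))"
    using stab stab' unfolding eta_sq_def q_def M_def by linarith
  have nn: "0 \<le> k * A" "0 \<le> k * B" "0 \<le> inverse k * A'" "0 \<le> inverse k * B'"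
    unfolding A_def B_def A'_def B'_def using k_pos
    by (intro mult_nonneg_nonneg ip_self_nonneg; simp)+
  \<comment> \<open>The derived factor of the discretization errors is 4 plus twice the stability
    constant; these nonnegative terms raise it to the stated \<open>4 * (1 + \<alpha>t)\<close> and
    \<open>4 * (1 + \<alpha>)\<close>. For the projection errors the factors agree exactly.\<close>
  have "0 \<le> \<alpha>t * (k * A)" "0 \<le> \<alpha> * (inverse k * A')" using nn St(2) S(2) by auto
  then show ?thesis
    using main unfolding eA eB flux_norm_sq N_def[symmetric] A'_def[symmetric] B'_def[symmetric]
    by (simp add: algebra_simps)
qed

end

section \<open>From the domain to its elements\<close>

lemma polygonal_domain_open_bounded:
  assumes "polygonal_domain \<Omega> E"
  shows "open \<Omega>" "bounded \<Omega>"
proof -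
  obtain P H where P: "simple_polygon P" "finite H"
    "\<Omega> = region P - (\<Union>Q\<in>H. closure (region Q))"
    using assms unfolding polygonal_domain_def by blast
  show "open \<Omega>" unfolding P(3) using region_facts(1)[OF P(1)] P(2) by (intro open_Diff closed_UN) auto
  show "bounded \<Omega>" using region_facts(2)[OF P(1)] by (rule bounded_subset) (auto simp: P(3))
qed

text \<open>The lower bound on the coefficient holds only a.e., but a nonempty open set is not null,
  so it reaches the constant value.\<close>

lemma coefficient_pos:
  assumes "coefficient \<Omega> \<kappa>" "open D" "D \<noteq> {}" "D \<subseteq> \<Omega>" "open \<Omega>" "\<And>x. x \<in> D \<Longrightarrow> \<kappa> x = k"
  shows "0 < k"
proof (rule ccontr)
  assume k: "\<not> 0 < k"
  have "AE x in lebesgue_on \<Omega>. 0 < \<kappa> x" using coefficient_L2(3)[OF assms(1) L2_0] .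
  then have "AE x in lebesgue_on D. 0 < \<kappa> x"
    by (rule AE_lebesgue_on_subset[OF _ assms(4)]) (simp_all add: borel_open assms)
  then have "AE x in lebesgue. x \<in> D \<longrightarrow> 0 < \<kappa> x" using assms(2) by (simp add: AE_restrict_space_iff)
  then have "AE x\<in>D in lebesgue. x \<in> {}" by eventually_elim (use assms(6) k in auto)
  then show False using mem_closed_if_AE_lebesgue_open[OF assms(2) closed_empty] assms(3) by blast
qed

theorem theorem3p2:
  fixes \<Omega> \<Gamma>D \<Gamma>N :: "point set" and E :: "edge set" and T :: "polygon set"
    and \<kappa> f gD gN :: "point \<Rightarrow> real"
    and \<gamma> \<gamma>' :: real and p :: nat
    and St :: "polygon \<Rightarrow> (point \<Rightarrow> real) \<Rightarrow> (point \<Rightarrow> real) \<Rightarrow> real"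
    and S :: "polygon \<Rightarrow> (point \<Rightarrow> point) \<Rightarrow> (point \<Rightarrow> point) \<Rightarrow> real"
    and \<alpha>t_lo \<alpha>t_up \<alpha>_lo \<alpha>_up :: "polygon \<Rightarrow> real"
    and ut u utn un :: "point \<Rightarrow> real" and \<sigma> \<sigma>n :: "point \<Rightarrow> point"
  assumes domain: "polygonal_domain \<Omega> E"
    and mesh: "conforming_mesh \<Omega> T"
    and boundary: "boundary_partition \<Omega> T \<Gamma>D \<Gamma>N"
    and G1: "0 < \<gamma>" "mesh_G1 \<gamma> T"
    and G2: "0 < \<gamma>'" "mesh_G2 \<gamma>' T"
    and degree: "1 \<le> p"
    and coefficient: "coefficient \<Omega> \<kappa>"
    and K: "\<And>K. K \<in> T \<Longrightarrow> \<kappa> constant_on region K"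
    and data: "f \<in> L2 \<Omega>" "gD \<in> H12 \<Omega> E \<Gamma>D"
    and D: "data_D \<Omega> T p \<Gamma>D \<Gamma>N gD gN"
    and St: "\<And>K. K \<in> T \<Longrightarrow> 0 < \<alpha>t_lo K \<and> \<alpha>t_lo K \<le> \<alpha>t_up K"
            "\<And>K. K \<in> T \<Longrightarrow> primal_stab \<kappa> p K (\<alpha>t_lo K) (\<alpha>t_up K) (St K)"
    and S: "\<And>K. K \<in> T \<Longrightarrow> 0 < \<alpha>_lo K \<and> \<alpha>_lo K \<le> \<alpha>_up K"
           "\<And>K. K \<in> T \<Longrightarrow> mixed_stab \<kappa> p K (\<alpha>_lo K) (\<alpha>_up K) (S K)"
    and primal: "primal_solution \<Omega> E \<Gamma>D \<Gamma>N \<kappa> f gD gN ut"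
    and mixed: "mixed_solution \<Omega> E \<Gamma>D \<Gamma>N \<kappa> f gD gN \<sigma> u"
    and primal_vem: "primal_vem_solution \<Omega> E T p \<Gamma>D \<Gamma>N \<kappa> f gD gN St utn"
    and mixed_vem: "mixed_vem_solution \<Omega> E T p \<Gamma>D \<Gamma>N \<kappa> f gD gN S \<sigma>n un"
  shows "\<forall>K\<in>T. eta_sq \<kappa> p St S utn \<sigma>n K \<le>
      4 * (1 + \<alpha>t_up K) * (energy_norm \<kappa> K (\<lambda>x. ut x - utn x))\<^sup>2
      + 2 * (2 + \<alpha>t_up K) * (energy_norm \<kappa> K (\<lambda>x. ut x - Pi_nabla \<kappa> p K ut x))\<^sup>2
      + 4 * (1 + \<alpha>_up K) * (flux_norm \<kappa> K (\<lambda>x. \<sigma> x - \<sigma>n x))\<^sup>2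
      + 2 * (2 + \<alpha>_up K) * (flux_norm \<kappa> K (\<lambda>x. \<sigma> x - Pi_mixed \<kappa> p K \<sigma> x))\<^sup>2"
proof (rule ballI, goal_cases)
  case (1 K)
  then have KT: "K \<in> T" .
  note \<Omega> = polygonal_domain_open_bounded[OF domain]
  have simple: "simple_polygon K" and sub: "region K \<subseteq> \<Omega>"
    using conjunct1[OF conjunct2[OF mesh[unfolded conforming_mesh_def]]] KT by blast+
  note region = region_facts[OF simple]
  obtain k where k: "\<And>x. x \<in> region K \<Longrightarrow> \<kappa> x = k" using K[OF KT] unfolding constant_on_def by blast
  have "0 < k" using coefficient_pos[OF coefficient region(1,3) sub \<Omega>(1) k] .
  then interpret polygonal_element K \<kappa> k p
    using simple k by unfold_locales
  have \<Gamma>: "frontier \<Omega> = \<Gamma>D \<union> \<Gamma>N" "\<Gamma>D \<inter> \<Gamma>N = {}" 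
    using boundary unfolding boundary_partition_def by blast+
  have ut: "ut \<in> H1 \<Omega>" using primal by (simp add: primal_solution_def)
  note ut_D = wgrad_restrict[OF \<Omega> sub region(1) ut]
  have "\<sigma> \<in> L2 \<Omega>" using mixed Hdiv_L2 unfolding mixed_solution_def by blast
  then have \<sigma>: "\<sigma> \<in> L2 (region K)"
    by (rule L2_restrict[OF _ sub]) (simp_all add: borel_open region(1) \<Omega>(1))
  have utn: "utn \<in> Vt_loc p K"
    using primal_vem KT by (simp add: primal_vem_solution_def Vt_bc_def Vt_def)
  have \<sigma>n: "\<sigma>n \<in> Sigma_loc p K"
    using mixed_vem KT by (simp add: mixed_vem_solution_def Sigma_n_def)
  have "AE x in lebesgue_on \<Omega>. \<sigma> x = - (\<kappa> x *\<^sub>R wgrad \<Omega> ut x)"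
    using mixed_flux_eq[OF \<Omega> \<Gamma> coefficient data(1) primal mixed] .
  then have "AE x in lebesgue_on (region K). \<sigma> x = - (\<kappa> x *\<^sub>R wgrad \<Omega> ut x)"
    by (rule AE_lebesgue_on_subset[OF _ sub]) (simp_all add: borel_open region(1) \<Omega>(1))
  \<comment> \<open>The value \<open>k\<close> of \<open>\<kappa>\<close> is known only inside the
    element, so membership is carried along as an a.e. fact, next to the flux identity and the
    agreement of the local and the global weak gradient.\<close>
  moreover have "AE x in lebesgue_on (region K). x \<in> region K" by (rule AE_I2) simp
  ultimately have flux: "AE x in lebesgue_on (region K). \<sigma> x = - (k *\<^sub>R wgrad (region K) ut x)"
    using ut_D(2) by eventually_elim (simp add: k)
  show ?case
    using St(1)[OF KT] S(1)[OF KT]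
    by (intro local_efficiency[where St = St and S = S, OF ut_D(1) utn \<sigma> \<sigma>n flux St(2)[OF KT] _ S(2)[OF KT]])
      auto
qed

end
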